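(* Let $\Omega$, $\mathcal O=(0,0)$, $\alpha\in[0,\pi]$, $\Omega^*$, $\partial^{\pm}\Omega^*$, $\gamma$, $\gamma^{\pm}$, $A_I^{\pm}$, $A_S^{\pm}$, and the cases (I), (D), (ID), (DI) with side fan sizes $\beta^{\pm}$ be as described in the context, and let $\kappa,\lambda$ be real constants. Let $f$ be a bounded solution of $$\nabla\cdot Tf=\kappa f+\lambda\ \text{ in }\Omega,\qquad Tf=\frac{\nabla f}{\sqrt{1+|\nabla f|^2}},$$ which satisfies $Tf\cdot\nu=\cos\gamma$ on $\partial^{\pm}\Omega^*\setminus\{\mathcal O\}$ and which is discontinuous at $\mathcal O$, and assume that the radial limit $Rf(\theta)$ exists for all $\theta\in(-\alpha,\alpha)$. Let $m\in[-1,1]$ and set $\sigma=\cos^{-1}(m)\in[0,\pi]$. (a) If $A_I^{+}(b)\le mb$ for all $b\in(0,1)$ and case (I) or (DI) holds, then $\beta^{+}\ge\sigma$. (b) If $A_I^{-}(b)\le mb$ for all $b\in(0,1)$ and case (D) or (DI) holds, then $\beta^{-}\ge\sigma$. (c) If $A_S^{-}(b)\ge mb$ for all $b\in(0,1)$ and case (I) or (ID) holds, then $\beta^{-}\ge\pi-\sigma$. (d) If $A_S^{+}(b)\ge mb$ for all $b\in(0,1)$ and case (D) or (ID) holds, then $\beta^{+}\ge\pi-\sigma$.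
   Context: $\Omega$ is a region in $\mathbb R^2$ with a corner at $\mathcal O=(0,0)\in\partial\Omega$; $(r,\theta)$ are polar coordinates about $\mathcal O$. For some $\delta^*>0$, $B_{\delta^*}(\mathcal O)$ is the ball of radius $\delta^*$ about $\mathcal O$ and $\Omega^*=\Omega\cap B_{\delta^*}(\mathcal O)$. It is assumed that $\partial\Omega$ is piecewise smooth and that $\partial\Omega\cap B_{\delta^*}(\mathcal O)$ consists of two arcs $\partial^{+}\Omega^*$ and $\partial^{-}\Omega^*$ meeting at $\mathcal O$, whose tangent lines approach the lines $\theta=\alpha$ and $\theta=-\alpha$ respectively as $\mathcal O$ is approached, so that near $\mathcal O$ the region $\Omega$ is tangentially modelled on the sector $-\alpha<\theta<\alpha$. $\nu$ is the exterior unit normal on $\partial\Omega$, and $\gamma$ (the contact angle) is a (measurable) function of position on $\partial\Omega$ with $0\le\gamma\le\pi$. Let $(x^{\pm}(s),y^{\pm}(s))$ be an arclength parametrization of $\partial^{\pm}\Omega^*$ measured from the corner, so $(x^{\pm}(0),y^{\pm}(0))=(0,0)$; set $\gamma^{\pm}(s)=\gamma(x^{\pm}(s),y^{\pm}(s))$. For $0<b<1$ define $$A_I^{\pm}(b)=\liminf_{\epsilon\downarrow0}\frac1\epsilon\int_0^{b\epsilon}\cos(\gamma^{\pm}(t))\,dt,\qquad A_S^{\pm}(b)=\limsup_{\epsilon\downarrow0}\frac1\epsilon\int_0^{b\epsilon}\cos(\gamma^{\pm}(t))\,dt.$$ A solution $f$ is a function in $C^2(\Omega)$ satisfying the equation in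 $\Omega$. "Discontinuous at $\mathcal O$" means that $f$ does not extend continuously to $\mathcal O$ from $\Omega$. The radial limits are $Rf(\theta)=\lim_{r\to0^+}f(r\cos\theta,r\sin\theta)$ for $-\alpha<\theta<\alpha$. Cases. Case (I) (respectively (D)): there exist $-\alpha\le\alpha_1<\alpha_2\le\alpha$ such that $Rf$ is constant on $(-\alpha,\alpha_1]$ and on $[\alpha_2,\alpha)$ and strictly increasing (respectively strictly decreasing) on $[\alpha_1,\alpha_2]\cap(-\alpha,\alpha)$. Case (ID) (respectively (DI)): there exist $-\alpha\le\alpha_1<\alpha_L<\alpha_R<\alpha_2\le\alpha$ with $\alpha_R=\alpha_L+\pi$ such that $Rf$ is constant on $(-\alpha,\alpha_1]$, $[\alpha_L,\alpha_R]$ and $[\alpha_2,\alpha)$, and $Rf$ is increasing (respectively decreasing) on $[\alpha_1,\alpha_L]\cap(-\alpha,\alpha)$ and decreasing (respectively increasing) on $[\alpha_R,\alpha_2]\cap(-\alpha,\alpha)$. In all these cases $(-\alpha,\alpha_1]$ and $[\alpha_2,\alpha)$ are the full side fans, i.e. $Rf$ is not constant on $(-\alpha,\alpha']$ for any $\alpha'\in(\alpha_1,\alpha)$ and not constant on $[\alpha'',\alpha)$ for any $\alpha''\in(-\alpha,\alpha_2)$. The sizes of the side fans are $\beta^{-}=\alpha_1+\alpha$ and $\beta^{+}=\alpha-\alpha_2$. *)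

theory Defs
  imports "HOL-Analysis.Analysis"
begin

definition polar :: "real \<Rightarrow> real \<Rightarrow> real \<times> real" where
  "polar r \<theta> = (r * cos \<theta>, r * sin \<theta>)"


section \<open>The capillary equation\<close>

definition grad :: "('a::euclidean_space \<Rightarrow> real) \<Rightarrow> 'a \<Rightarrow> 'a" where
  "grad f x = (\<Sum>i\<in>Basis. frechet_derivative f (at x) i *\<^sub>R i)"

definition div_field :: "('a::euclidean_space \<Rightarrow> 'a) \<Rightarrow> 'a \<Rightarrow> real" where
  "div_field V x = (\<Sum>i\<in>Basis. frechet_derivative V (at x) i \<bullet> i)"

text \<open>For open \<open>S\<close>: the first and second derivatives exist on \<open>S\<close> and are continuous there.\<close>

definition C2_on :: "'a::euclidean_space set \<Rightarrow> ('a \<Rightarrow> real) \<Rightarrow> bool" where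
  "C2_on S f \<longleftrightarrow>
     (\<forall>x\<in>S. f differentiable (at x)) \<and>
     (\<forall>x\<in>S. grad f differentiable (at x)) \<and>
     (\<forall>i\<in>Basis. continuous_on S (\<lambda>x. frechet_derivative (grad f) (at x) i))"

definition T_op :: "('a::euclidean_space \<Rightarrow> real) \<Rightarrow> 'a \<Rightarrow> 'a" where
  "T_op f x = (1 / sqrt (1 + (norm (grad f x))\<^sup>2)) *\<^sub>R grad f x"

definition capillary_solution ::
    "'a::euclidean_space set \<Rightarrow> real \<Rightarrow> real \<Rightarrow> ('a \<Rightarrow> real) \<Rightarrow> bool" where
  "capillary_solution \<Omega> \<kappa> lam f \<longleftrightarrow>
     C2_on \<Omega> f \<and> (\<forall>x\<in>\<Omega>. div_field (T_op f) x = \<kappa> * f x + lam)"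

text \<open>
  A solution is only required to be twice continuously differentiable in the open set \<open>\<Omega>\<close>, so
  the value of \<open>Tf \<bullet> \<nu>\<close> at a boundary point \<open>p\<close> is understood as a nontangential
  limit from \<open>\<Omega>\<close>. This covers solutions for which \<open>Tf\<close> extends continuously to \<open>p\<close>, and,
  unlike an unrestricted limit, it does not force the contact angle to be continuous.
\<close>

definition nontangential_limit ::
    "'a::euclidean_space set \<Rightarrow> ('a \<Rightarrow> real) \<Rightarrow> 'a \<Rightarrow> real \<Rightarrow> bool" where
  "nontangential_limit \<Omega> g p c \<longleftrightarrow>
     (\<forall>M. (g \<longlongrightarrow> c) (at p within {x \<in> \<Omega>. dist x p \<le> M * infdist x (frontier \<Omega>)}))"


section \<open>Domains with a corner at the origin\<close>

text \<open>
  The boundary is, near each of its points, a finite union of regular \<open>C\<^sup>1\<close> arcs.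
\<close>

definition piecewise_smooth_boundary :: "(real \<times> real) set \<Rightarrow> bool" where
  "piecewise_smooth_boundary \<Omega> \<longleftrightarrow>
     (\<forall>p\<in>frontier \<Omega>. \<exists>r>0. \<exists>G. finite G \<and>
        (\<forall>g\<in>G. arc g \<and> g C1_differentiable_on {0..1} \<and>
               (\<forall>t\<in>{0..1}. vector_derivative g (at t) \<noteq> 0)) \<and>
        frontier \<Omega> \<inter> cball p r = (\<Union>g\<in>G. path_image g) \<inter> cball p r)"

text \<open>
  \<open>p\<close> is the arclength parametrization, starting at the origin, of an arc which runs to the
  circle of radius \<open>\<delta>\<close> and has tangent direction \<open>(cos \<phi>, sin \<phi>)\<close> in the limit at the
  origin. The part of it inside the open disc of radius \<open>\<delta>\<close> is \<open>p ` {0..<L}\<close>.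
\<close>

definition boundary_arc :: "real \<Rightarrow> real \<Rightarrow> (real \<Rightarrow> real \<times> real) \<Rightarrow> real \<Rightarrow> bool" where
  "boundary_arc \<delta> \<phi> p L \<longleftrightarrow>
     0 < L \<and> p 0 = 0 \<and>
     continuous_on {0..L} p \<and> inj_on p {0..L} \<and>
     (\<forall>s\<in>{0..<L}. norm (p s) < \<delta>) \<and> norm (p L) = \<delta> \<and>
     p C1_differentiable_on {0<..<L} \<and>
     (\<forall>s\<in>{0<..<L}. norm (vector_derivative p (at s)) = 1) \<and>
     ((\<lambda>s. vector_derivative p (at s)) \<longlongrightarrow> (cos \<phi>, sin \<phi>)) (at_right 0)"

text \<open>
  The last condition says that near the origin \<open>\<Omega>\<close> is the set between the two arcs, written in
  polar coordinates, and that it is tangent there to the sector \<open>-\<alpha> < \<theta> < \<alpha>\<close>. For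
  \<open>\<alpha> = \<pi>\<close> the two arcs have the same tangent at the origin, and it is this condition that
  tells which of them is approached as \<open>\<theta>\<close> increases to \<open>\<alpha>\<close>; the functions \<open>\<theta>p\<close>
  and \<open>\<theta>m\<close> may then exceed \<open>\<pi>\<close> in absolute value.
\<close>

definition corner_domain ::
    "(real \<times> real) set \<Rightarrow> real \<Rightarrow> real \<Rightarrow>
     (real \<Rightarrow> real \<times> real) \<Rightarrow> real \<Rightarrow> (real \<Rightarrow> real \<times> real) \<Rightarrow> real \<Rightarrow> bool" where
  "corner_domain \<Omega> \<alpha> \<delta> pp Lp pm Lm \<longleftrightarrow>
     open \<Omega> \<and> connected \<Omega> \<and> 0 \<in> frontier \<Omega> \<and> piecewise_smooth_boundary \<Omega> \<and>
     0 < \<delta> \<and>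
     boundary_arc \<delta> \<alpha> pp Lp \<and> boundary_arc \<delta> (- \<alpha>) pm Lm \<and>
     frontier \<Omega> \<inter> ball 0 \<delta> = pp ` {0..<Lp} \<union> pm ` {0..<Lm} \<and>
     pp ` {0..<Lp} \<inter> pm ` {0..<Lm} = {0} \<and>
     (\<exists>\<rho>>0. \<exists>\<theta>p \<theta>m.
        (\<theta>p \<longlongrightarrow> \<alpha>) (at_right 0) \<and> (\<theta>m \<longlongrightarrow> - \<alpha>) (at_right 0) \<and>
        (\<forall>r\<in>{0<..<\<rho>}. polar r (\<theta>p r) \<in> pp ` {0..<Lp} \<and> polar r (\<theta>m r) \<in> pm ` {0..<Lm}) \<and>
        \<Omega> \<inter> ball 0 \<rho> = {polar r \<theta> | r \<theta>. 0 < r \<and> r < \<rho> \<and> \<theta>m r < \<theta> \<and> \<theta> < \<theta>p r})"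

text \<open>\<open>n\<close> is the exterior unit normal to \<open>\<Omega>\<close> at the point \<open>p s\<close> of the boundary arc \<open>p\<close>.\<close>

definition exterior_unit_normal ::
    "(real \<times> real) set \<Rightarrow> (real \<Rightarrow> real \<times> real) \<Rightarrow> real \<Rightarrow> real \<times> real \<Rightarrow> bool" where
  "exterior_unit_normal \<Omega> p s n \<longleftrightarrow>
     norm n = 1 \<and> n \<bullet> vector_derivative p (at s) = 0 \<and>
     (\<forall>\<^sub>F t in at_right 0. p s - t *\<^sub>R n \<in> \<Omega> \<and> p s + t *\<^sub>R n \<notin> closure \<Omega>)"


section \<open>Averaged contact angles\<close>

text \<open>
  Here \<open>g\<close> is the contact angle along a boundary arc as a function of arclength. The averages
  are bounded, so nothing is lost by taking the lower and upper limits in the extended reals.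
\<close>

definition A_I :: "(real \<Rightarrow> real) \<Rightarrow> real \<Rightarrow> ereal" where
  "A_I g b = Liminf (at_right 0) (\<lambda>\<epsilon>. ereal (1 / \<epsilon> * integral {0..b * \<epsilon>} (\<lambda>t. cos (g t))))"

definition A_S :: "(real \<Rightarrow> real) \<Rightarrow> real \<Rightarrow> ereal" where
  "A_S g b = Limsup (at_right 0) (\<lambda>\<epsilon>. ereal (1 / \<epsilon> * integral {0..b * \<epsilon>} (\<lambda>t. cos (g t))))"


section \<open>Radial limits\<close>

definition radial_limit_exists :: "(real \<times> real \<Rightarrow> real) \<Rightarrow> real \<Rightarrow> bool" where
  "radial_limit_exists f \<theta> \<longleftrightarrow> (\<exists>l. ((\<lambda>r. f (polar r \<theta>)) \<longlongrightarrow> l) (at_right 0))"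

definition radial_limit :: "(real \<times> real \<Rightarrow> real) \<Rightarrow> real \<Rightarrow> real" where
  "radial_limit f \<theta> = Lim (at_right 0) (\<lambda>r. f (polar r \<theta>))"

text \<open>\<open>(-\<alpha>, \<alpha>1]\<close> and \<open>[\<alpha>2, \<alpha>)\<close> are the full side fans; either may be empty.\<close>

definition side_fans :: "real \<Rightarrow> (real \<Rightarrow> real) \<Rightarrow> real \<Rightarrow> real \<Rightarrow> bool" where
  "side_fans \<alpha> R \<alpha>1 \<alpha>2 \<longleftrightarrow>
     R constant_on {-\<alpha><..\<alpha>1} \<and> R constant_on {\<alpha>2..<\<alpha>} \<and>
     (\<forall>\<alpha>'\<in>{\<alpha>1<..<\<alpha>}. \<not> R constant_on {-\<alpha><..\<alpha>'}) \<and>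
     (\<forall>\<alpha>''\<in>{-\<alpha><..<\<alpha>2}. \<not> R constant_on {\<alpha>''..<\<alpha>})"

definition case_I :: "real \<Rightarrow> (real \<Rightarrow> real) \<Rightarrow> real \<Rightarrow> real \<Rightarrow> bool" where
  "case_I \<alpha> R \<alpha>1 \<alpha>2 \<longleftrightarrow>
     -\<alpha> \<le> \<alpha>1 \<and> \<alpha>1 < \<alpha>2 \<and> \<alpha>2 \<le> \<alpha> \<and> side_fans \<alpha> R \<alpha>1 \<alpha>2 \<and>
     strict_mono_on ({\<alpha>1..\<alpha>2} \<inter> {-\<alpha><..<\<alpha>}) R"

definition case_D :: "real \<Rightarrow> (real \<Rightarrow> real) \<Rightarrow> real \<Rightarrow> real \<Rightarrow> bool" where
  "case_D \<alpha> R \<alpha>1 \<alpha>2 \<longleftrightarrow>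
     -\<alpha> \<le> \<alpha>1 \<and> \<alpha>1 < \<alpha>2 \<and> \<alpha>2 \<le> \<alpha> \<and> side_fans \<alpha> R \<alpha>1 \<alpha>2 \<and>
     strict_antimono_on ({\<alpha>1..\<alpha>2} \<inter> {-\<alpha><..<\<alpha>}) R"

definition case_ID :: "real \<Rightarrow> (real \<Rightarrow> real) \<Rightarrow> real \<Rightarrow> real \<Rightarrow> bool" where
  "case_ID \<alpha> R \<alpha>1 \<alpha>2 \<longleftrightarrow>
     (\<exists>\<alpha>L \<alpha>R. -\<alpha> \<le> \<alpha>1 \<and> \<alpha>1 < \<alpha>L \<and> \<alpha>L < \<alpha>R \<and> \<alpha>R < \<alpha>2 \<and> \<alpha>2 \<le> \<alpha> \<and> \<alpha>R = \<alpha>L + pi \<and>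
        side_fans \<alpha> R \<alpha>1 \<alpha>2 \<and> R constant_on {\<alpha>L..\<alpha>R} \<and>
        mono_on ({\<alpha>1..\<alpha>L} \<inter> {-\<alpha><..<\<alpha>}) R \<and>
        antimono_on ({\<alpha>R..\<alpha>2} \<inter> {-\<alpha><..<\<alpha>}) R)"

definition case_DI :: "real \<Rightarrow> (real \<Rightarrow> real) \<Rightarrow> real \<Rightarrow> real \<Rightarrow> bool" where
  "case_DI \<alpha> R \<alpha>1 \<alpha>2 \<longleftrightarrow>
     (\<exists>\<alpha>L \<alpha>R. -\<alpha> \<le> \<alpha>1 \<and> \<alpha>1 < \<alpha>L \<and> \<alpha>L < \<alpha>R \<and> \<alpha>R < \<alpha>2 \<and> \<alpha>2 \<le> \<alpha> \<and> \<alpha>R = \<alpha>L + pi \<and>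
        side_fans \<alpha> R \<alpha>1 \<alpha>2 \<and> R constant_on {\<alpha>L..\<alpha>R} \<and>
        antimono_on ({\<alpha>1..\<alpha>L} \<inter> {-\<alpha><..<\<alpha>}) R \<and>
        mono_on ({\<alpha>R..\<alpha>2} \<inter> {-\<alpha><..<\<alpha>}) R)"

end

theory Submission
  imports Defs
begin

text \<open>
  The proof is a comparison of \<open>Tf\<close> with constant vector fields. Consider assertion (a). Near
  \<open>\<alpha>2\<close> there are directions \<open>\<theta>1 < \<theta>2\<close> with \<open>Rf(\<theta>1) < Rf(\<theta>2)\<close>. Let \<open>e\<close> be a unit vector which makes an
  acute angle with every direction from \<open>\<theta>1\<close> to \<open>\<alpha>\<close>, and let \<open>\<phi>\<close> be the function that vanishes up to
  the ray \<open>\<theta>1\<close>, is \<open>H(f)\<close> between the rays \<open>\<theta>1\<close> and \<open>\<theta>2\<close>, and is \<open>1\<close> from there to the boundary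
  arc. Here \<open>H\<close> is a nondecreasing \<open>C\<^sup>1\<close> step, equal to \<open>0\<close> at the values of \<open>f\<close> on the first ray and to
  \<open>1\<close> at those on the second, so that \<open>\<phi>\<close> has no jump close to the corner. The field
  \<open>V = \<phi> (Tf - e)\<close> has the following properties.

  \<^item> Its divergence is bounded below. Indeed \<open>div Tf = \<kappa> f + \<lambda>\<close> is bounded, and
    \<open>\<nabla>f \<bullet> Tf \<ge> |\<nabla>f| - 1 \<ge> \<nabla>f \<bullet> e - 1\<close>, so the large gradient of \<open>f\<close> contributes with the right sign.
  \<^item> It vanishes on the ray \<open>\<theta>1\<close>, and \<open>V \<bullet> e \<le> 0\<close> because \<open>|Tf| \<le> 1\<close>.

  The divergence theorem on the region between the ray \<open>\<theta>1\<close> and the boundary arc, cut off by a line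
  orthogonal to \<open>e\<close> through the point of the arc at arclength \<open>S\<close>, therefore gives
  \<open>\<integral>\<^sub>0\<^sup>S (cos \<gamma> - e \<bullet> \<nu>) ds \<ge> - K S\<^sup>2\<close>: the area is \<open>O(S\<^sup>2)\<close> and the line contributes nothing positive.
  Since \<open>\<nu>\<close> tends to the normal direction \<open>\<alpha> + \<pi>/2\<close> of the limiting tangent, the lower averages of
  \<open>cos \<gamma>\<close> are at least the cosine of the angle between \<open>e\<close> and that direction. Letting \<open>e\<close> turn
  until it is orthogonal to the ray \<open>\<theta>1\<close> yields \<open>m \<ge> cos (\<alpha> - \<theta>1)\<close>, and \<open>\<theta>1 \<rightarrow> \<alpha>2\<close> yields
  \<open>m \<ge> cos \<beta>\<close>, where \<open>\<beta>\<close> is the size of the side fan. That is the assertion.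

  The boundary condition is available as a nontangential limit only. The flux is therefore computed
  on the arc translated into \<open>\<Omega>\<close> by a small vector, and dominated convergence moves it to the boundary.

  The other assertions are the same one for other data: replacing \<open>f\<close> by \<open>-f\<close> interchanges increase
  and decrease and lower and upper averages, and a reflection interchanges the two arcs. The sign
  \<open>\<sigma> = \<plusminus>1\<close> below carries the reflection.
\<close>

section \<open>The divergence theorem between two graphs\<close>

lemma divergence_rectangle:
  fixes A As B Bv :: "real \<Rightarrow> real \<Rightarrow> real"
  assumes s: "s0 \<le> s1"
    and A: "\<And>s v. s \<in> {s0..s1} \<Longrightarrow> v \<in> {0..1} \<Longrightarrow>
              ((\<lambda>s. A s v) has_vector_derivative As s v) (at s within {s0..s1})"
    and B: "\<And>s v. s \<in> {s0..s1} \<Longrightarrow> v \<in> {0..1} \<Longrightarrow>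
              ((\<lambda>v. B s v) has_vector_derivative Bv s v) (at v within {0..1})"
    and cA: "continuous_on ({s0..s1} \<times> {0..1}) (\<lambda>(s, v). As s v)"
    and cB: "continuous_on ({s0..s1} \<times> {0..1}) (\<lambda>(s, v). Bv s v)"
  shows "integral {0..1} (\<lambda>v. A s1 v - A s0 v) + integral {s0..s1} (\<lambda>s. B s 1 - B s 0) =
         integral {s0..s1} (\<lambda>s. integral {0..1} (\<lambda>v. As s v + Bv s v))"
proof -
  have cA': "continuous_on (cbox (s0, 0) (s1, 1)) (\<lambda>(s, v). As s v)"
    and cB': "continuous_on (cbox (s0, 0) (s1, 1)) (\<lambda>(s, v). Bv s v)"
    using cA cB by (simp_all add: cbox_Pair_eq)
  have iA: "integral {s0..s1} (\<lambda>s. As s v) = A s1 v - A s0 v" if "v \<in> {0..1}" for v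
    using fundamental_theorem_of_calculus[OF s, of "\<lambda>s. A s v" "\<lambda>s. As s v"] A that
    by (auto intro: integral_unique)
  have iB: "((\<lambda>v. Bv s v) has_integral (B s 1 - B s 0)) {0..1}" if "s \<in> {s0..s1}" for s
    using fundamental_theorem_of_calculus[of 0 1 "\<lambda>v. B s v" "\<lambda>v. Bv s v"] B that by auto
  have intA: "(\<lambda>v. As s v) integrable_on {0..1}" if "s \<in> {s0..s1}" for s
    by (rule integrable_continuous_real)
       (use that in \<open>auto intro!: continuous_on_compose2[OF cA, of "{0..1}" "\<lambda>v. (s, v)", simplified] continuous_intros\<close>)
  have jA: "(\<lambda>s. integral {0..1} (\<lambda>v. As s v)) integrable_on {s0..s1}"
    using integral_integrable_2dim[OF cA'] by simp
  have "(\<lambda>s. integral {0..1} (\<lambda>v. Bv s v)) integrable_on {s0..s1}"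
    using integral_integrable_2dim[OF cB'] by simp
  then have jB: "(\<lambda>s. B s 1 - B s 0) integrable_on {s0..s1}"
    by (rule integrable_spike[where S = "{}"]) (use integral_unique[OF iB] in auto)
  have "integral {s0..s1} (\<lambda>s. integral {0..1} (\<lambda>v. As s v + Bv s v)) =
        integral {s0..s1} (\<lambda>s. integral {0..1} (\<lambda>v. As s v) + (B s 1 - B s 0))"
    by (intro integral_cong)
       (simp add: integral_add[OF intA has_integral_integrable[OF iB]] integral_unique[OF iB])
  also have "\<dots> = integral {s0..s1} (\<lambda>s. integral {0..1} (\<lambda>v. As s v))
                  + integral {s0..s1} (\<lambda>s. B s 1 - B s 0)"
    by (rule integral_add[OF jA jB])
  also have "integral {s0..s1} (\<lambda>s. integral {0..1} (\<lambda>v. As s v)) =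
             integral {0..1} (\<lambda>v. integral {s0..s1} (\<lambda>s. As s v))"
    using integral_swap_continuous[OF cA'] by simp
  also have "\<dots> = integral {0..1} (\<lambda>v. A s1 v - A s0 v)"
    using iA by (intro integral_cong) auto
  finally show ?thesis by simp
qed

text \<open>
  The divergence theorem for the region swept out by the segments \<open>\<xi> s *\<^sub>R e + y *\<^sub>R k\<close> with
  \<open>a s \<le> y \<le> b s\<close>. The bounds on \<open>V \<bullet> e\<close> dispose of the lateral segments at \<open>s0\<close> and \<open>s1\<close>: the
  latter has flux of the favourable sign, the former is short in the applications. The coordinate \<open>s\<close> is a
  free parameter, not \<open>x \<bullet> e\<close> itself, so that boundary arcs keep their arclength parametrization.
\<close>

lemma divergence_inequality_strip:
  fixes V :: "real \<times> real \<Rightarrow> real \<times> real" and e k :: "real \<times> real"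
  assumes s: "s0 \<le> s1"
    and V: "\<And>x. x \<in> S \<Longrightarrow> (V has_derivative DV x) (at x)"
    and cDV: "\<And>h. continuous_on S (\<lambda>x. DV x h)"
    and x': "\<And>s. s \<in> {s0..s1} \<Longrightarrow> (\<xi> has_vector_derivative \<xi>' s) (at s within {s0..s1})"
    and a': "\<And>s. s \<in> {s0..s1} \<Longrightarrow> (a has_vector_derivative a' s) (at s within {s0..s1})"
    and b': "\<And>s. s \<in> {s0..s1} \<Longrightarrow> (b has_vector_derivative b' s) (at s within {s0..s1})"
    and cx: "continuous_on {s0..s1} \<xi>'" and ca: "continuous_on {s0..s1} a'" and cb: "continuous_on {s0..s1} b'"
    and ab: "\<And>s. s \<in> {s0..s1} \<Longrightarrow> a s \<le> b s \<and> 0 \<le> \<xi>' s \<and> (b s - a s) * \<xi>' s \<le> K"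
    and inS: "\<And>s y. s \<in> {s0..s1} \<Longrightarrow> a s \<le> y \<Longrightarrow> y \<le> b s \<Longrightarrow> \<xi> s *\<^sub>R e + y *\<^sub>R k \<in> S"
    and div: "\<And>s y. s \<in> {s0..s1} \<Longrightarrow> a s \<le> y \<Longrightarrow> y \<le> b s \<Longrightarrow>
               DV (\<xi> s *\<^sub>R e + y *\<^sub>R k) e \<bullet> e + DV (\<xi> s *\<^sub>R e + y *\<^sub>R k) k \<bullet> k \<ge> - C"
    and C: "C \<ge> 0"
    and Ve: "\<And>s y. s \<in> {s0..s1} \<Longrightarrow> a s \<le> y \<Longrightarrow> y \<le> b s \<Longrightarrow>
               V (\<xi> s *\<^sub>R e + y *\<^sub>R k) \<bullet> e \<in> {-2..0}"
  defines "F \<equiv> \<lambda>s. (\<xi>' s * (V (\<xi> s *\<^sub>R e + b s *\<^sub>R k) \<bullet> k) - b' s * (V (\<xi> s *\<^sub>R e + b s *\<^sub>R k) \<bullet> e))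
                  - (\<xi>' s * (V (\<xi> s *\<^sub>R e + a s *\<^sub>R k) \<bullet> k) - a' s * (V (\<xi> s *\<^sub>R e + a s *\<^sub>R k) \<bullet> e))"
  shows "F integrable_on {s0..s1}" and "integral {s0..s1} F \<ge> - C * K * (s1 - s0) - 2 * (b s0 - a s0)"
proof -
  define G where "G = (\<lambda>s v. \<xi> s *\<^sub>R e + (a s + v * (b s - a s)) *\<^sub>R k)"
  have GS: "G s v \<in> S" and Gdiv: "DV (G s v) e \<bullet> e + DV (G s v) k \<bullet> k \<ge> - C"
    and Ge: "V (G s v) \<bullet> e \<in> {-2..0}"
    if "s \<in> {s0..s1}" "v \<in> {0..1}" for s v
  proof -
    have *: "a s \<le> a s + v * (b s - a s)" "a s + v * (b s - a s) \<le> b s"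
      using ab[OF that(1)] that(2) mult_right_mono[of v 1 "b s - a s"] by auto
    show "G s v \<in> S" "DV (G s v) e \<bullet> e + DV (G s v) k \<bullet> k \<ge> - C"
         "V (G s v) \<bullet> e \<in> {-2..0}"
      unfolding G_def by (rule inS[OF that(1) *], rule div[OF that(1) *], rule Ve[OF that(1) *])
  qed
  define w where "w = (\<lambda>s. b s - a s)"
  define w' where "w' = (\<lambda>s. b' s - a' s)"
  define t' where "t' = (\<lambda>s v. a' s + v * w' s)"
  \<comment> \<open>In the coordinates \<open>(s, v)\<close>, \<open>0 \<le> v \<le> 1\<close>, the field \<open>V\<close> becomes \<open>(A, B)\<close>, whose divergence is
      that of \<open>V\<close> times the Jacobian \<open>w * \<xi>'\<close>. No second derivatives of \<open>\<xi>\<close>, \<open>a\<close>, \<open>b\<close> occur.\<close>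
  define A where "A = (\<lambda>s v. w s * (V (G s v) \<bullet> e))"
  define As where "As = (\<lambda>s v. w' s * (V (G s v) \<bullet> e) + w s * (\<xi>' s * (DV (G s v) e \<bullet> e) + t' s v * (DV (G s v) k \<bullet> e)))"
  define B where "B = (\<lambda>s v. \<xi>' s * (V (G s v) \<bullet> k) - t' s v * (V (G s v) \<bullet> e))"
  define Bv where "Bv = (\<lambda>s v. \<xi>' s * (w s * (DV (G s v) k \<bullet> k)) - (w' s * (V (G s v) \<bullet> e) + t' s v * (w s * (DV (G s v) k \<bullet> e))))"
  have lin: "DV (G s v) (x *\<^sub>R e + y *\<^sub>R k) = x *\<^sub>R DV (G s v) e + y *\<^sub>R DV (G s v) k"
    if "s \<in> {s0..s1}" "v \<in> {0..1}" for s v x y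
  proof -
    interpret bounded_linear "DV (G s v)" using V[OF GS[OF that]] by (rule has_derivative_bounded_linear)
    show ?thesis by (simp add: add scaleR)
  qed
  have dAB: "((\<lambda>s. A s v) has_vector_derivative As s v) (at s within {s0..s1})"
            "((\<lambda>v. B s v) has_vector_derivative Bv s v) (at v within {0..1})"
    if sv: "s \<in> {s0..s1}" "v \<in> {0..1}" for s v
  proof -
    have G1: "((\<lambda>s. G s v) has_vector_derivative (\<xi>' s *\<^sub>R e + t' s v *\<^sub>R k)) (at s within {s0..s1})"
      unfolding G_def t'_def w'_def
      using x'[OF sv(1)] a'[OF sv(1)] b'[OF sv(1)]
      unfolding has_real_derivative_iff_has_vector_derivative[symmetric]
      by (auto intro!: derivative_eq_intros simp: algebra_simps)
    have G2: "((\<lambda>v. G s v) has_vector_derivative (0 *\<^sub>R e + w s *\<^sub>R k)) (at v within {0..1})"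
      unfolding G_def w_def by (auto intro!: derivative_eq_intros simp: algebra_simps)
    have V1: "((\<lambda>s. V (G s v)) has_vector_derivative (\<xi>' s *\<^sub>R DV (G s v) e + t' s v *\<^sub>R DV (G s v) k)) (at s within {s0..s1})"
      using vector_derivative_diff_chain_within[OF G1 has_derivative_at_withinI[OF V[OF GS[OF sv]]]] lin[OF sv] 
      by (simp add: o_def)
    have V2: "((\<lambda>v. V (G s v)) has_vector_derivative (w s *\<^sub>R DV (G s v) k)) (at v within {0..1})"
      using vector_derivative_diff_chain_within[OF G2 has_derivative_at_withinI[OF V[OF GS[OF sv]]]] lin[OF sv, of 0 "w s"] 
      by (simp add: o_def)
    have w1: "(w has_vector_derivative w' s) (at s within {s0..s1})"
      unfolding w_def w'_def by (intro derivative_intros a'[OF sv(1)] b'[OF sv(1)])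
    have ie: "((\<lambda>s. V (G s v) \<bullet> e) has_vector_derivative ((\<xi>' s *\<^sub>R DV (G s v) e + t' s v *\<^sub>R DV (G s v) k) \<bullet> e)) (at s within {s0..s1})"
      by (rule bounded_linear.has_vector_derivative[OF bounded_linear_inner_left V1])
    have ie2: "((\<lambda>v. V (G s v) \<bullet> z) has_vector_derivative ((w s *\<^sub>R DV (G s v) k) \<bullet> z)) (at v within {0..1})" for z
      by (rule bounded_linear.has_vector_derivative[OF bounded_linear_inner_left V2])
    show "((\<lambda>s. A s v) has_vector_derivative As s v) (at s within {s0..s1})"
      unfolding A_def As_def
      by (rule has_vector_derivative_eq_rhs[OF has_vector_derivative_mult[OF w1 ie]])
         (simp add: inner_simps algebra_simps)
    have t2: "((\<lambda>v. t' s v) has_vector_derivative w' s) (at v within {0..1})"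
      unfolding t'_def by (auto intro!: derivative_eq_intros)
    show "((\<lambda>v. B s v) has_vector_derivative Bv s v) (at v within {0..1})"
      unfolding B_def Bv_def
      by (rule has_vector_derivative_eq_rhs[OF has_vector_derivative_diff[OF has_vector_derivative_mult_right[OF ie2] has_vector_derivative_mult[OF t2 ie2]]])
         (simp add: inner_simps algebra_simps)
  qed
  have c1: "continuous_on ({s0..s1} \<times> {0..1}) (\<lambda>z::real\<times>real. g (fst z))" if "continuous_on {s0..s1} g" for g :: "real \<Rightarrow> real"
    by (rule continuous_on_compose2[OF that]) (auto intro!: continuous_intros)
  have cxab: "continuous_on {s0..s1} \<xi>" "continuous_on {s0..s1} a" "continuous_on {s0..s1} b"
    by (rule continuous_on_vector_derivative[OF x'] continuous_on_vector_derivative[OF a']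
          continuous_on_vector_derivative[OF b']; assumption)+
  have cG: "continuous_on ({s0..s1} \<times> {0..1}) (\<lambda>z. G (fst z) (snd z))"
    unfolding G_def by (intro continuous_intros c1 cxab)
  have cVS: "continuous_on S V"
    using V by (auto intro!: continuous_at_imp_continuous_on has_derivative_continuous)
  have cc: "continuous_on ({s0..s1} \<times> {0..1}) (\<lambda>z. V (G (fst z) (snd z)))"
           "continuous_on ({s0..s1} \<times> {0..1}) (\<lambda>z. DV (G (fst z) (snd z)) h)" for h
    using GS by (auto intro!: continuous_on_compose2[OF cVS cG] continuous_on_compose2[OF cDV cG])
  have cw: "continuous_on {s0..s1} w" 
    unfolding w_def by (intro continuous_intros cxab)
  have cw': "continuous_on {s0..s1} w'" unfolding w'_def by (intro continuous_intros ca cb)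
  have ct': "continuous_on ({s0..s1} \<times> {0..1}) (\<lambda>z. t' (fst z) (snd z))"
    unfolding t'_def by (intro continuous_intros c1 ca cw')
  have cA: "continuous_on ({s0..s1} \<times> {0..1}) (\<lambda>(s, v). As s v)"
    unfolding As_def case_prod_unfold by (intro continuous_intros c1 cw cw' ct' cc cx)
  have cB: "continuous_on ({s0..s1} \<times> {0..1}) (\<lambda>(s, v). Bv s v)"
    unfolding Bv_def case_prod_unfold by (intro continuous_intros c1 cw cw' ct' cc cx)
  have sum: "As s v + Bv s v = w s * \<xi>' s * (DV (G s v) e \<bullet> e + DV (G s v) k \<bullet> k)" for s v
    unfolding As_def Bv_def by (simp add: algebra_simps)
  have ge: "As s v + Bv s v \<ge> - C * K" if "s \<in> {s0..s1}" "v \<in> {0..1}" for s v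
  proof -
    have "0 \<le> w s * \<xi>' s" "w s * \<xi>' s \<le> K" using ab[OF that(1)] by (auto simp: w_def)
    then have "w s * \<xi>' s * (- C) \<ge> - C * K" using C by (simp add: mult_left_mono mult.commute)
    moreover have "w s * \<xi>' s * (- C) \<le> w s * \<xi>' s * (DV (G s v) e \<bullet> e + DV (G s v) k \<bullet> k)"
      using Gdiv[OF that] \<open>0 \<le> w s * \<xi>' s\<close> by (intro mult_left_mono) auto
    ultimately show ?thesis using sum by simp
  qed
  have cAB: "continuous_on ({s0..s1} \<times> {0..1}) (\<lambda>(s, v). As s v + Bv s v)"
    using continuous_on_add[OF cA cB] by (simp add: case_prod_unfold)
  have inner: "(\<lambda>v. As s v + Bv s v) integrable_on {0..1}" if "s \<in> {s0..s1}" for s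
    by (rule integrable_continuous_real, rule continuous_on_compose2[OF cAB, of "{0..1}" "\<lambda>v. (s, v)", simplified])
       (use that in \<open>auto intro!: continuous_intros\<close>)
  have outer: "(\<lambda>s. integral {0..1} (\<lambda>v. As s v + Bv s v)) integrable_on {s0..s1}"
    using integral_integrable_2dim[of s0 0 s1 1 "\<lambda>(s, v). As s v + Bv s v"] cAB by (simp add: cbox_Pair_eq)
  have "- C * K \<le> integral {0..1} (\<lambda>v. As s v + Bv s v)" if "s \<in> {s0..s1}" for s
    using integral_le[OF integrable_const_ivl[of "- C * K" 0 1] inner[OF that]] ge[OF that] by simp
  then have "integral {s0..s1} (\<lambda>s. - C * K) \<le> integral {s0..s1} (\<lambda>s. integral {0..1} (\<lambda>v. As s v + Bv s v))"
    by (intro integral_le[OF integrable_const_ivl outer]) auto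
  also have "\<dots> = integral {0..1} (\<lambda>v. A s1 v - A s0 v) + integral {s0..s1} (\<lambda>s. B s 1 - B s 0)"
    by (rule divergence_rectangle[symmetric, OF s dAB cA cB])
  finally have main: "- C * K * (s1 - s0) \<le> integral {0..1} (\<lambda>v. A s1 v - A s0 v) + integral {s0..s1} (\<lambda>s. B s 1 - B s 0)"
    using s by (simp add: mult_ac)
  have "continuous_on {0..1} (\<lambda>v. V (G s v))" if "s \<in> {s0..s1}" for s
    by (rule continuous_on_compose2[OF cc(1), of "{0..1}" "\<lambda>v. (s, v)", simplified])
       (use that in \<open>auto intro!: continuous_intros\<close>)
  then have iA: "(\<lambda>v. A s1 v - A s0 v) integrable_on {0..1}"
    unfolding A_def using s by (intro integrable_continuous_real continuous_intros) auto
  have "A s1 v - A s0 v \<le> 2 * (b s0 - a s0)" if v: "v \<in> {0..1}" for v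
  proof -
    have "A s1 v \<le> 0"
      unfolding A_def w_def using Ge[OF _ v, of s1] ab[of s1] s by (simp add: mult_le_0_iff)
    moreover have "w s0 * (- 2) \<le> A s0 v"
      unfolding A_def w_def using Ge[OF _ v, of s0] ab[of s0] s by (intro mult_left_mono) auto
    ultimately show ?thesis by (simp add: w_def)
  qed
  then have J: "integral {0..1} (\<lambda>v. A s1 v - A s0 v) \<le> 2 * (b s0 - a s0)"
    using integral_le[OF iA integrable_const_ivl[of "2 * (b s0 - a s0)"]] by simp
  have FB: "F = (\<lambda>s. B s 1 - B s 0)"
    by (simp add: F_def B_def t'_def w'_def G_def)
  have "continuous_on {s0..s1} (\<lambda>s. V (G s v))" "continuous_on {s0..s1} (\<lambda>s. t' s v)" if "v \<in> {0..1}" for v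
    by (rule continuous_on_compose2[OF cc(1), of "{s0..s1}" "\<lambda>s. (s, v)", simplified]
             continuous_on_compose2[OF ct', of "{s0..s1}" "\<lambda>s. (s, v)", simplified];
        use that in \<open>auto intro!: continuous_intros\<close>)+
  then show "F integrable_on {s0..s1}"
    unfolding FB B_def by (intro integrable_continuous_real continuous_intros cx) auto
  show "integral {s0..s1} F \<ge> - C * K * (s1 - s0) - 2 * (b s0 - a s0)"
    using main J unfolding FB by linarith
qed

section \<open>The capillary equation as a first-order system\<close>

lemma C1_step_exists:
  fixes z1 z2 B :: real
  assumes z: "z1 < z2"
  obtains H H' :: "real \<Rightarrow> real" and G where
    "\<And>z. \<bar>z\<bar> \<le> B \<Longrightarrow> (H has_real_derivative H' z) (at z)"
    "continuous_on UNIV H'" "\<And>z. 0 \<le> H' z" "\<And>z. H' z \<le> G" 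
    "\<And>z. z \<le> z1 \<Longrightarrow> H z = 0" "\<And>z. z2 \<le> z \<Longrightarrow> H z = 1" "\<And>z. 0 \<le> H z" "\<And>z. H z \<le> 1"
proof -
  define c where "c = (\<lambda>z. max 0 ((z - z1) * (z2 - z)))"
  \<comment> \<open>The primitive starts to the left of \<open>- B\<close>, so that it is differentiable at all \<open>z\<close> with \<open>\<bar>z\<bar> \<le> B\<close>.\<close>
  define A where "A = min (- B) z1 - 1"
  have cc: "continuous_on S c" for S unfolding c_def by (intro continuous_intros)
  have ci: "c integrable_on {a..b}" for a b by (rule integrable_continuous_real[OF cc])
  have c0: "c z \<ge> 0" for z by (simp add: c_def)
  have cle: "c z \<le> (z2 - z1)^2" for z
  proof (cases "z1 \<le> z \<and> z \<le> z2")
    case True then have "(z - z1) * (z2 - z) \<le> (z2 - z1) * (z2 - z1)" by (intro mult_mono) auto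
    then show ?thesis by (auto simp: c_def power2_eq_square)
  next
    case False then have "(z - z1) * (z2 - z) \<le> 0" using z by (auto simp: mult_le_0_iff)
    then show ?thesis by (simp add: c_def)
  qed
  have cz: "c z = 0" if "z \<le> z1 \<or> z2 \<le> z" for z
    using that z mult_nonpos_nonneg[of "z - z1" "z2 - z"] mult_nonneg_nonpos[of "z - z1" "z2 - z"]
    by (auto simp: c_def)
  define I where "I = (\<lambda>z. integral {A..z} c)"
  have mono: "I x \<le> I y" if "x \<le> y" for x y
    unfolding I_def by (rule integral_subset_le) (use that c0 ci in auto)
  have I0: "I z = 0" if "z \<le> z1" for z
  proof -
    have "integral {A..z} c = integral {A..z} (\<lambda>_. 0)" by (intro integral_cong) (use cz that in auto)
    then show ?thesis by (simp add: I_def)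
  qed
  have I1: "I z = I z2" if "z2 \<le> z" for z
  proof -
    have "I z = I z2 + integral {z2..z} c"
      unfolding I_def using z that ci Henstock_Kurzweil_Integration.integral_combine[of A z2 z c]
      by (simp add: A_def)
    also have "integral {z2..z} c = integral {z2..z} (\<lambda>_. 0)" by (intro integral_cong) (use cz in auto)
    finally show ?thesis by simp
  qed
  have Ipos: "I z2 > 0"
  proof -
    have "I z2 \<noteq> 0"
    proof
      assume "I z2 = 0"
      then have "(c has_integral 0) (cbox A z2)" using integrable_integral[OF ci[of A z2]] by (simp add: I_def)
      \<comment> \<open>A continuous nonnegative function with integral zero vanishes.\<close>
      then have "c ((z1+z2)/2) = 0"
        by (rule has_integral_0_cbox_imp_0[OF cc[of "cbox A z2"] c0]) (use z in \<open>auto simp: A_def\<close>)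
      moreover have "((z1+z2)/2 - z1) * (z2 - (z1+z2)/2) > 0" using z by (intro mult_pos_pos) auto
      ultimately show False by (simp add: c_def)
    qed
    then show ?thesis using mono[of z1 z2] I0[of z1] z by auto
  qed
  show ?thesis
  proof (rule that[of "\<lambda>z. I z / I z2" "\<lambda>z. c z / I z2" "(z2 - z1)^2 / I z2"])
    fix z :: real assume "\<bar>z\<bar> \<le> B"
    then have in_: "z \<in> {A<..<\<bar>z\<bar> + 1}" by (auto simp: A_def)
    have "(I has_real_derivative c z) (at z within {A..\<bar>z\<bar> + 1})"
      unfolding I_def by (rule integral_has_real_derivative[OF cc]) (use in_ in auto)
    then have "(I has_real_derivative c z) (at z)"
      using in_ by (simp add: at_within_Icc_at)
    then show "((\<lambda>z. I z / I z2) has_real_derivative c z / I z2) (at z)" by (rule DERIV_cdivide)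
  next
    show "continuous_on UNIV (\<lambda>z. c z / I z2)" using Ipos by (intro continuous_intros cc) auto
  next
    fix z show "0 \<le> c z / I z2" using c0 Ipos by auto
    show "c z / I z2 \<le> (z2 - z1)^2 / I z2" using cle Ipos by (intro divide_right_mono) auto
    show "z \<le> z1 \<Longrightarrow> I z / I z2 = 0" using I0 by simp
    show "z2 \<le> z \<Longrightarrow> I z / I z2 = 1" using I1[of z] Ipos by auto
    have "0 \<le> I z" using mono[of "min z z1" z] I0[of "min z z1"] by auto
    then show "0 \<le> I z / I z2" using Ipos by auto
    have "I z \<le> I z2" using mono[of z "max z z2"] I1[of "max z z2"] by auto
    then show "I z / I z2 \<le> 1" using Ipos by auto
  qed
qed

text \<open>
  The divergence may be computed in any of the frames \<open>e\<close>, \<open>k\<close> used below, of either orientation.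
\<close>

lemma trace_rotated:
  fixes L :: "real \<times> real \<Rightarrow> real \<times> real"
  assumes "bounded_linear L" and "a\<^sup>2 + b\<^sup>2 = 1" "\<sigma>\<^sup>2 = (1::real)"
    and "e = (a, \<sigma> * b)" "k = (- b, \<sigma> * a)"
  shows "L e \<bullet> e + L k \<bullet> k = L (1,0) \<bullet> (1,0) + L (0,1) \<bullet> (0,1)"
proof -
  interpret bounded_linear L by fact
  have *: "L (x,y) = x *\<^sub>R L (1,0) + y *\<^sub>R L (0,1)" for x y
    using add[of "x *\<^sub>R (1,0)" "y *\<^sub>R (0,1)"] scaleR[of x "(1,0)"] scaleR[of y "(0,1)"] by simp
  obtain p q r s where L: "L (1,0) = (p,q)" "L (0,1) = (r,s)" by (metis surj_pair)
  have "L e \<bullet> e + L k \<bullet> k = (a\<^sup>2 + b\<^sup>2) * p + \<sigma>\<^sup>2 * (a\<^sup>2 + b\<^sup>2) * s"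
    unfolding assms(4,5) *[of a] *[of "-b"] L
    by (simp add: power2_eq_square algebra_simps)
  then show ?thesis using assms(2,3) L by simp
qed

text \<open>
  All that the flux estimate uses of a solution \<open>f\<close> and \<open>T = Tf\<close>. The conditions are symmetric under
  a change of sign of \<open>f\<close>, \<open>g\<close> and \<open>T\<close>.
\<close>

locale capillary_field =
  fixes \<Omega> :: "(real \<times> real) set" and C :: real and f :: "real \<times> real \<Rightarrow> real"
    and g T :: "real \<times> real \<Rightarrow> real \<times> real" and DT :: "real \<times> real \<Rightarrow> real \<times> real \<Rightarrow> real \<times> real"
  assumes f_deriv: "x \<in> \<Omega> \<Longrightarrow> (f has_derivative (\<lambda>h. g x \<bullet> h)) (at x)"
    and g_cont: "continuous_on \<Omega> g"
    and T_deriv: "x \<in> \<Omega> \<Longrightarrow> (T has_derivative DT x) (at x)"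
    and DT_cont: "continuous_on \<Omega> (\<lambda>x. DT x h)"
    and div_T: "x \<in> \<Omega> \<Longrightarrow> \<bar>DT x (1,0) \<bullet> (1,0) + DT x (0,1) \<bullet> (0,1)\<bar> \<le> C"
    and T_le: "x \<in> \<Omega> \<Longrightarrow> norm (T x) \<le> 1"
    and T_g: "x \<in> \<Omega> \<Longrightarrow> norm (g x) - 1 \<le> g x \<bullet> T x"
    and C_nonneg: "0 \<le> C"

lemma (in capillary_field) uminus: "capillary_field \<Omega> C (\<lambda>x. - f x) (\<lambda>x. - g x) (\<lambda>x. - T x) (\<lambda>x h. - DT x h)"
proof
  fix x assume x: "x \<in> \<Omega>"
  show "((\<lambda>x. - f x) has_derivative (\<lambda>h. - g x \<bullet> h)) (at x)"
    using has_derivative_minus[OF f_deriv[OF x]] by simp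
  show "((\<lambda>x. - T x) has_derivative (\<lambda>h. - DT x h)) (at x)"
    using has_derivative_minus[OF T_deriv[OF x]] .
  show "\<bar>- DT x (1,0) \<bullet> (1,0) + - DT x (0,1) \<bullet> (0,1)\<bar> \<le> C" using div_T[OF x] by (simp add: inner_minus_left)
  show "norm (- T x) \<le> 1" "norm (- g x) - 1 \<le> - g x \<bullet> - T x" using T_le[OF x] T_g[OF x] by auto
qed (use g_cont DT_cont C_nonneg in \<open>auto intro!: continuous_intros\<close>)

lemma capillary_solution_field:
  fixes \<Omega> :: "(real \<times> real) set"
  assumes \<Omega>: "open \<Omega>" and sol: "capillary_solution \<Omega> \<kappa> lam f" and bd: "\<And>x. x \<in> \<Omega> \<Longrightarrow> \<bar>f x\<bar> \<le> M" and M: "0 \<le> M"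
  shows "capillary_field \<Omega> (\<bar>\<kappa>\<bar> * M + \<bar>lam\<bar>) f (grad f) (T_op f) (\<lambda>x. frechet_derivative (T_op f) (at x))"
proof -
  have fd: "f differentiable (at x)" and gd: "grad f differentiable (at x)"
    and dv: "div_field (T_op f) x = \<kappa> * f x + lam" if "x \<in> \<Omega>" for x
    using sol that by (auto simp: capillary_solution_def C2_on_def)
  have cD: "continuous_on \<Omega> (\<lambda>x. frechet_derivative (grad f) (at x) i)" if "i \<in> Basis" for i
    using sol that by (auto simp: capillary_solution_def C2_on_def)
  define D where "D = (\<lambda>x h. frechet_derivative (grad f) (at x) h)"
  have D: "(grad f has_derivative D x) (at x)" if "x \<in> \<Omega>" for x
    using gd[OF that] frechet_derivative_works unfolding D_def by blast
  have contg: "continuous_on \<Omega> (grad f)"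
    using D by (auto intro!: continuous_at_imp_continuous_on has_derivative_continuous)
  have contD: "continuous_on \<Omega> (\<lambda>x. D x h)" for h
  proof -
    have "continuous_on \<Omega> (\<lambda>x. \<Sum>i\<in>Basis. (h \<bullet> i) *\<^sub>R D x i)"
      using cD unfolding D_def by (intro continuous_intros) auto
    then show ?thesis
    proof (rule continuous_on_eq)
      fix x assume x: "x \<in> \<Omega>"
      interpret bounded_linear "D x" using D[OF x] by (rule has_derivative_bounded_linear)
      have "D x h = D x (\<Sum>i\<in>Basis. (h \<bullet> i) *\<^sub>R i)" by (simp only: euclidean_representation)
      then show "(\<Sum>i\<in>Basis. (h \<bullet> i) *\<^sub>R D x i) = D x h" by (simp only: sum scaleR)
    qed
  qed
  define W where "W = (\<lambda>x. sqrt (1 + grad f x \<bullet> grad f x))"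
  have W1: "W x \<ge> 1" for x unfolding W_def by simp
  then have W0: "W x > 0" "W x \<noteq> 0" for x using W1[of x] by linarith+
  have T: "T_op f x = inverse (W x) *\<^sub>R grad f x" for x
    by (simp only: T_op_def W_def dot_square_norm inverse_eq_divide)
  have WD: "(W has_derivative (\<lambda>h. (grad f x \<bullet> D x h) / W x)) (at x)" if "x \<in> \<Omega>" for x
  proof -
    have q: "((\<lambda>x. 1 + grad f x \<bullet> grad f x) has_derivative (\<lambda>h. 2 * (grad f x \<bullet> D x h))) (at x)"
      using has_derivative_add[OF has_derivative_const has_derivative_inner[OF D[OF that] D[OF that]], of 1]
      by (simp add: inner_commute)
    show ?thesis
      using has_derivative_real_sqrt[OF add_pos_nonneg[OF zero_less_one inner_ge_zero] q]
      unfolding W_def by (simp only: divide_inverse mult.assoc) (simp add: mult.left_commute)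
  qed
  define DT where "DT = (\<lambda>x h. inverse (W x) *\<^sub>R D x h
                       + (- (inverse (W x) * ((grad f x \<bullet> D x h) / W x) * inverse (W x))) *\<^sub>R grad f x)"
  have TD: "(T_op f has_derivative DT x) (at x)" if "x \<in> \<Omega>" for x
    unfolding T[abs_def] DT_def
    by (rule has_derivative_scaleR[OF Deriv.has_derivative_inverse[OF W0(2) WD[OF that]] D[OF that]])
  have FT: "frechet_derivative (T_op f) (at x) = DT x" if "x \<in> \<Omega>" for x
    using frechet_derivative_at[OF TD[OF that]] by simp
  have contW: "continuous_on \<Omega> W" unfolding W_def by (intro continuous_intros contg)
  have contDT: "continuous_on \<Omega> (\<lambda>x. DT x h)" for h
    unfolding DT_def by (intro continuous_intros contW contg contD) (use W0 in auto)
  show ?thesis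
  proof
    fix x assume x: "x \<in> \<Omega>"
    show "(f has_derivative (\<lambda>h. grad f x \<bullet> h)) (at x)"
    proof -
      have *: "(f has_derivative frechet_derivative f (at x)) (at x)" using fd[OF x] frechet_derivative_works by blast
      interpret bounded_linear "frechet_derivative f (at x)" using * by (rule has_derivative_bounded_linear)
      have "frechet_derivative f (at x) = (\<lambda>h. grad f x \<bullet> h)"
      proof
        fix h
        have "frechet_derivative f (at x) h = frechet_derivative f (at x) (\<Sum>i\<in>Basis. (h \<bullet> i) *\<^sub>R i)" by (simp only: euclidean_representation)
        also have "\<dots> = grad f x \<bullet> h" by (simp only: sum scaleR) (simp add: grad_def inner_sum_right inner_commute[of _ h] mult.commute)
        finally show "frechet_derivative f (at x) h = grad f x \<bullet> h" .
      qed
      with * show ?thesis by simp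
    qed
    show "(T_op f has_derivative frechet_derivative (T_op f) (at x)) (at x)" using FT[OF x] TD[OF x] by simp
    have "frechet_derivative (T_op f) (at x) (1,0) \<bullet> (1,0) + frechet_derivative (T_op f) (at x) (0,1) \<bullet> (0,1) = \<kappa> * f x + lam"
      using dv[OF x] by (simp add: div_field_def Basis_prod_def sum.union_disjoint)
    moreover have "\<bar>\<kappa> * f x + lam\<bar> \<le> \<bar>\<kappa>\<bar> * M + \<bar>lam\<bar>"
      using mult_left_mono[OF bd[OF x], of "\<bar>\<kappa>\<bar>"] abs_triangle_ineq[of "\<kappa> * f x" lam] by (simp add: abs_mult)
    ultimately show "\<bar>frechet_derivative (T_op f) (at x) (1,0) \<bullet> (1,0) + frechet_derivative (T_op f) (at x) (0,1) \<bullet> (0,1)\<bar> \<le> \<bar>\<kappa>\<bar> * M + \<bar>lam\<bar>" by simp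
    have Wg: "norm (grad f x) \<le> W x" unfolding W_def dot_square_norm by (rule real_le_rsqrt) simp
    then show "norm (T_op f x) \<le> 1" using W0[of x] by (simp add: T field_simps)
    have "W x ^ 2 = 1 + norm (grad f x) ^ 2" by (simp add: W_def dot_square_norm)
    then have "norm (grad f x) ^ 2 / W x = W x - 1 / W x" using W0[of x] by (simp add: field_simps power2_eq_square)
    moreover have "1 / W x \<le> 1" using W1[of x] by simp
    ultimately show "norm (grad f x) - 1 \<le> grad f x \<bullet> T_op f x" using Wg by (simp add: T dot_square_norm divide_inverse mult.commute)
  next
    show "continuous_on \<Omega> (grad f)" by (rule contg)
    show "continuous_on \<Omega> (\<lambda>x. frechet_derivative (T_op f) (at x) h)" for h
      using contDT by (simp add: FT cong: continuous_on_cong)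
    show "0 \<le> \<bar>\<kappa>\<bar> * M + \<bar>lam\<bar>" using M by simp
  qed
qed

section \<open>Orthonormal frames\<close>

text \<open>
  For \<open>\<sigma> = 1\<close> this is the unit vector at angle \<open>t\<close>, for \<open>\<sigma> = -1\<close> its reflection in the first axis. With the
  reflected angle, each of the two boundary arcs is approached as \<open>t\<close> increases to \<open>\<alpha>\<close>.
\<close>

definition dir :: "real \<Rightarrow> real \<Rightarrow> real \<times> real" where
  "dir \<sigma> t = (cos t, \<sigma> * sin t)"

lemma dir_inner: "\<sigma>\<^sup>2 = 1 \<Longrightarrow> dir \<sigma> s \<bullet> dir \<sigma> t = cos (s - t)"
  by (simp add: dir_def cos_diff power2_eq_square algebra_simps)

lemma norm_dir: "\<sigma>\<^sup>2 = 1 \<Longrightarrow> norm (dir \<sigma> t) = 1"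
  using dir_inner[of \<sigma> t t] by (simp add: norm_eq_1)

lemma dir_orthonormal:
  assumes "\<sigma>\<^sup>2 = 1"
  shows "dir \<sigma> t \<bullet> dir \<sigma> t = 1" "dir \<sigma> (t + pi/2) \<bullet> dir \<sigma> (t + pi/2) = 1"
    "dir \<sigma> t \<bullet> dir \<sigma> (t + pi/2) = 0" "dir \<sigma> (t + pi/2) \<bullet> dir \<sigma> t = 0"
  using assms by (auto simp: dir_inner)

lemma dir_expand:
  assumes "\<sigma>\<^sup>2 = 1"
  shows "x = (x \<bullet> dir \<sigma> t) *\<^sub>R dir \<sigma> t + (x \<bullet> dir \<sigma> (t + pi/2)) *\<^sub>R dir \<sigma> (t + pi/2)"
proof -
  obtain a b where x: "x = (a, b)" by force
  have s: "\<sigma> * \<sigma> = 1" using assms by (simp add: power2_eq_square)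
  have "a * (cos t)\<^sup>2 + a * (sin t)\<^sup>2 = a" "b * (cos t)\<^sup>2 + b * (sin t)\<^sup>2 = b"
    by (simp_all flip: distrib_left)
  moreover have ss: "\<sigma> * (\<sigma> * z) = z" for z using s by (metis mult.assoc mult_1)
  ultimately show ?thesis
    using s by (simp add: ss x dir_def cos_add sin_add power2_eq_square algebra_simps)
qed

lemma dir_inner_expand:
  assumes "\<sigma>\<^sup>2 = 1"
  shows "x \<bullet> y = (x \<bullet> dir \<sigma> t) * (y \<bullet> dir \<sigma> t) + (x \<bullet> dir \<sigma> (t + pi/2)) * (y \<bullet> dir \<sigma> (t + pi/2))"
  by (subst dir_expand[OF assms, of y t]) (simp add: inner_simps mult.commute)

lemma polar_angle:
  assumes \<sigma>: "\<sigma>\<^sup>2 = 1" and x: "0 < x \<bullet> dir \<sigma> t"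
  shows "x = norm x *\<^sub>R dir \<sigma> (t + arctan ((x \<bullet> dir \<sigma> (t + pi/2)) / (x \<bullet> dir \<sigma> t)))"
proof -
  define X Y where "X = x \<bullet> dir \<sigma> t" and "Y = x \<bullet> dir \<sigma> (t + pi/2)"
  define q s where "q = Y / X" and "s = sqrt (1 + q\<^sup>2)"
  have X: "X > 0" using x by (simp add: X_def)
  then have Y: "Y = q * X" by (simp add: q_def)
  have s: "s > 0" by (simp add: s_def add_pos_nonneg)
  have "norm x = sqrt (X\<^sup>2 + Y\<^sup>2)"
    unfolding norm_eq_sqrt_inner dir_inner_expand[OF \<sigma>, of x x t] X_def Y_def by (simp only: power2_eq_square)
  also have "X\<^sup>2 + Y\<^sup>2 = X\<^sup>2 * (1 + q\<^sup>2)" unfolding Y by (simp add: power_mult_distrib algebra_simps)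
  finally have n: "norm x = X * s" using X by (simp add: real_sqrt_mult s_def)
  have 1: "norm x * cos (arctan q) = X" "norm x * sin (arctan q) = Y"
    unfolding n cos_arctan sin_arctan s_def[symmetric] Y using s by simp_all
  have "dir \<sigma> (t + arctan q) = cos (arctan q) *\<^sub>R dir \<sigma> t + sin (arctan q) *\<^sub>R dir \<sigma> (t + pi/2)"
    by (simp add: dir_def cos_add sin_add algebra_simps del: cos_arctan sin_arctan)
  then have "norm x *\<^sub>R dir \<sigma> (t + arctan q) = X *\<^sub>R dir \<sigma> t + Y *\<^sub>R dir \<sigma> (t + pi/2)"
    by (simp only: scaleR_add_right scaleR_scaleR 1)
  also have "\<dots> = x" unfolding X_def Y_def by (rule dir_expand[OF \<sigma>, symmetric])
  finally show ?thesis by (simp add: X_def Y_def q_def)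
qed

text \<open>
  The rotation by \<open>\<sigma> \<pi>/2\<close>. It turns the unit tangent of a boundary arc, oriented away from the corner,
  into the exterior normal.
\<close>

definition rot :: "real \<Rightarrow> real \<times> real \<Rightarrow> real \<times> real" where
  "rot \<sigma> v = (- \<sigma> * snd v, \<sigma> * fst v)"

lemma rot_expand:
  assumes "\<sigma>\<^sup>2 = 1"
  shows "rot \<sigma> v = (v \<bullet> dir \<sigma> t) *\<^sub>R dir \<sigma> (t + pi/2) - (v \<bullet> dir \<sigma> (t + pi/2)) *\<^sub>R dir \<sigma> t"
proof -
  obtain a b where v: "v = (a, b)" by force
  have ss: "\<sigma> * (\<sigma> * z) = z" for z using assms by (simp add: power2_eq_square flip: mult.assoc)
  have "z * (\<sigma> * (cos t)\<^sup>2) + z * (\<sigma> * (sin t)\<^sup>2) = z * \<sigma>" for z by (simp flip: distrib_left)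
  from this[of a] this[of b] show ?thesis
    by (simp add: ss v rot_def dir_def cos_add sin_add power2_eq_square algebra_simps)
qed

lemma rot_props:
  assumes "\<sigma>\<^sup>2 = 1"
  shows "norm (rot \<sigma> v) = norm v" "rot \<sigma> v \<bullet> v = 0" "rot \<sigma> (dir \<sigma> t) = dir \<sigma> (t + pi/2)"
    "rot \<sigma> v - rot \<sigma> w = rot \<sigma> (v - w)"
proof -
  have ss: "\<sigma> * \<sigma> = 1" using assms by (simp add: power2_eq_square)
  show "norm (rot \<sigma> v) = norm v"
    by (simp add: rot_def norm_prod_def power_mult_distrib assms add.commute)
  show "rot \<sigma> v \<bullet> v = 0" "rot \<sigma> v - rot \<sigma> w = rot \<sigma> (v - w)"
    by (simp_all add: rot_def inner_prod_def algebra_simps)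
  show "rot \<sigma> (dir \<sigma> t) = dir \<sigma> (t + pi/2)"
    by (simp add: rot_def dir_def cos_add sin_add ss flip: mult.assoc)
qed

lemma perp_unit_cases:
  assumes "\<sigma>\<^sup>2 = 1" "norm n = 1" "norm v = 1" "n \<bullet> v = 0"
  shows "n = rot \<sigma> v \<or> n = - rot \<sigma> v"
proof -
  obtain a b where v: "v = (a, b)" by force
  obtain x y where n: "n = (x, y)" by force
  have h: "a * a + b * b = 1" "x * x + y * y = 1" "x * a + y * b = 0"
    using assms(2-4) by (auto simp: v n norm_prod_def power2_eq_square)
  define d where "d = \<sigma> * (y * a - x * b)"
  have s: "\<sigma> * \<sigma> = 1" using assms(1) by (simp add: power2_eq_square)
  have sq: "(y * a - x * b)\<^sup>2 = 1" using h by algebra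
  have "d * d = 1" unfolding d_def using sq s by algebra
  then have d: "d = 1 \<or> d = -1" by (simp add: square_eq_1_iff)
  have "x = - \<sigma> * b * d" "y = \<sigma> * a * d" unfolding d_def using h s by algebra+
  then show ?thesis using d by (auto simp: n v rot_def)
qed

section \<open>Comparison with a constant field\<close>

text \<open>
  The comparison of \<open>T\<close> with the constant field \<open>e\<close>. The two parts of the region, below and above the
  line \<open>y = t2 * \<xi>\<close>, are treated separately with the fields \<open>H(f) (T - e)\<close> and \<open>T - e\<close>; as \<open>H(f) = 1\<close>
  on that line, the fluxes through it cancel. The constant \<open>C'\<close> does not depend on the region, which is
  what allows the region to shrink to the corner.
\<close>

lemma (in capillary_field) flux_lower_bound:
  fixes \<sigma> t0 z1 z2 M :: real
  assumes \<sigma>: "\<sigma>\<^sup>2 = 1" and z: "z1 < z2" and fM: "\<And>x. x \<in> \<Omega> \<Longrightarrow> \<bar>f x\<bar> \<le> M"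
  defines "e \<equiv> dir \<sigma> t0" and "k \<equiv> dir \<sigma> (t0 + pi/2)"
  obtains C' where "C' \<ge> 0"
    "\<And>s0 s1 \<xi> \<xi>' b b' t1 t2 K. \<lbrakk>s0 \<le> s1; t1 < t2;
      \<And>s. s \<in> {s0..s1} \<Longrightarrow> (\<xi> has_vector_derivative \<xi>' s) (at s within {s0..s1});
      \<And>s. s \<in> {s0..s1} \<Longrightarrow> (b has_vector_derivative b' s) (at s within {s0..s1});
      continuous_on {s0..s1} \<xi>'; continuous_on {s0..s1} b';
      \<And>s. s \<in> {s0..s1} \<Longrightarrow> 0 \<le> \<xi> s \<and> t2 * \<xi> s \<le> b s \<and> 0 \<le> \<xi>' s \<and> (b s - t1 * \<xi> s) * \<xi>' s \<le> K;
      \<And>s y. s \<in> {s0..s1} \<Longrightarrow> t1 * \<xi> s \<le> y \<Longrightarrow> y \<le> b s \<Longrightarrow> \<xi> s *\<^sub>R e + y *\<^sub>R k \<in> \<Omega>;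
      \<And>s. s \<in> {s0..s1} \<Longrightarrow> f (\<xi> s *\<^sub>R e + (t1 * \<xi> s) *\<^sub>R k) \<le> z1;
      \<And>s. s \<in> {s0..s1} \<Longrightarrow> z2 \<le> f (\<xi> s *\<^sub>R e + (t2 * \<xi> s) *\<^sub>R k)\<rbrakk>
     \<Longrightarrow> integral {s0..s1} (\<lambda>s. T (\<xi> s *\<^sub>R e + b s *\<^sub>R k) \<bullet> (\<xi>' s *\<^sub>R k - b' s *\<^sub>R e) + b' s)
         \<ge> - C' * K * (s1 - s0) - 2 * (b s0 - t1 * \<xi> s0)"
proof -
  obtain H H' :: "real \<Rightarrow> real" and G where
    H: "\<And>z. \<bar>z\<bar> \<le> M \<Longrightarrow> (H has_real_derivative H' z) (at z)"
      "continuous_on UNIV H'" "\<And>z. 0 \<le> H' z" "\<And>z. H' z \<le> G" 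
      "\<And>z. z \<le> z1 \<Longrightarrow> H z = 0" "\<And>z. z2 \<le> z \<Longrightarrow> H z = 1" "\<And>z. 0 \<le> H z" "\<And>z. H z \<le> 1"
    using C1_step_exists[OF z, of M] by metis
  note on = dir_orthonormal[OF \<sigma>, of t0, folded e_def k_def]
  have ek: "e = (cos t0, \<sigma> * sin t0)" "k = (- sin t0, \<sigma> * cos t0)"
    by (simp_all add: e_def k_def dir_def cos_add sin_add)
  have ne: "norm e = 1" using on by (simp add: norm_eq_1)
  have G0: "G \<ge> 0" using H(3)[of 0] H(4)[of 0] by linarith
  have tr: "\<bar>DT x e \<bullet> e + DT x k \<bullet> k\<bar> \<le> C" if "x \<in> \<Omega>" for x
    using trace_rotated[OF has_derivative_bounded_linear[OF T_deriv[OF that]] _ \<sigma> ek] div_T[OF that] by simp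
  have Te: "T x \<bullet> e - 1 \<in> {-2..0}" if "x \<in> \<Omega>" for x
    using Cauchy_Schwarz_ineq2[of "T x" e] T_le[OF that] ne by (auto simp: abs_le_iff)
  define V where "V = (\<lambda>x. T x - e)"
  have V: "(V has_derivative DT x) (at x)" if "x \<in> \<Omega>" for x
    unfolding V_def using has_derivative_diff[OF T_deriv[OF that] has_derivative_const[of e]] by simp
  define U where "U = (\<lambda>x. H (f x) *\<^sub>R V x)"
  define DU where "DU = (\<lambda>x h. H (f x) *\<^sub>R DT x h + (H' (f x) * (g x \<bullet> h)) *\<^sub>R V x)"
  have U: "(U has_derivative DU x) (at x)" if "x \<in> \<Omega>" for x
  proof -
    have "((\<lambda>x. H (f x)) has_derivative (\<lambda>h. (g x \<bullet> h) * H' (f x))) (at x)"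
      using has_derivative_compose[OF f_deriv[OF that], of H "\<lambda>h. h * H' (f x)"] H(1)[OF fM[OF that]]
      by (simp add: has_field_derivative_def mult_commute_abs)
    from has_derivative_scaleR[OF this V[OF that]]
    show ?thesis unfolding U_def DU_def by (simp add: mult.commute)
  qed
  have cf: "continuous_on \<Omega> f" and cV: "continuous_on \<Omega> V"
    using f_deriv V by (auto intro!: continuous_at_imp_continuous_on has_derivative_continuous)
  have cHf: "continuous_on \<Omega> (\<lambda>x. H' (f x))" 
    by (rule continuous_on_compose2[OF H(2) cf]) auto
  have "continuous_on \<Omega> (\<lambda>x. H (f x))"
    by (rule continuous_on_compose2[OF _ cf, of "{-M..M}"])
       (use H(1) fM in \<open>auto intro!: continuous_at_imp_continuous_on DERIV_isCont simp: abs_le_iff\<close>, 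
        (force simp: abs_le_iff)+)
  then have cDU: "continuous_on \<Omega> (\<lambda>x. DU x h)" for h
    unfolding DU_def by (intro continuous_intros DT_cont cHf g_cont cV)
  have divU: "DU x e \<bullet> e + DU x k \<bullet> k \<ge> - (C + G)" if x: "x \<in> \<Omega>" for x
  proof -
    have "g x \<bullet> V x = (g x \<bullet> e) * (V x \<bullet> e) + (g x \<bullet> k) * (V x \<bullet> k)"
      unfolding e_def k_def by (rule dir_inner_expand[OF \<sigma>])
    then have 1: "DU x e \<bullet> e + DU x k \<bullet> k = H (f x) * (DT x e \<bullet> e + DT x k \<bullet> k) + H' (f x) * (g x \<bullet> V x)"
      unfolding DU_def by (simp add: inner_simps algebra_simps)
    \<comment> \<open>The decisive sign: \<open>T\<close> is almost \<open>g / |g|\<close> where \<open>g\<close> is large, and \<open>e\<close> is a unit vector.\<close>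
    have "g x \<bullet> V x \<ge> - 1"
      using T_g[OF x] norm_cauchy_schwarz[of "g x" e] ne by (simp add: V_def inner_simps)
    then have "H' (f x) * (g x \<bullet> V x) \<ge> H' (f x) * (-1)" using H(3) by (intro mult_left_mono)
    moreover have "\<bar>H (f x) * (DT x e \<bullet> e + DT x k \<bullet> k)\<bar> \<le> 1 * C"
      unfolding abs_mult using tr[OF x] H(7,8)[of "f x"] by (intro mult_mono) auto
    ultimately show ?thesis unfolding 1 using H(4)[of "f x"] by linarith
  qed
  show ?thesis
  proof (rule that[of "2 * (C + G)"])
    show "2 * (C + G) \<ge> 0" using C_nonneg G0 by simp
    fix s0 s1 t1 t2 K :: real and \<xi> \<xi>' b b' :: "real \<Rightarrow> real"
    assume s: "s0 \<le> s1" and t: "t1 < t2"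
      and x': "\<And>s. s \<in> {s0..s1} \<Longrightarrow> (\<xi> has_vector_derivative \<xi>' s) (at s within {s0..s1})"
      and b': "\<And>s. s \<in> {s0..s1} \<Longrightarrow> (b has_vector_derivative b' s) (at s within {s0..s1})"
      and cx: "continuous_on {s0..s1} \<xi>'" and cb: "continuous_on {s0..s1} b'"
      and ineq: "\<And>s. s \<in> {s0..s1} \<Longrightarrow> 0 \<le> \<xi> s \<and> t2 * \<xi> s \<le> b s \<and> 0 \<le> \<xi>' s \<and> (b s - t1 * \<xi> s) * \<xi>' s \<le> K"
      and ins: "\<And>s y. s \<in> {s0..s1} \<Longrightarrow> t1 * \<xi> s \<le> y \<Longrightarrow> y \<le> b s \<Longrightarrow> \<xi> s *\<^sub>R e + y *\<^sub>R k \<in> \<Omega>"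
      and f1: "\<And>s. s \<in> {s0..s1} \<Longrightarrow> f (\<xi> s *\<^sub>R e + (t1 * \<xi> s) *\<^sub>R k) \<le> z1"
      and f2: "\<And>s. s \<in> {s0..s1} \<Longrightarrow> z2 \<le> f (\<xi> s *\<^sub>R e + (t2 * \<xi> s) *\<^sub>R k)"
    have d: "((\<lambda>s. t * \<xi> s) has_vector_derivative t * \<xi>' s) (at s within {s0..s1})"
      and cd: "continuous_on {s0..s1} (\<lambda>s. t * \<xi>' s)"
      if "s \<in> {s0..s1}" for t s
      by (rule has_vector_derivative_mult_right[OF x'[OF that]], intro continuous_intros cx)
    have tt: "t1 * \<xi> s \<le> t2 * \<xi> s" if "s \<in> {s0..s1}" for s
      using ineq[OF that] t by (intro mult_right_mono) auto
    have w1: "(t2 * \<xi> s - t1 * \<xi> s) * \<xi>' s \<le> K" and w2: "(b s - t2 * \<xi> s) * \<xi>' s \<le> K"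
      if "s \<in> {s0..s1}" for s
      using ineq[OF that] tt[OF that]
        mult_right_mono[of "t2 * \<xi> s - t1 * \<xi> s" "b s - t1 * \<xi> s" "\<xi>' s"]
        mult_right_mono[of "b s - t2 * \<xi> s" "b s - t1 * \<xi> s" "\<xi>' s"] by linarith+
    define F where "F = (\<lambda>y s y'. \<xi>' s * (V (\<xi> s *\<^sub>R e + y *\<^sub>R k) \<bullet> k) - y' * (V (\<xi> s *\<^sub>R e + y *\<^sub>R k) \<bullet> e))"
    define F1 where "F1 = (\<lambda>s. (\<xi>' s * (U (\<xi> s *\<^sub>R e + (t2 * \<xi> s) *\<^sub>R k) \<bullet> k) - t2 * \<xi>' s * (U (\<xi> s *\<^sub>R e + (t2 * \<xi> s) *\<^sub>R k) \<bullet> e))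
                  - (\<xi>' s * (U (\<xi> s *\<^sub>R e + (t1 * \<xi> s) *\<^sub>R k) \<bullet> k) - t1 * \<xi>' s * (U (\<xi> s *\<^sub>R e + (t1 * \<xi> s) *\<^sub>R k) \<bullet> e)))"
    define F2 where "F2 = (\<lambda>s. (\<xi>' s * (V (\<xi> s *\<^sub>R e + b s *\<^sub>R k) \<bullet> k) - b' s * (V (\<xi> s *\<^sub>R e + b s *\<^sub>R k) \<bullet> e))
                  - (\<xi>' s * (V (\<xi> s *\<^sub>R e + (t2 * \<xi> s) *\<^sub>R k) \<bullet> k) - t2 * \<xi>' s * (V (\<xi> s *\<^sub>R e + (t2 * \<xi> s) *\<^sub>R k) \<bullet> e)))"
    have in1: "\<xi> s *\<^sub>R e + y *\<^sub>R k \<in> \<Omega>" if "s \<in> {s0..s1}" "t1 * \<xi> s \<le> y" "y \<le> t2 * \<xi> s" for s y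
      using ins[of s y] ineq[of s] that by auto
    have in2: "\<xi> s *\<^sub>R e + y *\<^sub>R k \<in> \<Omega>" if "s \<in> {s0..s1}" "t2 * \<xi> s \<le> y" "y \<le> b s" for s y
      using ins[of s y] tt[of s] that by auto
    have UV: "U x \<bullet> e \<in> {-2..0}" "V x \<bullet> e \<in> {-2..0}" if "x \<in> \<Omega>" for x
    proof -
      show v: "V x \<bullet> e \<in> {-2..0}" using Te[OF that] on by (simp add: V_def inner_simps)
      have "H (f x) * (V x \<bullet> e) \<ge> 1 * (V x \<bullet> e)"
        using v H(8)[of "f x"] by (intro mult_right_mono_neg) auto
      then show "U x \<bullet> e \<in> {-2..0}" using v H(7)[of "f x"] by (auto simp: U_def mult_le_0_iff)
    qed
    note X1 = divergence_inequality_strip[where S = \<Omega> and V = U and DV = DU and a = "\<lambda>s. t1 * \<xi> s" and b = "\<lambda>s. t2 * \<xi> s"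
        and a' = "\<lambda>s. t1 * \<xi>' s" and b' = "\<lambda>s. t2 * \<xi>' s" and \<xi> = \<xi> and \<xi>' = \<xi>' and e = e and k = k and C = "C + G" and K = K,
        OF s U cDU x' d d cx cd cd, folded F1_def]
    have F1: "F1 integrable_on {s0..s1}" "integral {s0..s1} F1 \<ge> - (C + G) * K * (s1 - s0) - 2 * (t2 * \<xi> s0 - t1 * \<xi> s0)"
      by (rule X1; use s tt ineq w1 in1 in1[THEN divU] in1[THEN UV(1)] C_nonneg G0 in auto)+
    note X2 = divergence_inequality_strip[where S = \<Omega> and V = V and DV = DT and a = "\<lambda>s. t2 * \<xi> s" and b = b
        and a' = "\<lambda>s. t2 * \<xi>' s" and b' = b' and \<xi> = \<xi> and \<xi>' = \<xi>' and e = e and k = k and C = "C + G" and K = K,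
        OF s V DT_cont x' d b' cx cd cb, folded F2_def]
    have divV: "- (C + G) \<le> DT x e \<bullet> e + DT x k \<bullet> k" if "x \<in> \<Omega>" for x
      using tr[OF that] G0 by linarith
    have F2: "F2 integrable_on {s0..s1}" "integral {s0..s1} F2 \<ge> - (C + G) * K * (s1 - s0) - 2 * (b s0 - t2 * \<xi> s0)"
      by (rule X2; use s tt ineq w2 in2 in2[THEN divV] in2[THEN UV(2)] C_nonneg G0 in auto)+
    have "F1 s + F2 s = T (\<xi> s *\<^sub>R e + b s *\<^sub>R k) \<bullet> (\<xi>' s *\<^sub>R k - b' s *\<^sub>R e) + b' s" if "s \<in> {s0..s1}" for s
      using f1[OF that] f2[OF that] H(5,6) on
      by (simp add: F1_def F2_def U_def V_def inner_simps algebra_simps)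
    then have "integral {s0..s1} (\<lambda>s. T (\<xi> s *\<^sub>R e + b s *\<^sub>R k) \<bullet> (\<xi>' s *\<^sub>R k - b' s *\<^sub>R e) + b' s)
      = integral {s0..s1} F1 + integral {s0..s1} F2"
      unfolding integral_add[OF F1(1) F2(1), symmetric] by (intro integral_cong) auto
    then show "integral {s0..s1} (\<lambda>s. T (\<xi> s *\<^sub>R e + b s *\<^sub>R k) \<bullet> (\<xi>' s *\<^sub>R k - b' s *\<^sub>R e) + b' s)
         \<ge> - (2 * (C + G)) * K * (s1 - s0) - 2 * (b s0 - t1 * \<xi> s0)"
      using F1(2) F2(2) by (simp add: algebra_simps)
  qed
qed

section \<open>The domain near one of the boundary arcs\<close>

text \<open>
  Since the unit tangent converges at the corner, the arc is a small Lipschitz perturbation of its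
  limiting tangent line. This is stronger than differentiability at the corner and is the only regularity of
  the arc that the local geometry uses.
\<close>

lemma boundary_arc_tangent:
  assumes arc: "boundary_arc \<delta> (\<sigma> * \<alpha>) p L" and \<sigma>: "\<sigma> = 1 \<or> \<sigma> = -1" and \<epsilon>: "\<epsilon> > 0"
  obtains s0 where "0 < s0" "s0 < L"
    "\<And>s. 0 < s \<Longrightarrow> s \<le> s0 \<Longrightarrow> norm (vector_derivative p (at s) - dir \<sigma> \<alpha>) \<le> \<epsilon>"
    "\<And>s s'. s \<in> {0..s0} \<Longrightarrow> s' \<in> {0..s0} \<Longrightarrow> norm (p s - p s' - (s - s') *\<^sub>R dir \<sigma> \<alpha>) \<le> \<epsilon> * \<bar>s - s'\<bar>"
proof -
  have L: "0 < L" and cp: "continuous_on {0..L} p" and C1: "p C1_differentiable_on {0<..<L}"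
    and lim: "((\<lambda>s. vector_derivative p (at s)) \<longlongrightarrow> dir \<sigma> \<alpha>) (at_right 0)"
    using arc \<sigma> by (auto simp: boundary_arc_def dir_def)
  have "\<forall>\<^sub>F s in at_right 0. dist (vector_derivative p (at s)) (dir \<sigma> \<alpha>) < \<epsilon>"
    using tendstoD[OF lim \<epsilon>] .
  then obtain a where a: "0 < a" "\<And>s. 0 < s \<Longrightarrow> s < a \<Longrightarrow> norm (vector_derivative p (at s) - dir \<sigma> \<alpha>) < \<epsilon>"
    unfolding eventually_at_right_field by (auto simp: dist_norm)
  define s0 where "s0 = min a L / 2"
  have s0: "0 < s0" "s0 < L" "s0 < a" using a L by (auto simp: s0_def)
  have small: "norm (p s - p s' - (s - s') *\<^sub>R dir \<sigma> \<alpha>) \<le> \<epsilon> * (s - s')"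
    if "0 \<le> s'" "s' < s" "s \<le> s0" for s s'
  proof -
    define q where "q = (\<lambda>s. p s - s *\<^sub>R dir \<sigma> \<alpha>)"
    have "\<exists>x\<in>{s'<..<s}. norm (q s - q s') \<le> norm ((\<lambda>h. h *\<^sub>R (vector_derivative p (at x) - dir \<sigma> \<alpha>)) (s - s'))"
    proof (rule mvt_general[OF \<open>s' < s\<close>])
      show "continuous_on {s'..s} q"
        unfolding q_def using that s0 by (intro continuous_intros continuous_on_subset[OF cp]) auto
      fix x assume x: "s' < x" "x < s"
      then have "p differentiable (at x)" using C1 that s0 by (auto simp: C1_differentiable_on_eq)
      then have "(p has_vector_derivative vector_derivative p (at x)) (at x)" by (simp add: vector_derivative_works)
      then have "(q has_vector_derivative vector_derivative p (at x) - dir \<sigma> \<alpha>) (at x)"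
        unfolding q_def by (auto intro!: derivative_eq_intros)
      then show "(q has_derivative (\<lambda>h. h *\<^sub>R (vector_derivative p (at x) - dir \<sigma> \<alpha>))) (at x)"
        by (simp add: has_vector_derivative_def)
    qed
    then obtain x where x: "x \<in> {s'<..<s}"
      and "norm (q s - q s') \<le> norm ((s - s') *\<^sub>R (vector_derivative p (at x) - dir \<sigma> \<alpha>))"
      by auto
    note this(2)
    also have "norm ((s - s') *\<^sub>R (vector_derivative p (at x) - dir \<sigma> \<alpha>)) \<le> (s - s') * \<epsilon>"
      using a(2)[of x] x(1) that s0 by (auto intro!: mult_left_mono)
    finally show ?thesis by (simp add: q_def algebra_simps)
  qed
  show ?thesis
  proof (rule that[OF s0(1,2)])
    show "norm (vector_derivative p (at s) - dir \<sigma> \<alpha>) \<le> \<epsilon>" if "0 < s" "s \<le> s0" for s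
      using a(2)[of s] that s0 by auto
    fix s s' assume "s \<in> {0..s0}" "s' \<in> {0..s0}"
    then consider "s' < s" | "s < s'" | "s = s'" by force
    then show "norm (p s - p s' - (s - s') *\<^sub>R dir \<sigma> \<alpha>) \<le> \<epsilon> * \<bar>s - s'\<bar>"
    proof cases
      case 2
      have "p s - p s' - (s - s') *\<^sub>R dir \<sigma> \<alpha> = - (p s' - p s - (s' - s) *\<^sub>R dir \<sigma> \<alpha>)"
        by (simp add: algebra_simps)
      then show ?thesis using small[of s s'] 2 \<open>s \<in> _\<close> \<open>s' \<in> _\<close> by (simp only: norm_minus_cancel) auto
    qed (use small[of s' s] \<open>s \<in> _\<close> \<open>s' \<in> _\<close> in auto)
  qed
qed

text \<open>
  On a circle, near the point \<open>(1,0)\<close>, chords are steeper than the diagonal.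
\<close>

lemma cos_diff_le_sin_diff:
  assumes "- (pi/4) \<le> a" "a \<le> b" "b \<le> pi/4"
  shows "\<bar>cos b - cos a\<bar> \<le> sin b - sin a"
proof -
  have "sin (a + pi/4) \<le> sin (b + pi/4)" "sin (a - pi/4) \<le> sin (b - pi/4)"
    using assms by (auto intro!: sin_monotone_2pi_le)
  then have "(sin a + cos a) * (sqrt 2 / 2) \<le> (sin b + cos b) * (sqrt 2 / 2)"
    "(sin a - cos a) * (sqrt 2 / 2) \<le> (sin b - cos b) * (sqrt 2 / 2)"
    unfolding sin_add sin_diff sin_45 cos_45 distrib_right left_diff_distrib by linarith+
  moreover have "sqrt 2 / 2 > (0::real)" by simp
  ultimately have "sin a + cos a \<le> sin b + cos b" "sin a - cos a \<le> sin b - cos b"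
    by (simp_all only: mult_le_cancel_right_pos)
  then show ?thesis by linarith
qed

text \<open>
  The domain is described in polar coordinates, the flux estimate needs segments in other directions. Suppose a
  point \<open>x\<close> below the arc were not in \<open>\<Omega>\<close>. Then the arc meets the circle through \<open>x\<close> about the corner at a
  point \<open>p s'\<close> which lies clockwise of \<open>x\<close> (for \<open>\<sigma> = 1\<close>). So \<open>x\<close> is above \<open>p s'\<close> along a steep chord, while
  it is below the point \<open>p s\<close> of an almost straight arc through \<open>p s'\<close>, and these are incompatible.
\<close>

lemma below_arc_in_domain:
  assumes arc: "boundary_arc \<delta> (\<sigma> * \<alpha>) p L" and \<sigma>: "\<sigma> = 1 \<or> \<sigma> = -1" and \<alpha>: "0 < \<alpha>"
    and \<theta>p: "(\<theta>p \<longlongrightarrow> \<alpha>) (at_right 0)" and \<theta>m: "(\<theta>m \<longlongrightarrow> - \<alpha>) (at_right 0)" and \<rho>: "0 < \<rho>"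
    and on_arc: "\<And>r. 0 < r \<Longrightarrow> r < \<rho> \<Longrightarrow> r *\<^sub>R dir \<sigma> (\<theta>p r) \<in> p ` {0..<L}"
    and inside: "\<And>r \<theta>. 0 < r \<Longrightarrow> r < \<rho> \<Longrightarrow> \<theta>m r < \<theta> \<Longrightarrow> \<theta> < \<theta>p r \<Longrightarrow> r *\<^sub>R dir \<sigma> \<theta> \<in> \<Omega>"
    and c0: "0 < c0" "c0 \<le> 1"
  obtains s0 \<mu> where "0 < s0" "s0 < L" "0 < \<mu>"
    "\<And>s d v. \<lbrakk>s \<in> {0..s0}; 0 < d; c0 \<le> v \<bullet> dir \<sigma> (\<alpha> + pi/2); \<bar>v \<bullet> dir \<sigma> \<alpha>\<bar> \<le> 2;
       \<bar>(p s - d *\<^sub>R v) \<bullet> dir \<sigma> (\<alpha> + pi/2)\<bar> < \<mu> * ((p s - d *\<^sub>R v) \<bullet> dir \<sigma> \<alpha>); norm (p s - d *\<^sub>R v) < s0\<rbrakk>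
      \<Longrightarrow> p s - d *\<^sub>R v \<in> \<Omega>"
proof -
  define \<tau> N where "\<tau> = dir \<sigma> \<alpha>" and "N = dir \<sigma> (\<alpha> + pi/2)"
  have \<sigma>2: "\<sigma>\<^sup>2 = 1" using \<sigma> by auto
  note on = dir_orthonormal[OF \<sigma>2, of \<alpha>, folded \<tau>_def N_def]
  have n1: "norm \<tau> = 1" "norm N = 1" using on by (simp_all add: norm_eq_1)
  obtain sK where sK: "0 < sK" "sK < L"
    and K: "\<And>s s'. s \<in> {0..sK} \<Longrightarrow> s' \<in> {0..sK} \<Longrightarrow> norm (p s - p s' - (s - s') *\<^sub>R \<tau>) \<le> c0/8 * \<bar>s - s'\<bar>"
  proof (rule boundary_arc_tangent[OF arc \<sigma>, of "c0/8", folded \<tau>_def])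
    show "0 < c0/8" using c0 by simp
  qed (rule that; assumption)
  have cp: "continuous_on {0..L} p" and p0: "p 0 = 0" and inj: "inj_on p {0..L}"
    using arc by (auto simp: boundary_arc_def)
  have "\<exists>s\<in>{sK..L}. \<forall>s'\<in>{sK..L}. norm (p s) \<le> norm (p s')"
    using sK by (intro continuous_attains_inf continuous_intros continuous_on_subset[OF cp]) auto
  then obtain sm where sm: "sm \<in> {sK..L}" "\<And>s'. s' \<in> {sK..L} \<Longrightarrow> norm (p sm) \<le> norm (p s')" by blast
  have "p sm \<noteq> p 0" using inj_onD[OF inj, of sm 0] sm(1) sK by auto
  then have m0: "norm (p sm) > 0" using p0 by simp
  have "\<forall>\<^sub>F r in at_right 0. \<bar>\<theta>p r - \<alpha>\<bar> < pi/4"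
    using tendstoD[OF \<theta>p, of "pi/4"] by (simp add: dist_real_def)
  moreover have "\<forall>\<^sub>F r in at_right 0. \<theta>m r < 0"
    using order_tendstoD(2)[OF \<theta>m, of 0] \<alpha> by simp
  ultimately have "\<forall>\<^sub>F r in at_right 0. \<bar>\<theta>p r - \<alpha>\<bar> < pi/4 \<and> \<theta>m r < 0"
    by (rule eventually_conj)
  then obtain r1 where r1: "0 < r1" "\<And>r. 0 < r \<Longrightarrow> r < r1 \<Longrightarrow> \<bar>\<theta>p r - \<alpha>\<bar> < pi/4 \<and> \<theta>m r < 0"
    unfolding eventually_at_right_field by blast
  \<comment> \<open>The bound \<open>norm (p sm)\<close> forces points of the arc of smaller norm to have parameter less than \<open>sK\<close>.\<close>
  define s0 where "s0 = min (min sK r1) (min \<rho> (norm (p sm)))"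
  define \<mu> where "\<mu> = min (pi/4) \<alpha>"
  show ?thesis
  proof (rule that[of s0 \<mu>])
    show "0 < s0" "s0 < L" "0 < \<mu>" using sK r1 m0 \<rho> \<alpha> by (auto simp: s0_def \<mu>_def)
    fix s d v
    assume s: "s \<in> {0..s0}" and d: "0 < d" and vN: "c0 \<le> v \<bullet> dir \<sigma> (\<alpha> + pi/2)" and vt: "\<bar>v \<bullet> dir \<sigma> \<alpha>\<bar> \<le> 2"
      and cone: "\<bar>(p s - d *\<^sub>R v) \<bullet> dir \<sigma> (\<alpha> + pi/2)\<bar> < \<mu> * ((p s - d *\<^sub>R v) \<bullet> dir \<sigma> \<alpha>)"
      and nx: "norm (p s - d *\<^sub>R v) < s0"
    define x where "x = p s - d *\<^sub>R v"
    define r where "r = norm x"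
    have mu: "0 < \<mu>" using \<alpha> by (simp add: \<mu>_def)
    have X: "0 < x \<bullet> dir \<sigma> \<alpha>"
    proof -
      have "0 < \<mu> * (x \<bullet> dir \<sigma> \<alpha>)" using cone unfolding x_def by linarith
      then show ?thesis using mu by (simp add: zero_less_mult_iff)
    qed
    define \<psi> where "\<psi> = arctan ((x \<bullet> dir \<sigma> (\<alpha> + pi/2)) / (x \<bullet> dir \<sigma> \<alpha>))"
    have x: "x = r *\<^sub>R dir \<sigma> (\<alpha> + \<psi>)" using polar_angle[OF \<sigma>2 X] unfolding r_def \<psi>_def .
    have "\<bar>\<psi>\<bar> \<le> \<bar>(x \<bullet> dir \<sigma> (\<alpha> + pi/2)) / (x \<bullet> dir \<sigma> \<alpha>)\<bar>"
      unfolding \<psi>_def by (rule abs_arctan_le)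
    also have "\<dots> < \<mu>" using cone X by (simp add: x_def[symmetric] abs_divide divide_less_eq)
    finally have psi: "\<bar>\<psi>\<bar> < \<mu>" .
    have r: "0 < r" "r < s0" using X nx by (auto simp: r_def x_def)
    show "p s - d *\<^sub>R v \<in> \<Omega>"
    proof (cases "\<alpha> + \<psi> < \<theta>p r")
      case True
      have "\<theta>m r < \<alpha> + \<psi>" using r1(2)[of r] r psi by (auto simp: s0_def \<mu>_def)
      from inside[OF r(1) _ this True] show ?thesis using r x by (simp add: s0_def x_def)
    next
      case False
      define \<psi>' where "\<psi>' = \<theta>p r - \<alpha>"
      have le: "\<psi>' \<le> \<psi>" and psi': "\<bar>\<psi>'\<bar> < pi/4" using False r1(2)[of r] r by (auto simp: \<psi>'_def s0_def)
      obtain s' where s': "s' \<in> {0..<L}" "p s' = r *\<^sub>R dir \<sigma> (\<alpha> + \<psi>')"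
        using on_arc[of r] r by (auto simp: \<psi>'_def s0_def)
      have "norm (p s') = r" using s'(2) r by (simp add: norm_dir[OF \<sigma>2])
      then have "s' < sK" using sm(2)[of s'] s'(1) r by (force simp: s0_def)
      define D where "D = \<bar>s - s'\<bar>"
      have Ks: "norm (p s - p s' - (s - s') *\<^sub>R \<tau>) \<le> c0/8 * D"
        unfolding D_def using K[of s s'] s s'(1) \<open>s' < sK\<close> by (auto simp: s0_def)
      have "\<bar>(p s - p s' - (s - s') *\<^sub>R \<tau>) \<bullet> N\<bar> \<le> c0/8 * D" "\<bar>(p s - p s' - (s - s') *\<^sub>R \<tau>) \<bullet> \<tau>\<bar> \<le> c0/8 * D"
        using Cauchy_Schwarz_ineq2[of "p s - p s' - (s - s') *\<^sub>R \<tau>" N] Cauchy_Schwarz_ineq2[of "p s - p s' - (s - s') *\<^sub>R \<tau>" \<tau>]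
          Ks n1 by auto
      then have A: "\<bar>(p s - p s') \<bullet> N\<bar> \<le> c0/8 * D" and B: "\<bar>(p s - p s') \<bullet> \<tau> - (s - s')\<bar> \<le> c0/8 * D"
        using on by (simp_all add: inner_diff_left)
      have trig: "dir \<sigma> (\<alpha> + a) \<bullet> \<tau> = cos a" "dir \<sigma> (\<alpha> + a) \<bullet> N = sin a" for a
        unfolding \<tau>_def N_def dir_inner[OF \<sigma>2] by (simp_all add: cos_diff)
      have "x \<bullet> N = r * sin \<psi>" "x \<bullet> \<tau> = r * cos \<psi>" by (subst x, simp add: trig)+
      moreover have "p s' \<bullet> N = r * sin \<psi>'" "p s' \<bullet> \<tau> = r * cos \<psi>'" by (simp_all add: s'(2) trig)
      moreover have "x \<bullet> z = p s \<bullet> z - d * (v \<bullet> z)" for z by (simp add: x_def inner_diff_left)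
      ultimately have eqs: "r * (sin \<psi> - sin \<psi>') = (p s - p s') \<bullet> N - d * (v \<bullet> N)"
                "r * (cos \<psi> - cos \<psi>') = (p s - p s') \<bullet> \<tau> - d * (v \<bullet> \<tau>)"
        by (simp_all add: inner_diff_left right_diff_distrib)
      have "\<bar>cos \<psi> - cos \<psi>'\<bar> \<le> sin \<psi> - sin \<psi>'"
        using le psi psi' by (intro cos_diff_le_sin_diff) (auto simp: \<mu>_def)
      then have "r * \<bar>cos \<psi> - cos \<psi>'\<bar> \<le> r * (sin \<psi> - sin \<psi>')" using r by (intro mult_left_mono) auto
      then have main: "\<bar>(p s - p s') \<bullet> \<tau> - d * (v \<bullet> \<tau>)\<bar> \<le> (p s - p s') \<bullet> N - d * (v \<bullet> N)"
        unfolding eqs[symmetric] using r by (simp add: abs_mult)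
      have 1: "d * c0 \<le> d * (v \<bullet> N)" using d vN by (simp add: N_def)
      have 2: "\<bar>d * (v \<bullet> \<tau>)\<bar> \<le> 2 * d" using d vt by (simp add: \<tau>_def abs_mult)
      have 3: "D \<ge> 0" "\<bar>s - s'\<bar> = D" by (simp_all add: D_def)
      have 4: "c0/8 * D \<le> D / 8" using mult_right_mono[of "c0/8" "1/8" D] c0 3 by simp
      have 5: "d * c0 \<le> c0/8 * D" using main A 1 by linarith
      then have "c0 * (8 * d) \<le> c0 * D" by (simp add: algebra_simps)
      then have 6: "8 * d \<le> D" using c0 by simp
      have 7: "0 < d * c0" using d c0 by simp
      have "D - c0/8 * D - 2 * d \<le> c0/8 * D"
        using main A B 1 2 3 7 by linarith
      with 4 6 d show ?thesis by linarith
    qed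
  qed
qed

text \<open>
  One side of the corner: the arc \<open>p\<close> with limiting angle \<open>\<sigma> * \<alpha>\<close>, and the polar description of the domain
  next to it. For \<open>\<sigma> = -1\<close> the functions \<open>\<theta>p\<close> and \<open>\<theta>m\<close> are reflected angles.
\<close>

locale corner_side =
  fixes \<Omega> :: "(real \<times> real) set" and \<sigma> \<alpha> \<delta> L \<rho> :: real
    and p :: "real \<Rightarrow> real \<times> real" and \<theta>p \<theta>m :: "real \<Rightarrow> real"
  assumes open_\<Omega>: "open \<Omega>" and corner: "0 \<in> frontier \<Omega>"
    and arc: "boundary_arc \<delta> (\<sigma> * \<alpha>) p L" and \<sigma>: "\<sigma> = 1 \<or> \<sigma> = -1" and \<alpha>: "0 < \<alpha>"
    and \<theta>p: "(\<theta>p \<longlongrightarrow> \<alpha>) (at_right 0)" and \<theta>m: "(\<theta>m \<longlongrightarrow> - \<alpha>) (at_right 0)" and \<rho>: "0 < \<rho>"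
    and on_arc: "\<And>r. 0 < r \<Longrightarrow> r < \<rho> \<Longrightarrow> r *\<^sub>R dir \<sigma> (\<theta>p r) \<in> p ` {0..<L}"
    and inside: "\<And>r \<theta>. 0 < r \<Longrightarrow> r < \<rho> \<Longrightarrow> \<theta>m r < \<theta> \<Longrightarrow> \<theta> < \<theta>p r \<Longrightarrow> r *\<^sub>R dir \<sigma> \<theta> \<in> \<Omega>"
begin

abbreviation "\<tau> \<equiv> dir \<sigma> \<alpha>"
abbreviation "N \<equiv> dir \<sigma> (\<alpha> + pi/2)"
abbreviation "p' \<equiv> \<lambda>s. vector_derivative p (at s)"

lemma \<sigma>2: "\<sigma>\<^sup>2 = 1" using \<sigma> by auto

lemma p0: "p 0 = 0"
  using arc by (auto simp: boundary_arc_def)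

lemma dir_norm_le: "\<bar>x \<bullet> dir \<sigma> t\<bar> \<le> norm x"
  using Cauchy_Schwarz_ineq2[of x "dir \<sigma> t"] by (simp add: norm_dir[OF \<sigma>2])

lemma tangent:
  assumes "\<epsilon> > 0"
  obtains s0 where "0 < s0" "s0 < L"
    "\<And>s. 0 < s \<Longrightarrow> s \<le> s0 \<Longrightarrow> norm (p' s - \<tau>) \<le> \<epsilon>"
    "\<And>s. 0 \<le> s \<Longrightarrow> s \<le> s0 \<Longrightarrow> norm (p s - s *\<^sub>R \<tau>) \<le> \<epsilon> * s"
proof (rule boundary_arc_tangent[OF arc \<sigma> assms])
  fix s0 assume s0: "0 < s0" "s0 < L" "\<And>s. 0 < s \<Longrightarrow> s \<le> s0 \<Longrightarrow> norm (p' s - \<tau>) \<le> \<epsilon>"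
    and K: "\<And>s s'. s \<in> {0..s0} \<Longrightarrow> s' \<in> {0..s0} \<Longrightarrow> norm (p s - p s' - (s - s') *\<^sub>R \<tau>) \<le> \<epsilon> * \<bar>s - s'\<bar>"
  show thesis
  proof (rule that[OF s0])
    show "norm (p s - s *\<^sub>R \<tau>) \<le> \<epsilon> * s" if "0 \<le> s" "s \<le> s0" for s
      using K[of s 0] that s0 p0 by simp
  qed
qed

lemma norm_p_le:
  obtains s0 where "0 < s0" "s0 < L" "\<And>s. 0 \<le> s \<Longrightarrow> s \<le> s0 \<Longrightarrow> norm (p s) \<le> 2 * s"
proof (rule tangent[of 1])
  fix s0 assume s0: "0 < s0" "s0 < L" "\<And>s. 0 \<le> s \<Longrightarrow> s \<le> s0 \<Longrightarrow> norm (p s - s *\<^sub>R \<tau>) \<le> 1 * s"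
  show thesis
  proof (rule that[OF s0(1,2)])
    show "norm (p s) \<le> 2 * s" if "0 \<le> s" "s \<le> s0" for s
      using s0(3)[OF that] norm_triangle_ineq[of "p s - s *\<^sub>R \<tau>" "s *\<^sub>R \<tau>"] that by (simp add: norm_dir[OF \<sigma>2])
  qed
qed simp

lemma p_quotient: "((\<lambda>s. p s /\<^sub>R s) \<longlongrightarrow> \<tau>) (at_right 0)"
proof (rule tendstoI)
  fix e :: real assume "e > 0"
  then have "e/2 > 0" by simp
  then show "\<forall>\<^sub>F s in at_right 0. dist (p s /\<^sub>R s) \<tau> < e"
  proof (rule tangent)
    fix s0 assume s0: "0 < s0" "\<And>s. 0 \<le> s \<Longrightarrow> s \<le> s0 \<Longrightarrow> norm (p s - s *\<^sub>R \<tau>) \<le> e/2 * s"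
    have "dist (p s /\<^sub>R s) \<tau> < e" if s: "0 < s" "s < s0" for s
    proof -
      have "p s /\<^sub>R s - \<tau> = (p s - s *\<^sub>R \<tau>) /\<^sub>R s" using s by (simp add: scaleR_diff_right)
      then have "dist (p s /\<^sub>R s) \<tau> = norm (p s - s *\<^sub>R \<tau>) / s" using s by (simp add: dist_norm divide_inverse mult.commute)
      also have "\<dots> \<le> e/2" using s0(2)[of s] s by (simp add: divide_le_eq)
      finally show ?thesis using \<open>e > 0\<close> by simp
    qed
    then show ?thesis unfolding eventually_at_right_field using s0(1) by blast
  qed
qed

lemma p_quotient_inner: "((\<lambda>s. (p s \<bullet> dir \<sigma> t) / s) \<longlongrightarrow> cos (\<alpha> - t)) (at_right 0)"
  using tendsto_inner[OF p_quotient tendsto_const[of "dir \<sigma> t"]] 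
  by (simp add: dir_inner[OF \<sigma>2] divide_inverse mult.commute)

text \<open>
  The interior cone condition at the points of the arc, with an aperture that is uniform up to the corner. It
  serves both to orient the normal and to see that transversal segments are nontangential.
\<close>

lemma interior_cone:
  assumes c0: "0 < c0" "c0 \<le> 1"
  obtains s0 where "0 < s0" "s0 < L"
    "\<And>s. 0 < s \<Longrightarrow> s < s0 \<Longrightarrow> \<exists>u0>0. \<forall>u v. 0 < u \<and> u < u0 \<and> norm v \<le> 2 \<and> c0 \<le> v \<bullet> N \<longrightarrow> p s - u *\<^sub>R v \<in> \<Omega>"
proof (rule below_arc_in_domain[OF arc \<sigma> \<alpha> \<theta>p \<theta>m \<rho> on_arc inside c0])
  fix s1 \<mu> assume s1: "0 < s1" "s1 < L" "0 < \<mu>"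
    and below: "\<And>s d v. \<lbrakk>s \<in> {0..s1}; 0 < d; c0 \<le> v \<bullet> N; \<bar>v \<bullet> \<tau>\<bar> \<le> 2;
       \<bar>(p s - d *\<^sub>R v) \<bullet> N\<bar> < \<mu> * ((p s - d *\<^sub>R v) \<bullet> \<tau>); norm (p s - d *\<^sub>R v) < s1\<rbrakk>
      \<Longrightarrow> p s - d *\<^sub>R v \<in> \<Omega>"
  define \<epsilon> where "\<epsilon> = min (1/2) (\<mu>/4)"
  have eps: "\<epsilon> > 0" "\<epsilon> \<le> 1/2" "\<epsilon> \<le> \<mu>/4" using s1 by (auto simp: \<epsilon>_def)
  show thesis
  proof (rule tangent[OF eps(1)])
    fix s2 assume s2: "0 < s2" "s2 < L" and T: "\<And>s. 0 \<le> s \<Longrightarrow> s \<le> s2 \<Longrightarrow> norm (p s - s *\<^sub>R \<tau>) \<le> \<epsilon> * s"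
    define s0 where "s0 = min (s1/4) s2"
    show thesis
    proof (rule that[of s0])
      show "0 < s0" "s0 < L" using s1 s2 by (auto simp: s0_def)
      fix s assume s: "0 < s" "s < s0"
      have n: "norm (p s - s *\<^sub>R \<tau>) \<le> \<epsilon> * s" using T[of s] s by (simp add: s0_def)
      have e1: "\<epsilon> * s \<le> 1/2 * s" "\<epsilon> * s \<le> \<mu>/4 * s" using eps s by (auto intro: mult_right_mono)
      have pN: "\<bar>p s \<bullet> N\<bar> \<le> \<mu>/4 * s" 
        using dir_norm_le[of "p s - s *\<^sub>R \<tau>" "\<alpha> + pi/2"] n e1 dir_orthonormal[OF \<sigma>2, of \<alpha>]
        by (simp add: inner_diff_left)
      have pt: "p s \<bullet> \<tau> \<ge> s/2" 
        using dir_norm_le[of "p s - s *\<^sub>R \<tau>" "\<alpha>"] n e1 dir_orthonormal[OF \<sigma>2, of \<alpha>]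
        by (simp add: inner_diff_left abs_le_iff)
      have "norm (s *\<^sub>R \<tau>) = s" using s by (simp add: norm_dir[OF \<sigma>2])
      moreover have "norm (p s) \<le> norm (p s - s *\<^sub>R \<tau>) + norm (s *\<^sub>R \<tau>)"
        using norm_triangle_ineq[of "p s - s *\<^sub>R \<tau>" "s *\<^sub>R \<tau>"] by simp
      ultimately have pn: "norm (p s) \<le> 3/2 * s" using n e1(1) by linarith
      define u0 where "u0 = min (s1/8) (\<mu> * s / (16 * (1 + \<mu>)))"
      have u0: "u0 > 0" using s1 s by (auto simp: u0_def)
      show "\<exists>u0>0. \<forall>u v. 0 < u \<and> u < u0 \<and> norm v \<le> 2 \<and> c0 \<le> v \<bullet> N \<longrightarrow> p s - u *\<^sub>R v \<in> \<Omega>"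
      proof (intro exI[of _ u0] conjI allI impI u0)
        fix u v assume "0 < u \<and> u < u0 \<and> norm v \<le> 2 \<and> c0 \<le> v \<bullet> N"
        then have u: "0 < u" "u < u0" and v: "norm v \<le> 2" "c0 \<le> v \<bullet> N" by auto
        have vt: "\<bar>v \<bullet> \<tau>\<bar> \<le> 2" "\<bar>v \<bullet> N\<bar> \<le> 2" using dir_norm_le[of v] v(1) order_trans by blast+
        have uv: "\<bar>u * (v \<bullet> \<tau>)\<bar> \<le> 2 * u" "\<bar>u * (v \<bullet> N)\<bar> \<le> 2 * u" "norm (u *\<^sub>R v) \<le> 2 * u"
          using vt v u by (auto simp: abs_mult)
        have "u * (16 * (1 + \<mu>)) < \<mu> * s" using u(2) s1 by (simp add: u0_def less_divide_eq)
        then have big: "16 * u + 16 * (u * \<mu>) < \<mu> * s" by (simp add: algebra_simps)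
        have "\<mu> * (s/2 - 2 * u) \<le> \<mu> * ((p s - u *\<^sub>R v) \<bullet> \<tau>)"
          using pt uv(1) s1 by (intro mult_left_mono) (auto simp: inner_diff_left)
        moreover have "\<bar>(p s - u *\<^sub>R v) \<bullet> N\<bar> \<le> \<mu>/4 * s + 2 * u"
          using pN uv(2) by (simp add: inner_diff_left)
        moreover have "\<mu> * (s/2 - 2 * u) = \<mu> * s / 2 - 2 * (u * \<mu>)" "0 < u * \<mu>" "0 < \<mu> * s" "\<mu>/4 * s = \<mu> * s / 4" 
          using u s1 s by (simp_all add: algebra_simps)
        ultimately have "\<bar>(p s - u *\<^sub>R v) \<bullet> N\<bar> < \<mu> * ((p s - u *\<^sub>R v) \<bullet> \<tau>)"
          using big u by linarith
        moreover have "norm (p s - u *\<^sub>R v) < s1"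
          using norm_triangle_ineq4[of "p s" "u *\<^sub>R v"] pn uv(3) u(2) s by (simp add: s0_def u0_def)
        ultimately show "p s - u *\<^sub>R v \<in> \<Omega>"
          using s s1 u v vt by (intro below) (auto simp: s0_def)
      qed
    qed
  qed
qed assumption+

text \<open>
  The unit normal is determined up to sign by the tangent. The wrong sign would point into the interior cone.
\<close>

lemma normal_is_rot:
  obtains s0 where "0 < s0" "s0 < L"
    "\<And>s n. 0 < s \<Longrightarrow> s < s0 \<Longrightarrow> exterior_unit_normal \<Omega> p s n \<Longrightarrow> n = rot \<sigma> (p' s)"
proof (rule interior_cone[of "1/2"])
  fix s1 assume s1: "0 < s1" "s1 < L" and
    cone: "\<And>s. 0 < s \<Longrightarrow> s < s1 \<Longrightarrow> \<exists>u0>0. \<forall>u v. 0 < u \<and> u < u0 \<and> norm v \<le> 2 \<and> 1/2 \<le> v \<bullet> N \<longrightarrow> p s - u *\<^sub>R v \<in> \<Omega>"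
  show thesis
  proof (rule tangent[of "1/2"])
    fix s2 assume s2: "0 < s2" "s2 < L" "\<And>s. 0 < s \<Longrightarrow> s \<le> s2 \<Longrightarrow> norm (p' s - \<tau>) \<le> 1/2"
    show thesis
    proof (rule that[of "min s1 s2"])
      show "0 < min s1 s2" "min s1 s2 < L" using s1 s2 by auto
      fix s n assume s: "0 < s" "s < min s1 s2" and n: "exterior_unit_normal \<Omega> p s n"
      have p1: "norm (p' s) = 1" using arc s s1 by (auto simp: boundary_arc_def)
      define v where "v = rot \<sigma> (p' s)"
      have v1: "norm v = 1" by (simp add: v_def rot_props(1)[OF \<sigma>2] p1)
      have "v - N = rot \<sigma> (p' s - \<tau>)" unfolding v_def by (simp add: rot_props(3)[OF \<sigma>2, symmetric] rot_props(4)[OF \<sigma>2])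
      then have "norm (v - N) \<le> 1/2" using s2(3)[of s] s by (simp add: rot_props(1)[OF \<sigma>2])
      then have "- (1/2) \<le> (v - N) \<bullet> N" using dir_norm_le[of "v - N" "\<alpha> + pi/2"] by linarith
      then have vN: "v \<bullet> N \<ge> 1/2" using dir_orthonormal[OF \<sigma>2, of \<alpha>] by (simp add: inner_diff_left)
      have "0 < s" "s < s1" using s by auto
      from cone[OF this] obtain u0 where u0: "u0 > 0"
        and in_: "\<And>u v. 0 < u \<Longrightarrow> u < u0 \<Longrightarrow> norm v \<le> 2 \<Longrightarrow> 1/2 \<le> v \<bullet> N \<Longrightarrow> p s - u *\<^sub>R v \<in> \<Omega>"
        by blast
      have "n \<noteq> - v"
      proof
        assume nv: "n = - v"
        have "\<forall>\<^sub>F t in at_right 0. p s + t *\<^sub>R n \<notin> closure \<Omega>"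
          using n by (auto simp: exterior_unit_normal_def elim: eventually_mono)
        moreover have "\<forall>\<^sub>F t in at_right 0. p s + t *\<^sub>R n \<in> \<Omega>"
          unfolding eventually_at_right_field using u0 in_[of _ v] v1 vN by (auto simp: nv)
        ultimately have "\<forall>\<^sub>F t in at_right (0::real). False"
          by eventually_elim (use closure_subset in blast)
        then show False by simp
      qed
      then show "n = rot \<sigma> (p' s)"
        using perp_unit_cases[OF \<sigma>2 _ p1, of n] n unfolding v_def exterior_unit_normal_def by blast
    qed
  qed simp
qed simp_all

text \<open>
  Transversal translates of the arc approach it nontangentially, so that the contact angle is attained
  along them.
\<close>

lemma nontangential_path:
  assumes t: "cos (\<alpha> - t0) > 0"
  obtains s0 where "0 < s0" "s0 < L"
    "\<And>s h c. 0 < s \<Longrightarrow> s < s0 \<Longrightarrow> nontangential_limit \<Omega> h (p s) c \<Longrightarrow>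
       ((\<lambda>u. h (p s - u *\<^sub>R dir \<sigma> (t0 + pi/2))) \<longlongrightarrow> c) (at_right 0)"
proof -
  define k where "k = dir \<sigma> (t0 + pi/2)"
  define c0 where "c0 = cos (\<alpha> - t0) / 2"
  have c0: "0 < c0" "c0 \<le> 1" "c0 \<le> 1/2" using t order_trans[OF cos_le_one[of "\<alpha> - t0"], of 2] by (auto simp: c0_def)
  have kN: "k \<bullet> N = 2 * c0" unfolding k_def dir_inner[OF \<sigma>2] c0_def by (simp add: cos_diff)
  have k1: "norm k = 1" by (simp add: k_def norm_dir[OF \<sigma>2])
  show thesis
  proof (rule interior_cone[OF c0(1,2)])
    fix s0 assume s0: "0 < s0" "s0 < L" and
      cone: "\<And>s. 0 < s \<Longrightarrow> s < s0 \<Longrightarrow> \<exists>u0>0. \<forall>u v. 0 < u \<and> u < u0 \<and> norm v \<le> 2 \<and> c0 \<le> v \<bullet> N \<longrightarrow> p s - u *\<^sub>R v \<in> \<Omega>"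
    show thesis
    proof (rule that[OF s0])
      fix s h c assume s: "0 < s" "s < s0" and lim: "nontangential_limit \<Omega> h (p s) c"
      from cone[OF s] obtain u0 where u0: "u0 > 0"
        and in_: "\<And>u v. 0 < u \<Longrightarrow> u < u0 \<Longrightarrow> norm v \<le> 2 \<Longrightarrow> c0 \<le> v \<bullet> N \<Longrightarrow> p s - u *\<^sub>R v \<in> \<Omega>" by blast
      have near: "p s - u *\<^sub>R k \<in> \<Omega>" "c0 * u \<le> infdist (p s - u *\<^sub>R k) (frontier \<Omega>)" if u: "0 < u" "u < u0" for u
      proof -
        show "p s - u *\<^sub>R k \<in> \<Omega>" using in_[OF u, of k] k1 kN c0 by simp
        have "c0 * u \<le> dist (p s - u *\<^sub>R k) y" if y: "y \<in> frontier \<Omega>" for y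
        proof (rule ccontr)
          assume "\<not> c0 * u \<le> dist (p s - u *\<^sub>R k) y"
          then have small: "dist (p s - u *\<^sub>R k) y < c0 * u" by simp
          \<comment> \<open>A boundary point closer than \<open>c0 * u\<close> would lie in the interior cone at \<open>p s\<close>.\<close>
          define v where "v = (p s - y) /\<^sub>R u"
          have yv: "y = p s - u *\<^sub>R v" using u by (simp add: v_def)
          have "k - v = - ((p s - u *\<^sub>R k - y) /\<^sub>R u)" using u by (simp add: v_def scaleR_diff_right)
          then have "norm (k - v) = dist (p s - u *\<^sub>R k) y / u" using u by (simp add: dist_norm divide_inverse mult.commute)
          also have "\<dots> < c0" using small u by (simp add: divide_less_eq)
          finally have kv: "norm (k - v) < c0" .
          have "norm v \<le> norm k + norm (k - v)" using norm_triangle_ineq4[of k "k - v"] by simp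
          then have "norm v \<le> 2" using kv k1 c0 by simp
          moreover have "c0 \<le> v \<bullet> N"
            using dir_norm_le[of "k - v" "\<alpha> + pi/2"] kv kN by (simp add: inner_diff_left abs_le_iff)
          ultimately have "y \<in> \<Omega>" using in_[OF u] yv by simp
          then show False using y open_\<Omega> by (simp add: frontier_def interior_open)
        qed
        then show "c0 * u \<le> infdist (p s - u *\<^sub>R k) (frontier \<Omega>)"
          unfolding infdist_def using corner by (auto intro!: cINF_greatest)
      qed
      let ?A = "{x \<in> \<Omega>. dist x (p s) \<le> (1/c0) * infdist x (frontier \<Omega>)}"
      have lim': "(h \<longlongrightarrow> c) (at (p s) within ?A)" using lim unfolding nontangential_limit_def by blast
      have "\<forall>\<^sub>F u in at_right 0. p s - u *\<^sub>R k \<in> ?A \<and> p s - u *\<^sub>R k \<noteq> p s"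
        unfolding eventually_at_right_field
      proof (intro exI[of _ u0] conjI allI impI u0)
        fix u assume "0 < u" "u < u0"
        note u = this
        have "u \<le> (1/c0) * infdist (p s - u *\<^sub>R k) (frontier \<Omega>)"
          using near(2)[OF u] c0 by (simp add: field_simps)
        then show "p s - u *\<^sub>R k \<in> ?A" using near(1)[OF u] u k1 by (simp add: dist_norm)
        show "p s - u *\<^sub>R k \<noteq> p s" using u k1 by auto
      qed
      moreover have "((\<lambda>u. p s - u *\<^sub>R k) \<longlongrightarrow> p s - 0 *\<^sub>R k) (at_right 0)" by (intro tendsto_intros)
      ultimately have "filterlim (\<lambda>u. p s - u *\<^sub>R k) (at (p s) within ?A) (at_right 0)"
        by (simp add: filterlim_at eventually_conj_iff)
      from filterlim_compose[OF lim' this]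
      show "((\<lambda>u. h (p s - u *\<^sub>R dir \<sigma> (t0 + pi/2))) \<longlongrightarrow> c) (at_right 0)" by (simp add: k_def)
    qed
  qed
qed

lemma eventually_at_right_0E:
  assumes "\<forall>\<^sub>F s in at_right (0::real). P s"
  obtains a where "0 < a" "\<And>s. 0 < s \<Longrightarrow> s < a \<Longrightarrow> P s"
  using assms unfolding eventually_at_right_field by blast

lemma tan_quotient:
  assumes t: "\<bar>\<alpha> - t0\<bar> < pi/2"
  shows "((\<lambda>s. (p s \<bullet> dir \<sigma> (t0 + pi/2)) / (p s \<bullet> dir \<sigma> t0)) \<longlongrightarrow> tan (\<alpha> - t0)) (at_right 0)"
proof -
  have c: "cos (\<alpha> - t0) > 0" using t unfolding abs_less_iff by (intro cos_gt_zero_pi) linarith+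
  have "((\<lambda>s. ((p s \<bullet> dir \<sigma> (t0 + pi/2)) / s) / ((p s \<bullet> dir \<sigma> t0) / s)) \<longlongrightarrow> cos (\<alpha> - (t0 + pi/2)) / cos (\<alpha> - t0)) (at_right 0)"
    using c by (intro tendsto_divide p_quotient_inner) auto
  moreover have "\<forall>\<^sub>F s in at_right 0. ((p s \<bullet> dir \<sigma> (t0 + pi/2)) / s) / ((p s \<bullet> dir \<sigma> t0) / s)
                   = (p s \<bullet> dir \<sigma> (t0 + pi/2)) / (p s \<bullet> dir \<sigma> t0)"
    unfolding eventually_at_right_field by (intro exI[of _ 1]) auto
  ultimately have "((\<lambda>s. (p s \<bullet> dir \<sigma> (t0 + pi/2)) / (p s \<bullet> dir \<sigma> t0)) \<longlongrightarrow> cos (\<alpha> - (t0 + pi/2)) / cos (\<alpha> - t0)) (at_right 0)"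
    by (rule Lim_transform_eventually)
  moreover have "cos (\<alpha> - (t0 + pi/2)) = sin (\<alpha> - t0)"
    by (simp add: cos_diff sin_diff cos_add sin_add)
  ultimately show ?thesis by (simp add: tan_def)
qed

text \<open>
  The segments over which the divergence theorem is applied lie in \<open>\<Omega>\<close>. Points whose angle stays away from
  \<open>\<alpha>\<close> are covered by the polar description of \<open>\<Omega>\<close>, the remaining ones by \<open>below_arc_in_domain\<close>.
\<close>

lemma region_below_arc:
  assumes t: "\<bar>\<alpha> - t0\<bar> < pi/2" and \<theta>1: "- \<alpha> < \<theta>1" "\<theta>1 < \<alpha>" "t0 - pi/2 < \<theta>1" "\<theta>1 < t0 + pi/2"
  defines "e \<equiv> dir \<sigma> t0" and "k \<equiv> dir \<sigma> (t0 + pi/2)"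
  obtains s0 where "0 < s0" "s0 < L"
    "\<And>s y. \<lbrakk>0 < s; s < s0; tan (\<theta>1 - t0) * (p s \<bullet> e) \<le> y; y < p s \<bullet> k\<rbrakk> \<Longrightarrow> (p s \<bullet> e) *\<^sub>R e + y *\<^sub>R k \<in> \<Omega>"
proof -
  define c0 where "c0 = cos (\<alpha> - t0)"
  have c0: "0 < c0" "c0 \<le> 1" using t unfolding c0_def abs_less_iff by (auto intro!: cos_gt_zero_pi)
  have kN: "k \<bullet> N = c0" unfolding k_def dir_inner[OF \<sigma>2] c0_def by (simp add: cos_diff)
  have k1: "norm k = 1" "norm e = 1" by (simp_all add: k_def e_def norm_dir[OF \<sigma>2])
  have kt: "\<bar>k \<bullet> \<tau>\<bar> \<le> 2" using dir_norm_le[of k \<alpha>] k1 by linarith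
  define t1 where "t1 = tan (\<theta>1 - t0)"
  have at1: "arctan t1 = \<theta>1 - t0" unfolding t1_def using \<theta>1 by (intro arctan_tan) auto
  note on = dir_orthonormal[OF \<sigma>2, of t0, folded e_def k_def]
  show thesis
  proof (rule below_arc_in_domain[OF arc \<sigma> \<alpha> \<theta>p \<theta>m \<rho> on_arc inside c0])
    fix s1 \<mu> assume s1: "0 < s1" "s1 < L" "0 < \<mu>"
      and below: "\<And>s d v. \<lbrakk>s \<in> {0..s1}; 0 < d; c0 \<le> v \<bullet> N; \<bar>v \<bullet> \<tau>\<bar> \<le> 2;
         \<bar>(p s - d *\<^sub>R v) \<bullet> N\<bar> < \<mu> * ((p s - d *\<^sub>R v) \<bullet> \<tau>); norm (p s - d *\<^sub>R v) < s1\<rbrakk>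
        \<Longrightarrow> p s - d *\<^sub>R v \<in> \<Omega>"
    define \<eta> where "\<eta> = min (pi/4) (\<mu>/2)"
    have eta: "0 < \<eta>" "\<eta> \<le> pi/4" "\<eta> \<le> \<mu>/2" using s1 by (auto simp: \<eta>_def)
    have "\<forall>\<^sub>F r in at_right 0. \<theta>p r > \<alpha> - \<eta>" "\<forall>\<^sub>F r in at_right 0. \<theta>m r < \<theta>1"
      using order_tendstoD(1)[OF \<theta>p, of "\<alpha> - \<eta>"] order_tendstoD(2)[OF \<theta>m, of \<theta>1] eta \<theta>1 by auto
    then have "\<forall>\<^sub>F r in at_right 0. \<theta>p r > \<alpha> - \<eta> \<and> \<theta>m r < \<theta>1" by (rule eventually_conj)
    then obtain r1 where r1: "0 < r1" "\<And>r. 0 < r \<Longrightarrow> r < r1 \<Longrightarrow> \<theta>p r > \<alpha> - \<eta> \<and> \<theta>m r < \<theta>1"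
      by (rule eventually_at_right_0E) blast
    have "((\<lambda>s. arctan ((p s \<bullet> k) / (p s \<bullet> e))) \<longlongrightarrow> arctan (tan (\<alpha> - t0))) (at_right 0)"
      unfolding e_def k_def by (intro tendsto_arctan tan_quotient t)
    moreover have "arctan (tan (\<alpha> - t0)) = \<alpha> - t0" using t unfolding abs_less_iff by (intro arctan_tan) linarith+
    ultimately have "\<forall>\<^sub>F s in at_right 0. arctan ((p s \<bullet> k) / (p s \<bullet> e)) < \<alpha> - t0 + \<eta>"
      using order_tendstoD(2) eta by (metis less_add_same_cancel1)
    moreover have "\<forall>\<^sub>F s in at_right 0. (p s \<bullet> e) / s > 0"
      using order_tendstoD(1)[OF p_quotient_inner[of t0], of 0] c0 by (simp add: e_def c0_def)
    ultimately have "\<forall>\<^sub>F s in at_right 0. arctan ((p s \<bullet> k) / (p s \<bullet> e)) < \<alpha> - t0 + \<eta> \<and> (p s \<bullet> e) / s > 0"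
      by (rule eventually_conj)
    then obtain s2 where s2: "0 < s2" "\<And>s. 0 < s \<Longrightarrow> s < s2 \<Longrightarrow> arctan ((p s \<bullet> k) / (p s \<bullet> e)) < \<alpha> - t0 + \<eta> \<and> (p s \<bullet> e) / s > 0"
      by (rule eventually_at_right_0E) blast
    show thesis
    proof (rule norm_p_le)
      fix s3 assume s3: "0 < s3" "s3 < L" "\<And>s. 0 \<le> s \<Longrightarrow> s \<le> s3 \<Longrightarrow> norm (p s) \<le> 2 * s"
      \<comment> \<open>The factor \<open>Q\<close> bounds the norm of all points of the segment with parameter \<open>s\<close> by \<open>Q * s\<close>.\<close>
      define R where "R = min s1 (min r1 \<rho>)"
      define Q where "Q = 2 * (2 + \<bar>t1\<bar>)"
      have R: "R > 0" using s1 r1 \<rho> by (simp add: R_def)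
      have Q: "Q > 0" by (simp add: Q_def)
      define s0 where "s0 = min (min s1 s2) (min s3 (R / Q))"
      show thesis
      proof (rule that[of s0])
        show "0 < s0" "s0 < L" using s1 s2 s3 R Q by (auto simp: s0_def)
        fix s y assume s: "0 < s" "s < s0" and y: "tan (\<theta>1 - t0) * (p s \<bullet> e) \<le> y" "y < p s \<bullet> k"
        define X where "X = p s \<bullet> e"
        define x where "x = X *\<^sub>R e + y *\<^sub>R k"
        have X: "X > 0" using s2(2)[of s] s by (simp add: s0_def X_def zero_less_divide_iff)
        have xe: "x \<bullet> e = X" "x \<bullet> k = y" using on by (simp_all add: x_def inner_add_left)
        define \<theta> where "\<theta> = t0 + arctan (y / X)"
        have px: "x = norm x *\<^sub>R dir \<sigma> \<theta>"
          using polar_angle[OF \<sigma>2, of x t0] xe X unfolding \<theta>_def e_def k_def by simp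
        have n: "norm (p s) \<le> 2 * s" using s3(3)[of s] s by (simp add: s0_def)
        have "\<bar>X\<bar> \<le> 2 * s" "\<bar>p s \<bullet> k\<bar> \<le> 2 * s" using n dir_norm_le[of "p s"] order_trans unfolding X_def e_def k_def by blast+
        note small = this
        have "\<bar>t1 * X\<bar> \<le> \<bar>t1\<bar> * (2 * s)" unfolding abs_mult using small(1) by (intro mult_left_mono) auto
        then have "\<bar>y\<bar> \<le> \<bar>t1\<bar> * (2 * s) + 2 * s" using y small(2) s unfolding X_def[symmetric] t1_def[symmetric] by auto
        moreover have "norm x \<le> \<bar>X\<bar> + \<bar>y\<bar>" using norm_triangle_ineq[of "X *\<^sub>R e" "y *\<^sub>R k"] k1 by (simp add: x_def)
        ultimately have "norm x \<le> Q * s" using small(1) by (simp add: Q_def algebra_simps)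
        also have "\<dots> < R" using s Q by (simp add: s0_def less_divide_eq mult.commute)
        finally have nR: "norm x < R" .
        have n0: "norm x > 0" using X xe on by auto
        have "t1 \<le> y / X" using y(1) X by (simp add: X_def t1_def le_divide_eq)
        then have "arctan t1 \<le> arctan (y / X)" by (simp add: arctan_le_iff)
        then have th1: "\<theta>1 \<le> \<theta>" by (simp add: at1 \<theta>_def)
        have "y / X < (p s \<bullet> k) / X" using y X by (simp add: divide_strict_right_mono)
        then have "arctan (y / X) < arctan ((p s \<bullet> k) / X)" by (simp add: arctan_less_iff)
        then have th2: "\<theta> < \<alpha> + \<eta>" using s2(2)[of s] s by (simp add: s0_def \<theta>_def X_def)
        have "x \<in> \<Omega>"
        proof (cases "\<theta> \<le> \<alpha> - \<eta>")
          case True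
          then show ?thesis using r1(2)[of "norm x"] nR n0 th1 px inside[of "norm x" \<theta>] by (simp add: R_def)
        next
          case False
          define \<phi> where "\<phi> = \<theta> - \<alpha>"
          have phi: "\<bar>\<phi>\<bar> < \<eta>" using False th2 by (auto simp: \<phi>_def)
          have "cos (pi/3) < cos \<bar>\<phi>\<bar>" using phi eta by (intro cos_monotone_0_pi) auto
          then have c: "1/2 < cos \<phi>" by (simp add: cos_60)
          have "\<bar>sin \<phi>\<bar> < \<mu>/2" using abs_sin_x_le_abs_x[of \<phi>] phi eta by linarith
          also have "\<mu>/2 \<le> \<mu> * cos \<phi>" using c s1 by simp
          finally have sc: "norm x * \<bar>sin \<phi>\<bar> < norm x * (\<mu> * cos \<phi>)" using n0 by simp
          have "x \<bullet> N = norm x * sin \<phi>" "x \<bullet> \<tau> = norm x * cos \<phi>"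
            by (subst px, simp add: dir_inner[OF \<sigma>2] \<phi>_def cos_diff sin_diff cos_add sin_add)+
          then have cone: "\<bar>x \<bullet> N\<bar> < \<mu> * (x \<bullet> \<tau>)" using sc by (simp add: abs_mult mult_ac)
          have xp: "x = p s - (p s \<bullet> k - y) *\<^sub>R k"
            unfolding x_def X_def using dir_expand[OF \<sigma>2, of "p s" t0, folded e_def k_def, symmetric]
            by (simp add: scaleR_diff_left eq_diff_eq)
          show ?thesis
            using below[of s "p s \<bullet> k - y" k] cone nR y(2) s kN kt unfolding xp[symmetric]
            by (simp add: s0_def R_def)
        qed
        then show "(p s \<bullet> e) *\<^sub>R e + y *\<^sub>R k \<in> \<Omega>" by (simp add: x_def X_def)
      qed
    qed
  qed assumption+
qed

section \<open>Averages of the contact angle bound the side fan\<close>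

lemma arc_C1:
  shows p_deriv: "0 < s \<Longrightarrow> s < L \<Longrightarrow> (p has_vector_derivative p' s) (at s)"
    and p_unit_speed: "0 < s \<Longrightarrow> s < L \<Longrightarrow> norm (p' s) = 1"
    and p'_cont: "continuous_on {0<..<L} p'"
proof -
  have C1: "p C1_differentiable_on {0<..<L}" and unit: "\<forall>s\<in>{0<..<L}. norm (p' s) = 1"
    using arc unfolding boundary_arc_def by blast+
  show "norm (p' s) = 1" if "0 < s" "s < L" using unit that by simp
  show "(p has_vector_derivative p' s) (at s)" if "0 < s" "s < L"
    using C1 that unfolding C1_differentiable_on_eq by (simp add: vector_derivative_works)
  show "continuous_on {0<..<L} p'" using C1 unfolding C1_differentiable_on_eq by blast
qed

text \<open>
  The point of the ray \<open>\<theta>\<close> over the same abscissa \<open>p s \<bullet> dir \<sigma> t0\<close> as the arc point \<open>p s\<close> tends to the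
  corner along the ray, hence sees the radial limit.
\<close>

lemma ray_limit:
  assumes t: "\<bar>\<alpha> - t0\<bar> < pi/2" and \<theta>: "t0 - pi/2 < \<theta>" "\<theta> < t0 + pi/2"
    and l: "((\<lambda>r. f (r *\<^sub>R dir \<sigma> \<theta>)) \<longlongrightarrow> l) (at_right 0)"
  shows "((\<lambda>s. f ((p s \<bullet> dir \<sigma> t0) *\<^sub>R dir \<sigma> t0 + (tan (\<theta> - t0) * (p s \<bullet> dir \<sigma> t0)) *\<^sub>R dir \<sigma> (t0 + pi/2))) \<longlongrightarrow> l) (at_right 0)"
proof -
  define q where "q = cos (\<theta> - t0)"
  have q: "q > 0" using \<theta> unfolding q_def by (intro cos_gt_zero_pi) auto
  have c: "cos (\<alpha> - t0) > 0" using t unfolding abs_less_iff by (intro cos_gt_zero_pi) linarith+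
  define r where "r = (\<lambda>s. (p s \<bullet> dir \<sigma> t0) / q)"
  have "((\<lambda>s. ((p s \<bullet> dir \<sigma> t0) / s) * s / q) \<longlongrightarrow> cos (\<alpha> - t0) * 0 / q) (at_right 0)"
    using q by (intro tendsto_intros p_quotient_inner) auto
  moreover have "\<forall>\<^sub>F s in at_right 0. ((p s \<bullet> dir \<sigma> t0) / s) * s / q = r s"
    unfolding eventually_at_right_field r_def by (intro exI[of _ 1]) auto
  ultimately have "(r \<longlongrightarrow> cos (\<alpha> - t0) * 0 / q) (at_right 0)" by (rule Lim_transform_eventually)
  then have r0: "(r \<longlongrightarrow> 0) (at_right 0)" by simp
  have "\<forall>\<^sub>F s in at_right 0. (p s \<bullet> dir \<sigma> t0) / s > 0"
    using order_tendstoD(1)[OF p_quotient_inner c] .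
  moreover have "\<forall>\<^sub>F s in at_right (0::real). s > 0" by (simp add: eventually_at_right_less)
  ultimately have "\<forall>\<^sub>F s in at_right 0. r s \<in> {0<..} \<and> r s \<noteq> 0"
    by eventually_elim (use q in \<open>auto simp: r_def zero_less_divide_iff\<close>)
  then have "filterlim r (at_right 0) (at_right 0)"
    using r0 by (simp add: filterlim_at)
  from filterlim_compose[OF l this]
  have "((\<lambda>s. f (r s *\<^sub>R dir \<sigma> \<theta>)) \<longlongrightarrow> l) (at_right 0)" .
  moreover have "r s *\<^sub>R dir \<sigma> \<theta> = (p s \<bullet> dir \<sigma> t0) *\<^sub>R dir \<sigma> t0 + (tan (\<theta> - t0) * (p s \<bullet> dir \<sigma> t0)) *\<^sub>R dir \<sigma> (t0 + pi/2)" for s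
  proof -
    have "r s *\<^sub>R dir \<sigma> \<theta> = r s *\<^sub>R ((dir \<sigma> \<theta> \<bullet> dir \<sigma> t0) *\<^sub>R dir \<sigma> t0 + (dir \<sigma> \<theta> \<bullet> dir \<sigma> (t0 + pi/2)) *\<^sub>R dir \<sigma> (t0 + pi/2))"
      by (subst dir_expand[OF \<sigma>2, of "dir \<sigma> \<theta>" t0]) simp
    also have "dir \<sigma> \<theta> \<bullet> dir \<sigma> t0 = q" by (simp add: dir_inner[OF \<sigma>2] q_def)
    also have "dir \<sigma> \<theta> \<bullet> dir \<sigma> (t0 + pi/2) = sin (\<theta> - t0)" 
      by (simp add: dir_inner[OF \<sigma>2] cos_diff sin_diff cos_add sin_add)
    finally show ?thesis using q by (simp add: scaleR_add_right r_def tan_def q_def[symmetric] mult.commute)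
  qed
  ultimately show ?thesis by simp
qed

text \<open>
  The flux estimate, moved to the boundary. Here \<open>e = dir \<sigma> t0\<close>, and \<open>- (p S \<bullet> k)\<close> is the integral of
  \<open>e \<bullet> \<nu>\<close> over the arc. The flux is computed over arclength \<open>s0\<close> to \<open>S\<close> on the arc translated by
  \<open>- u *\<^sub>R k\<close>; first \<open>u\<close> and then \<open>s0\<close> tends to \<open>0\<close>.
\<close>

lemma contact_integral_lower_bound:
  fixes c :: "real \<Rightarrow> real"
  assumes cf: "capillary_field \<Omega> C f g T DT" and M: "\<And>x. x \<in> \<Omega> \<Longrightarrow> \<bar>f x\<bar> \<le> M"
    and \<nu>: "\<And>s. 0 < s \<Longrightarrow> s < L \<Longrightarrow> exterior_unit_normal \<Omega> p s (\<nu> s)"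
    and lim: "\<And>s. 0 < s \<Longrightarrow> s < L \<Longrightarrow> nontangential_limit \<Omega> (\<lambda>x. T x \<bullet> \<nu> s) (p s) (c s)"
    and c_meas: "c \<in> borel_measurable (lebesgue_on {0..<L})" and c_le: "\<And>s. \<bar>c s\<bar> \<le> 1"
    and t: "\<bar>\<alpha> - t0\<bar> < pi/2" and \<theta>: "- \<alpha> < \<theta>1" "\<theta>1 < \<theta>2" "\<theta>2 < \<alpha>" "t0 - pi/2 < \<theta>1"
    and l1: "((\<lambda>r. f (r *\<^sub>R dir \<sigma> \<theta>1)) \<longlongrightarrow> l1) (at_right 0)"
    and l2: "((\<lambda>r. f (r *\<^sub>R dir \<sigma> \<theta>2)) \<longlongrightarrow> l2) (at_right 0)" and l: "l1 < l2"
  obtains s1 K where "0 < s1" "s1 < L"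
    "\<And>S. 0 < S \<Longrightarrow> S < s1 \<Longrightarrow> c integrable_on {0..S} \<and> - (p S \<bullet> dir \<sigma> (t0 + pi/2)) - K * S\<^sup>2 \<le> integral {0..S} c"
proof -
  interpret cf: capillary_field \<Omega> C f g T DT by fact
  define e k where "e = dir \<sigma> t0" and "k = dir \<sigma> (t0 + pi/2)"
  define t1 t2 where "t1 = tan (\<theta>1 - t0)" and "t2 = tan (\<theta>2 - t0)"
  have \<theta>': "\<theta>1 < t0 + pi/2" "t0 - pi/2 < \<theta>2" "\<theta>2 < t0 + pi/2" using \<theta> t unfolding abs_less_iff by linarith+
  have t12: "t1 < t2" and t2\<alpha>: "t2 < tan (\<alpha> - t0)"
    unfolding t1_def t2_def using \<theta> \<theta>' t unfolding abs_less_iff by (auto intro!: tan_monotone)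
  define a where "a = cos (\<alpha> - t0)"
  have a: "a > 0" using t unfolding abs_less_iff a_def by (intro cos_gt_zero_pi) linarith+
  have n1: "norm e = 1" "norm k = 1" by (simp_all add: e_def k_def norm_dir[OF \<sigma>2])
  have le_e: "\<bar>x \<bullet> e\<bar> \<le> norm x" and le_k: "\<bar>x \<bullet> k\<bar> \<le> norm x" for x
    unfolding e_def k_def by (rule dir_norm_le)+
  have expand: "(x \<bullet> e) *\<^sub>R e + (x \<bullet> k) *\<^sub>R k = x" for x
    using dir_expand[OF \<sigma>2, of x t0] by (simp add: e_def k_def)
  \<comment> \<open>For small \<open>s0\<close>, translations by less than \<open>\<kappa> * s0\<close> keep the arc from \<open>s0\<close> on above the ray \<open>\<theta>2\<close>.\<close>
  define \<kappa> where "\<kappa> = a * (tan (\<alpha> - t0) - t2) / 2"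
  have \<kappa>: "\<kappa> > 0" using a t2\<alpha> by (simp add: \<kappa>_def)
  define z1 z2 where "z1 = l1 + (l2 - l1)/3" and "z2 = l2 - (l2 - l1)/3"
  have z: "l1 < z1" "z1 < z2" "z2 < l2" using l by (auto simp: z1_def z2_def field_simps)
  obtain C' where C': "C' \<ge> 0" and
    flux: "\<And>s0 s1 \<xi> \<xi>' b b' t1 t2 K. \<lbrakk>s0 \<le> s1; t1 < t2;
      \<And>s. s \<in> {s0..s1} \<Longrightarrow> (\<xi> has_vector_derivative \<xi>' s) (at s within {s0..s1});
      \<And>s. s \<in> {s0..s1} \<Longrightarrow> (b has_vector_derivative b' s) (at s within {s0..s1});
      continuous_on {s0..s1} \<xi>'; continuous_on {s0..s1} b';
      \<And>s. s \<in> {s0..s1} \<Longrightarrow> 0 \<le> \<xi> s \<and> t2 * \<xi> s \<le> b s \<and> 0 \<le> \<xi>' s \<and> (b s - t1 * \<xi> s) * \<xi>' s \<le> K;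
      \<And>s y. s \<in> {s0..s1} \<Longrightarrow> t1 * \<xi> s \<le> y \<Longrightarrow> y \<le> b s \<Longrightarrow> \<xi> s *\<^sub>R e + y *\<^sub>R k \<in> \<Omega>;
      \<And>s. s \<in> {s0..s1} \<Longrightarrow> f (\<xi> s *\<^sub>R e + (t1 * \<xi> s) *\<^sub>R k) \<le> z1;
      \<And>s. s \<in> {s0..s1} \<Longrightarrow> z2 \<le> f (\<xi> s *\<^sub>R e + (t2 * \<xi> s) *\<^sub>R k)\<rbrakk>
     \<Longrightarrow> integral {s0..s1} (\<lambda>s. T (\<xi> s *\<^sub>R e + b s *\<^sub>R k) \<bullet> (\<xi>' s *\<^sub>R k - b' s *\<^sub>R e) + b' s)
         \<ge> - C' * K * (s1 - s0) - 2 * (b s0 - t1 * \<xi> s0)"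
    by (rule cf.flux_lower_bound[OF \<sigma>2 z(2) M, of t0, folded e_def k_def]) blast+
  obtain sa where sa: "0 < sa" "sa < L" "\<And>s y. \<lbrakk>0 < s; s < sa; t1 * (p s \<bullet> e) \<le> y; y < p s \<bullet> k\<rbrakk> \<Longrightarrow> (p s \<bullet> e) *\<^sub>R e + y *\<^sub>R k \<in> \<Omega>"
  proof (rule region_below_arc[OF t \<theta>(1) _ \<theta>(4) \<theta>'(1), folded e_def k_def t1_def])
    show "\<theta>1 < \<alpha>" using \<theta> by simp
  qed (rule that; assumption)
  obtain sb where sb: "0 < sb" "sb < L" "\<And>s n. 0 < s \<Longrightarrow> s < sb \<Longrightarrow> exterior_unit_normal \<Omega> p s n \<Longrightarrow> n = rot \<sigma> (p' s)"
    by (rule normal_is_rot) blast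
  obtain sc where sc: "0 < sc" "sc < L" "\<And>s h c. 0 < s \<Longrightarrow> s < sc \<Longrightarrow> nontangential_limit \<Omega> h (p s) c \<Longrightarrow>
       ((\<lambda>u. h (p s - u *\<^sub>R k)) \<longlongrightarrow> c) (at_right 0)"
    by (rule nontangential_path[OF a[unfolded a_def], folded k_def]) blast
  obtain sd where sd: "0 < sd" "sd < L" "\<And>s. 0 \<le> s \<Longrightarrow> s \<le> sd \<Longrightarrow> norm (p s) \<le> 2 * s"
    by (rule norm_p_le) blast
  obtain se where se: "0 < se" "se < L" "\<And>s. 0 < s \<Longrightarrow> s \<le> se \<Longrightarrow> norm (p' s - \<tau>) \<le> a"
    by (rule tangent[OF a]) blast
  have "\<forall>\<^sub>F s in at_right 0. f ((p s \<bullet> e) *\<^sub>R e + (t1 * (p s \<bullet> e)) *\<^sub>R k) < z1"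
    unfolding e_def k_def t1_def by (rule order_tendstoD(2)[OF ray_limit[OF t \<theta>(4) \<theta>'(1) l1] z(1)])
  moreover have "\<forall>\<^sub>F s in at_right 0. z2 < f ((p s \<bullet> e) *\<^sub>R e + (t2 * (p s \<bullet> e)) *\<^sub>R k)"
    unfolding e_def k_def t2_def by (rule order_tendstoD(1)[OF ray_limit[OF t \<theta>'(2) \<theta>'(3) l2] z(3)])
  moreover have "\<forall>\<^sub>F s in at_right 0. (p s \<bullet> e) / s > 0"
    unfolding e_def by (rule order_tendstoD(1)[OF p_quotient_inner a[unfolded a_def]])
  moreover have "\<forall>\<^sub>F s in at_right 0. (p s \<bullet> k) / s - t2 * ((p s \<bullet> e) / s) > \<kappa>"
  proof (rule order_tendstoD(1))
    show "((\<lambda>s. (p s \<bullet> k) / s - t2 * ((p s \<bullet> e) / s)) \<longlongrightarrow> sin (\<alpha> - t0) - t2 * a) (at_right 0)"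
      using p_quotient_inner[of "t0 + pi/2"] unfolding e_def k_def a_def
      by (intro tendsto_intros p_quotient_inner) (simp add: cos_diff sin_diff cos_add sin_add)
    have "a * tan (\<alpha> - t0) = sin (\<alpha> - t0)" using a by (simp add: tan_def a_def)
    then have "sin (\<alpha> - t0) - t2 * a = 2 * \<kappa>" by (simp add: \<kappa>_def right_diff_distrib mult.commute)
    then show "\<kappa> < sin (\<alpha> - t0) - t2 * a" using \<kappa> by simp
  qed
  ultimately have "\<forall>\<^sub>F s in at_right 0. f ((p s \<bullet> e) *\<^sub>R e + (t1 * (p s \<bullet> e)) *\<^sub>R k) < z1
      \<and> z2 < f ((p s \<bullet> e) *\<^sub>R e + (t2 * (p s \<bullet> e)) *\<^sub>R k) \<and> (p s \<bullet> e) / s > 0 \<and> (p s \<bullet> k) / s - t2 * ((p s \<bullet> e) / s) > \<kappa>"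
    by eventually_elim simp
  then obtain sf where sf0: "0 < sf" and sf: "\<And>s. 0 < s \<Longrightarrow> s < sf \<Longrightarrow> f ((p s \<bullet> e) *\<^sub>R e + (t1 * (p s \<bullet> e)) *\<^sub>R k) < z1
      \<and> z2 < f ((p s \<bullet> e) *\<^sub>R e + (t2 * (p s \<bullet> e)) *\<^sub>R k) \<and> (p s \<bullet> e) / s > 0 \<and> (p s \<bullet> k) / s - t2 * ((p s \<bullet> e) / s) > \<kappa>"
    by (rule eventually_at_right_0E) blast
  define s1 where "s1 = min (min sa sb) (min (min sc sd) (min se sf))"
  define Q where "Q = 2 * (1 + \<bar>t1\<bar>)"
  have Q: "Q > 0" by (simp add: Q_def)
  have cint: "c integrable_on {0..S}" if "S < L" for S
  proof (rule measurable_bounded_by_integrable_imp_integrable)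
    show "c \<in> borel_measurable (lebesgue_on {0..S})"
      by (rule measurable_restrict_mono[OF c_meas]) (use that in auto)
    show "(\<lambda>_. 1::real) integrable_on {0..S}" by (rule integrable_const_ivl)
  qed (use c_le in auto)
  show thesis
  proof (rule that[of s1 "C' * Q"])
    show "0 < s1" "s1 < L" using sa(1,2) sb(1,2) sc(1,2) sd(1,2) se(1,2) sf0 by (auto simp: s1_def)
    fix S assume S: "0 < S" "S < s1"
    have SL: "S < L" using S sa(2) by (simp add: s1_def)
    have bound: "- (C' * Q * S\<^sup>2) - 2 * Q * s0 - (p S \<bullet> k - p s0 \<bullet> k) \<le> integral {s0..S} c"
      if s0: "0 < s0" "s0 < S" for s0
    proof -
      have p_der: "(p has_vector_derivative p' s) (at s within X)" if "s \<in> {s0..S}" for s X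
        by (rule has_vector_derivative_at_within, rule p_deriv) (use that s0 SL in auto)
      have p1: "norm (p' s) = 1" if "s \<in> {s0..S}" for s
        using p_unit_speed[of s] that s0 SL by auto
      have cp': "continuous_on {s0..S} p'"
        by (rule continuous_on_subset[OF p'_cont]) (use s0 SL in auto)
      have cp: "continuous_on {s0..S} p" by (rule continuous_on_vector_derivative[OF p_der])
      have facts: "0 < p s \<bullet> e" "t2 * (p s \<bullet> e) + \<kappa> * s0 \<le> p s \<bullet> k" "0 \<le> p' s \<bullet> e"
           "p s \<bullet> k - t1 * (p s \<bullet> e) \<le> Q * s" if s: "s \<in> {s0..S}" for s
      proof -
        have s': "0 < s" "s < sf" "s \<le> sd" "s \<le> se" using s s0 S by (auto simp: s1_def)
        have q: "0 < (p s \<bullet> e) / s" "\<kappa> < (p s \<bullet> k) / s - t2 * ((p s \<bullet> e) / s)"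
          using sf[OF s'(1,2)] by blast+
        show "0 < p s \<bullet> e" using q(1) s'(1) by (simp add: zero_less_divide_iff)
        have "(p s \<bullet> k) / s - t2 * ((p s \<bullet> e) / s) = (p s \<bullet> k - t2 * (p s \<bullet> e)) / s"
          by (simp add: diff_divide_distrib)
        then have "\<kappa> * s < p s \<bullet> k - t2 * (p s \<bullet> e)"
          using q(2) s'(1) by (simp add: less_divide_eq)
        moreover have "\<kappa> * s0 \<le> \<kappa> * s" using s \<kappa> by simp
        ultimately show "t2 * (p s \<bullet> e) + \<kappa> * s0 \<le> p s \<bullet> k" by simp
        have "\<tau> \<bullet> e = a" by (simp add: e_def a_def dir_inner[OF \<sigma>2])
        then show "0 \<le> p' s \<bullet> e" using le_e[of "p' s - \<tau>"] se(3)[of s] s' by (simp add: inner_diff_left abs_le_iff)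
        have np: "norm (p s) \<le> 2 * s" using sd(3)[of s] s' by simp
        have "\<bar>t1 * (p s \<bullet> e)\<bar> \<le> \<bar>t1\<bar> * (2 * s)"
          unfolding abs_mult using le_e[of "p s"] np by (intro mult_left_mono) auto
        then show "p s \<bullet> k - t1 * (p s \<bullet> e) \<le> Q * s"
          using le_k[of "p s"] np by (simp add: Q_def algebra_simps abs_le_iff)
      qed
      have inO: "p s - u *\<^sub>R k \<in> \<Omega>" if "s \<in> {s0..S}" "0 < u" "u < \<kappa> * s0" for s u
      proof -
        have "t1 * (p s \<bullet> e) \<le> t2 * (p s \<bullet> e)" using facts(1)[OF that(1)] t12 by simp
        then have "(p s \<bullet> e) *\<^sub>R e + (p s \<bullet> k - u) *\<^sub>R k \<in> \<Omega>"
          using that s0 S facts(2)[OF that(1)] by (intro sa(3)) (auto simp: s1_def)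
        then show ?thesis using expand[of "p s"] by (simp add: scaleR_diff_left add_diff_eq)
      qed
      define F where "F = (\<lambda>u s. T (p s - u *\<^sub>R k) \<bullet> rot \<sigma> (p' s) + p' s \<bullet> k)"
      have F_ge: "- (C' * Q * S\<^sup>2) - 2 * Q * s0 \<le> integral {s0..S} (F u)" if u: "0 < u" "u < \<kappa> * s0" for u
      proof -
        have "- C' * (Q * S) * (S - s0) - 2 * ((p s0 \<bullet> k - u) - t1 * (p s0 \<bullet> e)) \<le>
          integral {s0..S} (\<lambda>s. T ((p s \<bullet> e) *\<^sub>R e + (p s \<bullet> k - u) *\<^sub>R k) \<bullet> ((p' s \<bullet> e) *\<^sub>R k - (p' s \<bullet> k) *\<^sub>R e) + p' s \<bullet> k)"
        proof (rule flux[where ?t2.0 = t2 and ?t1.0 = t1])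
          show "((\<lambda>s. p s \<bullet> e) has_vector_derivative p' s \<bullet> e) (at s within {s0..S})" if "s \<in> {s0..S}" for s
            by (rule bounded_linear.has_vector_derivative[OF bounded_linear_inner_left p_der[OF that]])
          show "((\<lambda>s. p s \<bullet> k - u) has_vector_derivative p' s \<bullet> k) (at s within {s0..S})" if "s \<in> {s0..S}" for s
            using has_vector_derivative_diff[OF bounded_linear.has_vector_derivative[OF bounded_linear_inner_left[of k] p_der[OF that]]
                has_vector_derivative_const[of u]] by simp
          show "continuous_on {s0..S} (\<lambda>s. p' s \<bullet> e)" "continuous_on {s0..S} (\<lambda>s. p' s \<bullet> k)"
            by (intro continuous_intros cp')+
          fix s assume s: "s \<in> {s0..S}"
          have s': "0 < s" "s < sf" "s < sa" using s s0 S by (auto simp: s1_def)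
          have "(p s \<bullet> k - u - t1 * (p s \<bullet> e)) * (p' s \<bullet> e) \<le> (Q * S) * 1"
          proof (rule mult_mono)
            have "Q * s \<le> Q * S" using s Q by simp
            then show "p s \<bullet> k - u - t1 * (p s \<bullet> e) \<le> Q * S" using facts(4)[OF s] u by linarith
            show "p' s \<bullet> e \<le> 1" using le_e[of "p' s"] p1[OF s] by simp
          qed (use Q S facts(3)[OF s] in auto)
          then show "0 \<le> p s \<bullet> e \<and> t2 * (p s \<bullet> e) \<le> p s \<bullet> k - u \<and> 0 \<le> p' s \<bullet> e \<and>
              (p s \<bullet> k - u - t1 * (p s \<bullet> e)) * (p' s \<bullet> e) \<le> Q * S"
            using facts[OF s] u by simp
          show "f ((p s \<bullet> e) *\<^sub>R e + (t1 * (p s \<bullet> e)) *\<^sub>R k) \<le> z1" "z2 \<le> f ((p s \<bullet> e) *\<^sub>R e + (t2 * (p s \<bullet> e)) *\<^sub>R k)"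
            using sf[OF s'(1,2)] by auto
          show "(p s \<bullet> e) *\<^sub>R e + y *\<^sub>R k \<in> \<Omega>" if "t1 * (p s \<bullet> e) \<le> y" "y \<le> p s \<bullet> k - u" for y
            using sa(3)[OF s'(1,3) that(1)] that u by simp
        qed (use s0 t12 in auto)
        moreover have "(p s \<bullet> e) *\<^sub>R e + (p s \<bullet> k - u) *\<^sub>R k = p s - u *\<^sub>R k" for s
          using expand[of "p s"] by (simp add: scaleR_diff_left add_diff_eq)
        moreover have "(p' s \<bullet> e) *\<^sub>R k - (p' s \<bullet> k) *\<^sub>R e = rot \<sigma> (p' s)" for s
          unfolding e_def k_def by (rule rot_expand[OF \<sigma>2, symmetric])
        ultimately have "- C' * (Q * S) * (S - s0) - 2 * ((p s0 \<bullet> k - u) - t1 * (p s0 \<bullet> e)) \<le> integral {s0..S} (F u)"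
          by (simp add: F_def)
        moreover have "C' * (Q * S) * (S - s0) \<le> C' * (Q * S) * S"
          using C' Q S s0 by (intro mult_left_mono) auto
        ultimately show ?thesis using facts(4)[of s0] s0 u by (simp add: power2_eq_square algebra_simps)
      qed
      define u where "u = (\<lambda>n::nat. (\<kappa> * s0 / 2) * inverse (real (Suc n)))"
      have ks: "0 < \<kappa> * s0" using \<kappa> s0 by simp
      have u: "0 < u n" "u n < \<kappa> * s0" for n
      proof -
        show "0 < u n" using ks by (simp add: u_def)
        have "inverse (real (Suc n)) \<le> 1" by (simp add: inverse_le_1_iff)
        then have "u n \<le> (\<kappa> * s0 / 2) * 1" unfolding u_def using ks by (intro mult_left_mono) auto
        then show "u n < \<kappa> * s0" using ks by linarith
      qed
      have "u \<longlonglongrightarrow> (\<kappa> * s0 / 2) * 0" unfolding u_def by (intro tendsto_intros LIMSEQ_inverse_real_of_nat)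
      then have "u \<longlonglongrightarrow> 0" by simp
      then have u_lim: "filterlim u (at_right 0) sequentially"
        using u by (simp add: filterlim_at eventually_sequentiallyI less_imp_neq[symmetric])
      have F_int: "F (u n) integrable_on {s0..S}" for n
      proof -
        have crot: "continuous_on {s0..S} (\<lambda>s. rot \<sigma> (p' s))" unfolding rot_def by (intro continuous_intros cp')
        have "continuous_on \<Omega> T" using cf.T_deriv by (auto intro!: continuous_at_imp_continuous_on has_derivative_continuous)
        then have "continuous_on {s0..S} (\<lambda>s. T (p s - u n *\<^sub>R k))"
          by (rule continuous_on_compose2) (use inO u in \<open>auto intro!: continuous_intros cp\<close>)
        then show ?thesis
          unfolding F_def by (intro integrable_continuous_real continuous_intros cp' crot)
      qed
      have F_le: "norm (F (u n) s) \<le> 2" if s: "s \<in> {s0..S}" for n s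
      proof -
        have "\<bar>T (p s - u n *\<^sub>R k) \<bullet> rot \<sigma> (p' s)\<bar> \<le> 1"
          using Cauchy_Schwarz_ineq2[of "T (p s - u n *\<^sub>R k)" "rot \<sigma> (p' s)"] cf.T_le[OF inO[OF s u(1)[of n] u(2)[of n]]]
          by (simp add: rot_props(1)[OF \<sigma>2] p1[OF s])
        then show ?thesis using le_k[of "p' s"] p1[OF s] by (simp add: F_def)
      qed
      have F_lim: "(\<lambda>n. F (u n) s) \<longlonglongrightarrow> c s + p' s \<bullet> k" if s: "s \<in> {s0..S}" for s
      proof -
        have s': "0 < s" "s < sb" "s < sc" "s < L" using s s0 S SL by (auto simp: s1_def)
        have "\<nu> s = rot \<sigma> (p' s)" by (rule sb(3)[OF s'(1,2) \<nu>[OF s'(1,4)]])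
        with sc(3)[OF s'(1,3) lim[OF s'(1,4)]]
        have "((\<lambda>u. T (p s - u *\<^sub>R k) \<bullet> rot \<sigma> (p' s)) \<longlongrightarrow> c s) (at_right 0)" by simp
        from filterlim_compose[OF this u_lim]
        show ?thesis unfolding F_def by (intro tendsto_intros)
      qed
      note DCT = dominated_convergence[where f = "\<lambda>n. F (u n)", OF F_int integrable_const_ivl F_le F_lim]
      have "- (C' * Q * S\<^sup>2) - 2 * Q * s0 \<le> integral {s0..S} (\<lambda>s. c s + p' s \<bullet> k)"
        by (rule LIMSEQ_le_const[OF DCT(2)]) (use F_ge u in auto)
      also have "\<dots> = integral {s0..S} c + integral {s0..S} (\<lambda>s. p' s \<bullet> k)"
        by (intro integral_add integrable_subinterval_real[OF cint[OF SL]] integrable_continuous_real continuous_intros cp') (use s0 in auto)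
      also have "integral {s0..S} (\<lambda>s. p' s \<bullet> k) = p S \<bullet> k - p s0 \<bullet> k"
        by (intro integral_unique fundamental_theorem_of_calculus bounded_linear.has_vector_derivative[OF bounded_linear_inner_left p_der]) (use s0 in auto)
      finally show ?thesis by simp
    qed
    have "- (p S \<bullet> k) - (C' * Q) * S\<^sup>2 \<le> integral {0..S} c"
    proof (rule field_le_epsilon)
      fix \<epsilon> :: real assume \<epsilon>: "0 < \<epsilon>"
      define s0 where "s0 = min (S/2) (\<epsilon> / (3 + 2 * Q))"
      have s0: "0 < s0" "s0 < S" using S \<epsilon> Q by (auto simp: s0_def)
      have e: "(3 + 2 * Q) * s0 \<le> \<epsilon>"
      proof -
        have "s0 \<le> \<epsilon> / (3 + 2 * Q)" by (simp add: s0_def)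
        then show ?thesis using Q by (simp add: le_divide_eq mult.commute)
      qed
      have "norm (p s0) \<le> 2 * s0" using sd(3)[of s0] s0 S by (simp add: s1_def)
      then have "\<bar>p s0 \<bullet> k\<bar> \<le> 2 * s0" using le_k[of "p s0"] by linarith
      moreover have "integral {0..s0} c \<ge> integral {0..s0} (\<lambda>_. - 1)"
        using c_le s0 SL by (intro integral_le integrable_const_ivl cint) (auto simp: abs_le_iff minus_le_iff)
      moreover have "integral {0..s0} c + integral {s0..S} c = integral {0..S} c"
        using s0 by (intro Henstock_Kurzweil_Integration.integral_combine cint[OF SL]) auto
      ultimately show "- (p S \<bullet> k) - (C' * Q) * S\<^sup>2 \<le> integral {0..S} c + \<epsilon>"
        using bound[OF s0] e s0 by (simp add: algebra_simps abs_le_iff)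
    qed
    then show "c integrable_on {0..S} \<and> - (p S \<bullet> dir \<sigma> (t0 + pi/2)) - (C' * Q) * S\<^sup>2 \<le> integral {0..S} c"
      using cint[OF SL] by (simp add: k_def)
  qed
qed

lemma liminf_lower_bound:
  fixes c :: "real \<Rightarrow> real"
  assumes cf: "capillary_field \<Omega> C f g T DT" and M: "\<And>x. x \<in> \<Omega> \<Longrightarrow> \<bar>f x\<bar> \<le> M"
    and \<nu>: "\<And>s. 0 < s \<Longrightarrow> s < L \<Longrightarrow> exterior_unit_normal \<Omega> p s (\<nu> s)"
    and lim: "\<And>s. 0 < s \<Longrightarrow> s < L \<Longrightarrow> nontangential_limit \<Omega> (\<lambda>x. T x \<bullet> \<nu> s) (p s) (c s)"
    and c_meas: "c \<in> borel_measurable (lebesgue_on {0..<L})" and c_le: "\<And>s. \<bar>c s\<bar> \<le> 1"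
    and t: "\<bar>\<alpha> - t0\<bar> < pi/2" and \<theta>: "- \<alpha> < \<theta>1" "\<theta>1 < \<theta>2" "\<theta>2 < \<alpha>" "t0 - pi/2 < \<theta>1"
    and l1: "((\<lambda>r. f (r *\<^sub>R dir \<sigma> \<theta>1)) \<longlongrightarrow> l1) (at_right 0)"
    and l2: "((\<lambda>r. f (r *\<^sub>R dir \<sigma> \<theta>2)) \<longlongrightarrow> l2) (at_right 0)" and l: "l1 < l2" and b: "0 < b"
  shows "ereal (- b * sin (\<alpha> - t0)) \<le> Liminf (at_right 0) (\<lambda>\<epsilon>. ereal (1 / \<epsilon> * integral {0..b * \<epsilon>} c))"
proof -
  define k where "k = dir \<sigma> (t0 + pi/2)"
  obtain s1 K where s1: "0 < s1" and
    "\<And>S. 0 < S \<Longrightarrow> S < s1 \<Longrightarrow> c integrable_on {0..S} \<and> - (p S \<bullet> k) - K * S\<^sup>2 \<le> integral {0..S} c"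
    by (rule contact_integral_lower_bound[OF cf M \<nu> lim c_meas c_le t \<theta> l1 l2 l, folded k_def]) (assumption | rule that)+
  then have ineq: "- (p S \<bullet> k) - K * S\<^sup>2 \<le> integral {0..S} c" if "0 < S" "S < s1" for S
    using that by blast
  define h where "h = (\<lambda>\<epsilon>. - (b * ((p (b * \<epsilon>) \<bullet> k) / (b * \<epsilon>))) - K * b\<^sup>2 * \<epsilon>)"
  have "((\<lambda>\<epsilon>. b * \<epsilon>) \<longlongrightarrow> b * 0) (at_right 0)" by (intro tendsto_intros)
  moreover have "\<forall>\<^sub>F \<epsilon> in at_right 0. b * \<epsilon> \<in> {0<..} \<and> b * \<epsilon> \<noteq> 0"
    unfolding eventually_at_right_field using b by (intro exI[of _ 1]) auto
  ultimately have "filterlim (\<lambda>\<epsilon>. b * \<epsilon>) (at_right 0) (at_right 0)" by (simp add: filterlim_at)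
  from filterlim_compose[OF p_quotient_inner[of "t0 + pi/2"] this]
  have "((\<lambda>\<epsilon>. (p (b * \<epsilon>) \<bullet> k) / (b * \<epsilon>)) \<longlongrightarrow> cos (\<alpha> - (t0 + pi/2))) (at_right 0)" by (simp add: k_def)
  then have "(h \<longlongrightarrow> - (b * cos (\<alpha> - (t0 + pi/2))) - K * b\<^sup>2 * 0) (at_right 0)"
    unfolding h_def by (intro tendsto_intros)
  moreover have "cos (\<alpha> - (t0 + pi/2)) = sin (\<alpha> - t0)" by (simp add: cos_diff sin_diff cos_add sin_add)
  ultimately have "((\<lambda>\<epsilon>. ereal (h \<epsilon>)) \<longlongrightarrow> ereal (- b * sin (\<alpha> - t0))) (at_right 0)" by simp
  then have "ereal (- b * sin (\<alpha> - t0)) = Liminf (at_right 0) (\<lambda>\<epsilon>. ereal (h \<epsilon>))"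
    by (intro lim_imp_Liminf[symmetric]) auto
  also have "\<dots> \<le> Liminf (at_right 0) (\<lambda>\<epsilon>. ereal (1 / \<epsilon> * integral {0..b * \<epsilon>} c))"
  proof (rule Liminf_mono)
    have "h \<epsilon> \<le> 1 / \<epsilon> * integral {0..b * \<epsilon>} c" if e: "0 < \<epsilon>" "\<epsilon> < s1 / b" for \<epsilon>
    proof -
      have "0 < b * \<epsilon>" "b * \<epsilon> < s1" using e b by (auto simp: less_divide_eq mult.commute)
      from ineq[OF this] have "1 / \<epsilon> * (- (p (b * \<epsilon>) \<bullet> k) - K * (b * \<epsilon>)\<^sup>2) \<le> 1 / \<epsilon> * integral {0..b * \<epsilon>} c"
        using e by (intro mult_left_mono) auto
      moreover have "1 / \<epsilon> * (- (p (b * \<epsilon>) \<bullet> k) - K * (b * \<epsilon>)\<^sup>2) = h \<epsilon>"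
        using e b by (simp add: h_def field_simps power2_eq_square)
      ultimately show ?thesis by simp
    qed
    then show "\<forall>\<^sub>F \<epsilon> in at_right 0. ereal (h \<epsilon>) \<le> ereal (1 / \<epsilon> * integral {0..b * \<epsilon>} c)"
      unfolding eventually_at_right_field using s1 b by (intro exI[of _ "s1 / b"]) auto
  qed
  finally show ?thesis .
qed

text \<open>
  A direction \<open>\<theta>1\<close> at which \<open>R\<close> increases and with \<open>\<alpha> - \<theta>1 < arccos m\<close> is impossible: as \<open>e = dir \<sigma> t\<close>
  turns towards the normal of the ray \<open>\<theta>1\<close>, the lower bound for the averages tends to
  \<open>cos (\<alpha> - \<theta>1) > m\<close>.
\<close>

lemma fan_size_ge_arccos:
  fixes c :: "real \<Rightarrow> real"
  assumes cf: "capillary_field \<Omega> C f g T DT" and M: "\<And>x. x \<in> \<Omega> \<Longrightarrow> \<bar>f x\<bar> \<le> M"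
    and \<nu>: "\<And>s. 0 < s \<Longrightarrow> s < L \<Longrightarrow> exterior_unit_normal \<Omega> p s (\<nu> s)"
    and lim: "\<And>s. 0 < s \<Longrightarrow> s < L \<Longrightarrow> nontangential_limit \<Omega> (\<lambda>x. T x \<bullet> \<nu> s) (p s) (c s)"
    and c_meas: "c \<in> borel_measurable (lebesgue_on {0..<L})" and c_le: "\<And>s. \<bar>c s\<bar> \<le> 1"
    and R: "\<And>\<theta>. - \<alpha> < \<theta> \<Longrightarrow> \<theta> < \<alpha> \<Longrightarrow> ((\<lambda>r. f (r *\<^sub>R dir \<sigma> \<theta>)) \<longlongrightarrow> R \<theta>) (at_right 0)"
    and edge: "\<And>\<eta>. 0 < \<eta> \<Longrightarrow> \<exists>\<theta>1 \<theta>2. - \<alpha> < \<theta>1 \<and> \<beta> - \<eta> < \<theta>1 \<and> \<theta>1 < \<theta>2 \<and> \<theta>2 < \<alpha> \<and> R \<theta>1 < R \<theta>2"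
    and b: "0 < b" and A: "Liminf (at_right 0) (\<lambda>\<epsilon>. ereal (1 / \<epsilon> * integral {0..b * \<epsilon>} c)) \<le> ereal (m * b)"
    and m: "m \<in> {-1..1}"
  shows "arccos m \<le> \<alpha> - \<beta>"
proof (rule ccontr)
  assume "\<not> arccos m \<le> \<alpha> - \<beta>"
  then have "0 < arccos m - (\<alpha> - \<beta>)" by simp
  from edge[OF this] obtain \<theta>1 \<theta>2 where \<theta>: "- \<alpha> < \<theta>1" "\<theta>1 < \<theta>2" "\<theta>2 < \<alpha>" "R \<theta>1 < R \<theta>2"
    and \<beta>: "\<alpha> - \<theta>1 < arccos m" by (auto simp: algebra_simps)
  have ub: "arccos m \<le> pi" using m by (intro arccos_ubound) auto
  have "- sin (\<alpha> - t) \<le> m" if t: "\<alpha> - pi/2 < t" "t < \<theta>1 + pi/2" for t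
  proof -
    have t': "\<bar>\<alpha> - t\<bar> < pi/2" "t - pi/2 < \<theta>1" using t \<theta> unfolding abs_less_iff by linarith+
    have "ereal (- b * sin (\<alpha> - t)) \<le> ereal (m * b)"
      using liminf_lower_bound[OF cf M \<nu> lim c_meas c_le t'(1) \<theta>(1-3) t'(2) R R \<theta>(4) b] \<theta> A
      by (meson less_trans order_trans)
    then have "b * (- sin (\<alpha> - t)) \<le> b * m" by (simp add: mult.commute)
    then show ?thesis using b by (simp only: mult_le_cancel_left_pos)
  qed
  then have "\<forall>\<^sub>F t in at_left (\<theta>1 + pi/2). - sin (\<alpha> - t) \<le> m"
    unfolding eventually_at_left_field using \<beta> ub by (intro exI[of _ "\<alpha> - pi/2"]) auto
  moreover have "((\<lambda>t. - sin (\<alpha> - t)) \<longlongrightarrow> - sin (\<alpha> - (\<theta>1 + pi/2))) (at_left (\<theta>1 + pi/2))"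
    by (intro tendsto_intros)
  ultimately have "- sin (\<alpha> - (\<theta>1 + pi/2)) \<le> m"
    by (intro tendsto_upperbound[where F = "at_left (\<theta>1 + pi/2)"]) (auto simp: trivial_limit_at_left_real)
  moreover have "- sin (\<alpha> - (\<theta>1 + pi/2)) = cos (\<alpha> - \<theta>1)"
    by (simp add: cos_diff sin_diff cos_add sin_add)
  moreover have "cos (arccos m) < cos (\<alpha> - \<theta>1)"
    using \<theta> \<beta> ub by (intro cos_monotone_0_pi) auto
  ultimately show False using m by simp
qed

text \<open>
  The decreasing case is the increasing case for \<open>- f\<close>, whose contact angle is \<open>\<pi> - \<gamma>\<close>.
\<close>

lemma fan_bounds:
  fixes \<gamma> :: "real \<Rightarrow> real"
  assumes sol: "capillary_solution \<Omega> \<kappa> lam f" and bd: "bounded (f ` \<Omega>)"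
    and \<nu>: "\<And>s. 0 < s \<Longrightarrow> s < L \<Longrightarrow> exterior_unit_normal \<Omega> p s (\<nu> s)"
    and lim: "\<And>s. 0 < s \<Longrightarrow> s < L \<Longrightarrow> nontangential_limit \<Omega> (\<lambda>x. T_op f x \<bullet> \<nu> s) (p s) (cos (\<gamma> s))"
    and meas: "\<gamma> \<in> borel_measurable (lebesgue_on {0..<L})"
    and R: "\<And>\<theta>. - \<alpha> < \<theta> \<Longrightarrow> \<theta> < \<alpha> \<Longrightarrow> ((\<lambda>r. f (r *\<^sub>R dir \<sigma> \<theta>)) \<longlongrightarrow> R \<theta>) (at_right 0)"
    and m: "m \<in> {-1..1}"
  shows fan_bound_inc: "\<lbrakk>\<And>\<eta>. 0 < \<eta> \<Longrightarrow> \<exists>\<theta>1 \<theta>2. - \<alpha> < \<theta>1 \<and> \<beta> - \<eta> < \<theta>1 \<and> \<theta>1 < \<theta>2 \<and> \<theta>2 < \<alpha> \<and> R \<theta>1 < R \<theta>2;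
            \<And>b. 0 < b \<Longrightarrow> b < 1 \<Longrightarrow> A_I \<gamma> b \<le> ereal (m * b)\<rbrakk> \<Longrightarrow> arccos m \<le> \<alpha> - \<beta>"
    and fan_bound_dec: "\<lbrakk>\<And>\<eta>. 0 < \<eta> \<Longrightarrow> \<exists>\<theta>1 \<theta>2. - \<alpha> < \<theta>1 \<and> \<beta> - \<eta> < \<theta>1 \<and> \<theta>1 < \<theta>2 \<and> \<theta>2 < \<alpha> \<and> R \<theta>2 < R \<theta>1;
            \<And>b. 0 < b \<Longrightarrow> b < 1 \<Longrightarrow> ereal (m * b) \<le> A_S \<gamma> b\<rbrakk> \<Longrightarrow> pi - arccos m \<le> \<alpha> - \<beta>"
proof -
  obtain M where "\<And>x. x \<in> \<Omega> \<Longrightarrow> \<bar>f x\<bar> \<le> M" using bd unfolding bounded_iff by auto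
  then have M: "\<bar>f x\<bar> \<le> max 0 M" if "x \<in> \<Omega>" for x using that by fastforce
  note cf = capillary_solution_field[OF open_\<Omega> sol M max.cobounded1]
  have meas': "(\<lambda>s. cos (\<gamma> s)) \<in> borel_measurable (lebesgue_on {0..<L})"
    by (rule measurable_compose[OF meas borel_measurable_continuous_onI]) (intro continuous_intros)
  then have meas'': "(\<lambda>s. - cos (\<gamma> s)) \<in> borel_measurable (lebesgue_on {0..<L})" by simp
  show "arccos m \<le> \<alpha> - \<beta>"
    if edge: "\<And>\<eta>. 0 < \<eta> \<Longrightarrow> \<exists>\<theta>1 \<theta>2. - \<alpha> < \<theta>1 \<and> \<beta> - \<eta> < \<theta>1 \<and> \<theta>1 < \<theta>2 \<and> \<theta>2 < \<alpha> \<and> R \<theta>1 < R \<theta>2"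
      and A: "\<And>b. 0 < b \<Longrightarrow> b < 1 \<Longrightarrow> A_I \<gamma> b \<le> ereal (m * b)"
  proof (rule fan_size_ge_arccos[OF cf M \<nu> lim meas' _ R edge _ _ m])
    show "Liminf (at_right 0) (\<lambda>\<epsilon>. ereal (1 / \<epsilon> * integral {0..1/2 * \<epsilon>} (\<lambda>s. cos (\<gamma> s)))) \<le> ereal (m * (1/2))"
      using A[of "1/2"] by (simp add: A_I_def)
  qed simp_all
  show "pi - arccos m \<le> \<alpha> - \<beta>"
    if edge: "\<And>\<eta>. 0 < \<eta> \<Longrightarrow> \<exists>\<theta>1 \<theta>2. - \<alpha> < \<theta>1 \<and> \<beta> - \<eta> < \<theta>1 \<and> \<theta>1 < \<theta>2 \<and> \<theta>2 < \<alpha> \<and> R \<theta>2 < R \<theta>1"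
      and A: "\<And>b. 0 < b \<Longrightarrow> b < 1 \<Longrightarrow> ereal (m * b) \<le> A_S \<gamma> b"
  proof -
    have "arccos (- m) \<le> \<alpha> - \<beta>"
    proof (rule fan_size_ge_arccos[OF capillary_field.uminus[OF cf] _ \<nu> _ meas'', where R = "\<lambda>\<theta>. - R \<theta>" and M = "max 0 M" and b = "1/2"])
      show "\<bar>- f x\<bar> \<le> max 0 M" if "x \<in> \<Omega>" for x using M[OF that] by simp
      show "nontangential_limit \<Omega> (\<lambda>x. - T_op f x \<bullet> \<nu> s) (p s) (- cos (\<gamma> s))" if "0 < s" "s < L" for s
        using lim[OF that] unfolding nontangential_limit_def inner_minus_left by (intro allI tendsto_minus) blast
      show "((\<lambda>r. - f (r *\<^sub>R dir \<sigma> \<theta>)) \<longlongrightarrow> - R \<theta>) (at_right 0)" if "- \<alpha> < \<theta>" "\<theta> < \<alpha>" for \<theta>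
        by (rule tendsto_minus[OF R[OF that]])
      show "\<exists>\<theta>1 \<theta>2. - \<alpha> < \<theta>1 \<and> \<beta> - \<eta> < \<theta>1 \<and> \<theta>1 < \<theta>2 \<and> \<theta>2 < \<alpha> \<and> - R \<theta>1 < - R \<theta>2" if "0 < \<eta>" for \<eta>
        using edge[OF that] by simp
      have "Liminf (at_right 0) (\<lambda>\<epsilon>. - ereal (1 / \<epsilon> * integral {0..1/2 * \<epsilon>} (\<lambda>s. cos (\<gamma> s)))) = - A_S \<gamma> (1/2)"
        unfolding A_S_def by (rule ereal_Liminf_uminus)
      also have "\<dots> \<le> - ereal (m * (1/2))" using A[of "1/2"] by (simp only: ereal_minus_le_minus)
      finally show "Liminf (at_right 0) (\<lambda>\<epsilon>. ereal (1 / \<epsilon> * integral {0..1/2 * \<epsilon>} (\<lambda>s. - cos (\<gamma> s)))) \<le> ereal (- m * (1/2))"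
        by simp
    qed (use m in auto)
    then show ?thesis using arccos_minus[of m] m by simp
  qed
qed

end

text \<open>
  All that matters about the cases (I), (D), (ID), (DI) is that, up to sign and reflection, \<open>R\<close> strictly increases between two
  directions arbitrarily close to the edge \<open>\<beta>\<close> of the full side fan. Here \<open>\<beta> = \<alpha>\<close> is allowed, which is
  the case of an empty fan.
\<close>

lemma fan_edge:
  fixes R :: "real \<Rightarrow> real"
  assumes c: "- \<alpha> \<le> c" "c < \<beta>" "\<beta> \<le> \<alpha>"
    and mono: "\<And>x y. c \<le> x \<Longrightarrow> x \<le> y \<Longrightarrow> y \<le> \<beta> \<Longrightarrow> - \<alpha> < x \<Longrightarrow> y < \<alpha> \<Longrightarrow> R x \<le> R y"
    and const: "\<And>x y. \<beta> \<le> x \<Longrightarrow> x < \<alpha> \<Longrightarrow> \<beta> \<le> y \<Longrightarrow> y < \<alpha> \<Longrightarrow> R x = R y"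
    and nconst: "\<And>a. - \<alpha> < a \<Longrightarrow> a < \<beta> \<Longrightarrow> \<exists>y. a \<le> y \<and> y < \<alpha> \<and> R y \<noteq> R a"
    and \<eta>: "0 < \<eta>"
  shows "\<exists>\<theta>1 \<theta>2. - \<alpha> < \<theta>1 \<and> \<beta> - \<eta> < \<theta>1 \<and> \<theta>1 < \<theta>2 \<and> \<theta>2 < \<alpha> \<and> R \<theta>1 < R \<theta>2"
proof -
  obtain a where a: "max c (\<beta> - \<eta>) < a" "a < \<beta>" using dense[of "max c (\<beta> - \<eta>)" \<beta>] c \<eta> by auto
  then obtain y where y: "a \<le> y" "y < \<alpha>" "R y \<noteq> R a" using nconst[of a] c by auto
  \<comment> \<open>A value beyond the edge of the fan is also taken at the edge.\<close>
  define z where "z = min y \<beta>"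
  have z: "a \<le> z" "z \<le> \<beta>" "z < \<alpha>" using a y by (auto simp: z_def)
  have "R z = R y" using const[of \<beta> y] y by (cases "y \<le> \<beta>") (auto simp: z_def)
  moreover have "R a \<le> R z" using a z c by (intro mono) auto
  ultimately have "R a < R z" "a \<noteq> z" using y by auto
  then show ?thesis using a z c by (intro exI[of _ a] exI[of _ z]) auto
qed

section \<open>The radial limits at the edges of the side fans\<close>

lemma corner_domain_sides:
  assumes dom: "corner_domain \<Omega> \<alpha> \<delta> pp Lp pm Lm" and \<alpha>: "0 < \<alpha>"
  obtains \<rho> \<theta>p \<theta>m where "corner_side \<Omega> 1 \<alpha> \<delta> Lp \<rho> pp \<theta>p \<theta>m"
    "corner_side \<Omega> (-1) \<alpha> \<delta> Lm \<rho> pm (\<lambda>r. - \<theta>m r) (\<lambda>r. - \<theta>p r)"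
proof -
  have base: "open \<Omega>" "0 \<in> frontier \<Omega>" "boundary_arc \<delta> \<alpha> pp Lp" "boundary_arc \<delta> (- \<alpha>) pm Lm"
    using dom unfolding corner_domain_def by blast+
  from dom obtain \<rho> \<theta>p \<theta>m where \<rho>: "\<rho> > 0"
    and lp: "(\<theta>p \<longlongrightarrow> \<alpha>) (at_right 0)" and lm: "(\<theta>m \<longlongrightarrow> - \<alpha>) (at_right 0)"
    and on: "\<And>r. r \<in> {0<..<\<rho>} \<Longrightarrow> polar r (\<theta>p r) \<in> pp ` {0..<Lp} \<and> polar r (\<theta>m r) \<in> pm ` {0..<Lm}"
    and eq: "\<Omega> \<inter> ball 0 \<rho> = {polar r \<theta> | r \<theta>. 0 < r \<and> r < \<rho> \<and> \<theta>m r < \<theta> \<and> \<theta> < \<theta>p r}"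
    unfolding corner_domain_def by blast
  have ins: "polar r \<theta> \<in> \<Omega>" if "0 < r" "r < \<rho>" "\<theta>m r < \<theta>" "\<theta> < \<theta>p r" for r \<theta>
    using eq that by blast
  have pol: "r *\<^sub>R dir 1 \<theta> = polar r \<theta>" "r *\<^sub>R dir (-1) \<theta> = polar r (- \<theta>)" for r \<theta>
    by (simp_all add: dir_def polar_def)
  have lm': "((\<lambda>r. - \<theta>m r) \<longlongrightarrow> \<alpha>) (at_right 0)" using tendsto_minus[OF lm] by simp
  show thesis
  proof (rule that)
    show "corner_side \<Omega> 1 \<alpha> \<delta> Lp \<rho> pp \<theta>p \<theta>m"
      by unfold_locales (use base \<alpha> \<rho> lp lm on ins in \<open>simp_all add: pol\<close>)
    show "corner_side \<Omega> (-1) \<alpha> \<delta> Lm \<rho> pm (\<lambda>r. - \<theta>m r) (\<lambda>r. - \<theta>p r)"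
      by unfold_locales (use base \<alpha> \<rho> lm' tendsto_minus[OF lp] on ins in \<open>simp_all add: pol\<close>)
  qed
qed

lemma side_fans_right:
  assumes "side_fans \<alpha> R \<alpha>1 \<alpha>2"
  shows "\<And>x y. \<alpha>2 \<le> x \<Longrightarrow> x < \<alpha> \<Longrightarrow> \<alpha>2 \<le> y \<Longrightarrow> y < \<alpha> \<Longrightarrow> R x = R y"
    and "\<And>a. - \<alpha> < a \<Longrightarrow> a < \<alpha>2 \<Longrightarrow> \<exists>y. a \<le> y \<and> y < \<alpha> \<and> R y \<noteq> R a"
proof -
  show "R x = R y" if "\<alpha>2 \<le> x" "x < \<alpha>" "\<alpha>2 \<le> y" "y < \<alpha>" for x y
    using assms that unfolding side_fans_def constant_on_def by (metis atLeastLessThan_iff)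
  show "\<exists>y. a \<le> y \<and> y < \<alpha> \<and> R y \<noteq> R a" if "- \<alpha> < a" "a < \<alpha>2" for a
  proof -
    have "\<not> R constant_on {a..<\<alpha>}" using assms that unfolding side_fans_def by simp
    then show ?thesis unfolding constant_on_def by (metis atLeastLessThan_iff)
  qed
qed

lemma side_fans_left:
  assumes "side_fans \<alpha> R \<alpha>1 \<alpha>2"
  shows "\<And>x y. - \<alpha>1 \<le> x \<Longrightarrow> x < \<alpha> \<Longrightarrow> - \<alpha>1 \<le> y \<Longrightarrow> y < \<alpha> \<Longrightarrow> R (- x) = R (- y)"
    and "\<And>a. - \<alpha> < a \<Longrightarrow> a < - \<alpha>1 \<Longrightarrow> \<exists>y. a \<le> y \<and> y < \<alpha> \<and> R (- y) \<noteq> R (- a)"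
proof -
  obtain K where K: "\<And>x. x \<in> {- \<alpha><..\<alpha>1} \<Longrightarrow> R x = K"
    using assms unfolding side_fans_def constant_on_def by blast
  show "R (- x) = R (- y)" if "- \<alpha>1 \<le> x" "x < \<alpha>" "- \<alpha>1 \<le> y" "y < \<alpha>" for x y
    using K[of "- x"] K[of "- y"] that by simp
  show "\<exists>y. a \<le> y \<and> y < \<alpha> \<and> R (- y) \<noteq> R (- a)" if a: "- \<alpha> < a" "a < - \<alpha>1" for a
  proof -
    have "- a \<in> {\<alpha>1<..<\<alpha>}" using a by simp
    then have "\<not> R constant_on {- \<alpha><..- a}" using assms unfolding side_fans_def by blast
    then obtain x where "x \<in> {- \<alpha><..- a}" "R x \<noteq> R (- a)" unfolding constant_on_def by blast
    then show ?thesis by (intro exI[of _ "- x"]) auto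
  qed
qed

lemma strict_antimono_on_imp_antimono_on:
  fixes R :: "real \<Rightarrow> real"
  shows "strict_antimono_on A R \<Longrightarrow> antimono_on A R"
  unfolding monotone_on_def by (metis order_le_less order_refl)

text \<open>
  The four kinds of fan edges. The edge \<open>\<alpha>1\<close> on the left becomes the edge \<open>-\<alpha>1\<close> on the right of the
  reflected function \<open>R(-\<theta>)\<close>.
\<close>

lemma increasing_right_edge:
  assumes "case_I \<alpha> R \<alpha>1 \<alpha>2 \<or> case_DI \<alpha> R \<alpha>1 \<alpha>2" and "0 < \<eta>"
  shows "\<exists>\<theta>1 \<theta>2. - \<alpha> < \<theta>1 \<and> \<alpha>2 - \<eta> < \<theta>1 \<and> \<theta>1 < \<theta>2 \<and> \<theta>2 < \<alpha> \<and> R \<theta>1 < R \<theta>2"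
proof -
  obtain c where c: "- \<alpha> \<le> c" "c < \<alpha>2" "\<alpha>2 \<le> \<alpha>" "side_fans \<alpha> R \<alpha>1 \<alpha>2"
    and mono: "mono_on ({c..\<alpha>2} \<inter> {-\<alpha><..<\<alpha>}) R"
    using assms(1)
  proof (elim disjE)
    assume "case_I \<alpha> R \<alpha>1 \<alpha>2"
    then show thesis
      unfolding case_I_def by (intro that[of "\<alpha>1"]) (auto dest: strict_mono_on_imp_mono_on)
  next
    assume "case_DI \<alpha> R \<alpha>1 \<alpha>2"
    then obtain \<alpha>L \<alpha>R where "- \<alpha> \<le> \<alpha>1" "\<alpha>1 < \<alpha>L" "\<alpha>L < \<alpha>R" "\<alpha>R < \<alpha>2" "\<alpha>2 \<le> \<alpha>" "side_fans \<alpha> R \<alpha>1 \<alpha>2"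
      "mono_on ({\<alpha>R..\<alpha>2} \<inter> {-\<alpha><..<\<alpha>}) R"
      unfolding case_DI_def by blast
    then show thesis by (intro that[of "\<alpha>R"]) auto
  qed
  show ?thesis
    by (rule fan_edge[OF c(1-3) _ side_fans_right[OF c(4)] assms(2)]) (auto intro: mono_onD[OF mono])
qed

lemma decreasing_right_edge:
  assumes "case_D \<alpha> R \<alpha>1 \<alpha>2 \<or> case_ID \<alpha> R \<alpha>1 \<alpha>2" and "0 < \<eta>"
  shows "\<exists>\<theta>1 \<theta>2. - \<alpha> < \<theta>1 \<and> \<alpha>2 - \<eta> < \<theta>1 \<and> \<theta>1 < \<theta>2 \<and> \<theta>2 < \<alpha> \<and> R \<theta>2 < R \<theta>1"
proof -
  obtain c where c: "- \<alpha> \<le> c" "c < \<alpha>2" "\<alpha>2 \<le> \<alpha>" "side_fans \<alpha> R \<alpha>1 \<alpha>2"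
    and mono: "antimono_on ({c..\<alpha>2} \<inter> {-\<alpha><..<\<alpha>}) R"
    using assms(1)
  proof (elim disjE)
    assume "case_D \<alpha> R \<alpha>1 \<alpha>2"
    then show thesis
      unfolding case_D_def by (intro that[of "\<alpha>1"]) (auto dest: strict_antimono_on_imp_antimono_on)
  next
    assume "case_ID \<alpha> R \<alpha>1 \<alpha>2"
    then obtain \<alpha>L \<alpha>R where "- \<alpha> \<le> \<alpha>1" "\<alpha>1 < \<alpha>L" "\<alpha>L < \<alpha>R" "\<alpha>R < \<alpha>2" "\<alpha>2 \<le> \<alpha>" "side_fans \<alpha> R \<alpha>1 \<alpha>2"
      "antimono_on ({\<alpha>R..\<alpha>2} \<inter> {-\<alpha><..<\<alpha>}) R"
      unfolding case_ID_def by blast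
    then show thesis by (intro that[of "\<alpha>R"]) auto
  qed
  have "\<exists>\<theta>1 \<theta>2. - \<alpha> < \<theta>1 \<and> \<alpha>2 - \<eta> < \<theta>1 \<and> \<theta>1 < \<theta>2 \<and> \<theta>2 < \<alpha> \<and> - R \<theta>1 < - R \<theta>2"
  proof (rule fan_edge[OF c(1-3) _ _ _ assms(2)])
    show "- R x \<le> - R y" if "c \<le> x" "x \<le> y" "y \<le> \<alpha>2" "- \<alpha> < x" "y < \<alpha>" for x y
      using monotone_onD[OF mono, of x y] that by simp
    show "- R x = - R y" if "\<alpha>2 \<le> x" "x < \<alpha>" "\<alpha>2 \<le> y" "y < \<alpha>" for x y
      using side_fans_right(1)[OF c(4) that] by simp
    show "\<exists>y\<ge>a. y < \<alpha> \<and> - R y \<noteq> - R a" if "- \<alpha> < a" "a < \<alpha>2" for a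
      using side_fans_right(2)[OF c(4) that] by simp
  qed
  then show ?thesis by simp
qed

lemma decreasing_left_edge:
  assumes "case_D \<alpha> R \<alpha>1 \<alpha>2 \<or> case_DI \<alpha> R \<alpha>1 \<alpha>2" and "0 < \<eta>"
  shows "\<exists>\<theta>1 \<theta>2. - \<alpha> < \<theta>1 \<and> - \<alpha>1 - \<eta> < \<theta>1 \<and> \<theta>1 < \<theta>2 \<and> \<theta>2 < \<alpha> \<and> R (- \<theta>1) < R (- \<theta>2)"
proof -
  obtain c where c: "- \<alpha> \<le> - c" "- c < - \<alpha>1" "- \<alpha>1 \<le> \<alpha>" "side_fans \<alpha> R \<alpha>1 \<alpha>2"
    and mono: "antimono_on ({\<alpha>1..c} \<inter> {-\<alpha><..<\<alpha>}) R"
    using assms(1)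
  proof (elim disjE)
    assume "case_D \<alpha> R \<alpha>1 \<alpha>2"
    then show thesis
      unfolding case_D_def by (intro that[of "\<alpha>2"]) (auto dest: strict_antimono_on_imp_antimono_on)
  next
    assume "case_DI \<alpha> R \<alpha>1 \<alpha>2"
    then obtain \<alpha>L \<alpha>R where "- \<alpha> \<le> \<alpha>1" "\<alpha>1 < \<alpha>L" "\<alpha>L < \<alpha>R" "\<alpha>R < \<alpha>2" "\<alpha>2 \<le> \<alpha>" "side_fans \<alpha> R \<alpha>1 \<alpha>2"
      "antimono_on ({\<alpha>1..\<alpha>L} \<inter> {-\<alpha><..<\<alpha>}) R"
      unfolding case_DI_def by blast
    then show thesis by (intro that[of "\<alpha>L"]) auto
  qed
  show ?thesis
    by (rule fan_edge[OF c(1-3) _ side_fans_left[OF c(4)] assms(2)])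
       (auto intro: monotone_onD[OF mono])
qed

lemma increasing_left_edge:
  assumes "case_I \<alpha> R \<alpha>1 \<alpha>2 \<or> case_ID \<alpha> R \<alpha>1 \<alpha>2" and "0 < \<eta>"
  shows "\<exists>\<theta>1 \<theta>2. - \<alpha> < \<theta>1 \<and> - \<alpha>1 - \<eta> < \<theta>1 \<and> \<theta>1 < \<theta>2 \<and> \<theta>2 < \<alpha> \<and> R (- \<theta>2) < R (- \<theta>1)"
proof -
  obtain c where c: "- \<alpha> \<le> - c" "- c < - \<alpha>1" "- \<alpha>1 \<le> \<alpha>" "side_fans \<alpha> R \<alpha>1 \<alpha>2"
    and mono: "mono_on ({\<alpha>1..c} \<inter> {-\<alpha><..<\<alpha>}) R"
    using assms(1)
  proof (elim disjE)
    assume "case_I \<alpha> R \<alpha>1 \<alpha>2"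
    then show thesis
      unfolding case_I_def by (intro that[of "\<alpha>2"]) (auto dest: strict_mono_on_imp_mono_on)
  next
    assume "case_ID \<alpha> R \<alpha>1 \<alpha>2"
    then obtain \<alpha>L \<alpha>R where "- \<alpha> \<le> \<alpha>1" "\<alpha>1 < \<alpha>L" "\<alpha>L < \<alpha>R" "\<alpha>R < \<alpha>2" "\<alpha>2 \<le> \<alpha>" "side_fans \<alpha> R \<alpha>1 \<alpha>2"
      "mono_on ({\<alpha>1..\<alpha>L} \<inter> {-\<alpha><..<\<alpha>}) R"
      unfolding case_ID_def by blast
    then show thesis by (intro that[of "\<alpha>L"]) auto
  qed
  have "\<exists>\<theta>1 \<theta>2. - \<alpha> < \<theta>1 \<and> - \<alpha>1 - \<eta> < \<theta>1 \<and> \<theta>1 < \<theta>2 \<and> \<theta>2 < \<alpha> \<and> - R (- \<theta>1) < - R (- \<theta>2)"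
  proof (rule fan_edge[OF c(1-3) _ _ _ assms(2)])
    show "- R (- x) \<le> - R (- y)" if "- c \<le> x" "x \<le> y" "y \<le> - \<alpha>1" "- \<alpha> < x" "y < \<alpha>" for x y
      using monotone_onD[OF mono, of "- y" "- x"] that by simp
    show "- R (- x) = - R (- y)" if "- \<alpha>1 \<le> x" "x < \<alpha>" "- \<alpha>1 \<le> y" "y < \<alpha>" for x y
      using side_fans_left(1)[OF c(4) that] by simp
    show "\<exists>y\<ge>a. y < \<alpha> \<and> - R (- y) \<noteq> - R (- a)" if "- \<alpha> < a" "a < - \<alpha>1" for a
      using side_fans_left(2)[OF c(4) that] by simp
  qed
  then show ?thesis by simp
qed

theorem corollary1:
  fixes \<Omega> :: "(real \<times> real) set"
    and \<alpha> \<delta> Lp Lm \<kappa> lam m \<sigma> :: real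
    and pp pm :: "real \<Rightarrow> real \<times> real"
    and \<nu> :: "real \<times> real \<Rightarrow> real \<times> real"
    and \<gamma> f :: "real \<times> real \<Rightarrow> real"
  assumes "\<alpha> \<in> {0..pi}"
    and "corner_domain \<Omega> \<alpha> \<delta> pp Lp pm Lm"
    and "\<forall>s\<in>{0<..<Lp}. exterior_unit_normal \<Omega> pp s (\<nu> (pp s))"
    and "\<forall>s\<in>{0<..<Lm}. exterior_unit_normal \<Omega> pm s (\<nu> (pm s))"
    and "\<forall>x\<in>frontier \<Omega>. 0 \<le> \<gamma> x \<and> \<gamma> x \<le> pi"
    and "(\<lambda>s. \<gamma> (pp s)) \<in> borel_measurable (lebesgue_on {0..<Lp})"
    and "(\<lambda>s. \<gamma> (pm s)) \<in> borel_measurable (lebesgue_on {0..<Lm})"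
    and "capillary_solution \<Omega> \<kappa> lam f"
    and "bounded (f ` \<Omega>)"
    and "\<forall>s\<in>{0<..<Lp}. nontangential_limit \<Omega> (\<lambda>x. T_op f x \<bullet> \<nu> (pp s)) (pp s) (cos (\<gamma> (pp s)))"
    and "\<forall>s\<in>{0<..<Lm}. nontangential_limit \<Omega> (\<lambda>x. T_op f x \<bullet> \<nu> (pm s)) (pm s) (cos (\<gamma> (pm s)))"
    and "\<not> (\<exists>l. (f \<longlongrightarrow> l) (at 0 within \<Omega>))"
    and "\<forall>\<theta>\<in>{-\<alpha><..<\<alpha>}. radial_limit_exists f \<theta>"
    and "m \<in> {-1..1}"
    and "\<sigma> = arccos m"
  shows
    "(\<forall>\<alpha>1 \<alpha>2. (\<forall>b\<in>{0<..<1}. A_I (\<lambda>s. \<gamma> (pp s)) b \<le> ereal (m * b)) \<and>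
        (case_I \<alpha> (radial_limit f) \<alpha>1 \<alpha>2 \<or> case_DI \<alpha> (radial_limit f) \<alpha>1 \<alpha>2)
        \<longrightarrow> \<alpha> - \<alpha>2 \<ge> \<sigma>) \<and>
     (\<forall>\<alpha>1 \<alpha>2. (\<forall>b\<in>{0<..<1}. A_I (\<lambda>s. \<gamma> (pm s)) b \<le> ereal (m * b)) \<and>
        (case_D \<alpha> (radial_limit f) \<alpha>1 \<alpha>2 \<or> case_DI \<alpha> (radial_limit f) \<alpha>1 \<alpha>2)
        \<longrightarrow> \<alpha>1 + \<alpha> \<ge> \<sigma>) \<and>
     (\<forall>\<alpha>1 \<alpha>2. (\<forall>b\<in>{0<..<1}. A_S (\<lambda>s. \<gamma> (pm s)) b \<ge> ereal (m * b)) \<and>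
        (case_I \<alpha> (radial_limit f) \<alpha>1 \<alpha>2 \<or> case_ID \<alpha> (radial_limit f) \<alpha>1 \<alpha>2)
        \<longrightarrow> \<alpha>1 + \<alpha> \<ge> pi - \<sigma>) \<and>
     (\<forall>\<alpha>1 \<alpha>2. (\<forall>b\<in>{0<..<1}. A_S (\<lambda>s. \<gamma> (pp s)) b \<ge> ereal (m * b)) \<and>
        (case_D \<alpha> (radial_limit f) \<alpha>1 \<alpha>2 \<or> case_ID \<alpha> (radial_limit f) \<alpha>1 \<alpha>2)
        \<longrightarrow> \<alpha> - \<alpha>2 \<ge> pi - \<sigma>)"
proof (cases "0 < \<alpha>")
  case False
  \<comment> \<open>Each of the four cases provides \<open>-\<alpha> < \<alpha>\<close>.\<close>
  then show ?thesis
    unfolding case_I_def case_D_def case_ID_def case_DI_def by fastforce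
next
  case True
  then obtain \<rho> \<theta>p \<theta>m where plus: "corner_side \<Omega> 1 \<alpha> \<delta> Lp \<rho> pp \<theta>p \<theta>m"
    and minus: "corner_side \<Omega> (-1) \<alpha> \<delta> Lm \<rho> pm (\<lambda>r. - \<theta>m r) (\<lambda>r. - \<theta>p r)"
    by (rule corner_domain_sides[OF assms(2)])
  have pol: "r *\<^sub>R dir 1 \<theta> = polar r \<theta>" "r *\<^sub>R dir (-1) \<theta> = polar r (- \<theta>)" for r \<theta>
    by (simp_all add: dir_def polar_def)
  have R: "((\<lambda>r. f (polar r \<theta>)) \<longlongrightarrow> radial_limit f \<theta>) (at_right 0)" if "- \<alpha> < \<theta>" "\<theta> < \<alpha>" for \<theta>
  proof -
    have "\<theta> \<in> {-\<alpha><..<\<alpha>}" using that by simp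
    then obtain l where "((\<lambda>r. f (polar r \<theta>)) \<longlongrightarrow> l) (at_right 0)"
      using assms(13) unfolding radial_limit_exists_def by blast
    then show ?thesis unfolding radial_limit_def by (simp add: tendsto_Lim)
  qed
  have Rp: "((\<lambda>r. f (r *\<^sub>R dir 1 \<theta>)) \<longlongrightarrow> radial_limit f \<theta>) (at_right 0)" if "- \<alpha> < \<theta>" "\<theta> < \<alpha>" for \<theta>
    using R[OF that] by (simp add: pol)
  have Rm: "((\<lambda>r. f (r *\<^sub>R dir (-1) \<theta>)) \<longlongrightarrow> radial_limit f (- \<theta>)) (at_right 0)" if "- \<alpha> < \<theta>" "\<theta> < \<alpha>" for \<theta>
    using R[of "- \<theta>"] that by (simp add: pol)
  have np: "exterior_unit_normal \<Omega> pp s (\<nu> (pp s))"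
       "nontangential_limit \<Omega> (\<lambda>x. T_op f x \<bullet> \<nu> (pp s)) (pp s) (cos (\<gamma> (pp s)))" if "0 < s" "s < Lp" for s
    using assms(3,10) that by auto
  have nm: "exterior_unit_normal \<Omega> pm s (\<nu> (pm s))"
       "nontangential_limit \<Omega> (\<lambda>x. T_op f x \<bullet> \<nu> (pm s)) (pm s) (cos (\<gamma> (pm s)))" if "0 < s" "s < Lm" for s
    using assms(4,11) that by auto
  note plus_bounds = corner_side.fan_bounds[OF plus assms(8,9) np assms(6) Rp assms(14)]
  note minus_bounds = corner_side.fan_bounds[OF minus assms(8,9) nm assms(7) Rm assms(14)]
  show ?thesis
  proof (intro conjI allI impI; elim conjE)
    fix \<alpha>1 \<alpha>2
    assume A: "\<forall>b\<in>{0<..<1}. A_I (\<lambda>s. \<gamma> (pp s)) b \<le> ereal (m * b)"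
      and c: "case_I \<alpha> (radial_limit f) \<alpha>1 \<alpha>2 \<or> case_DI \<alpha> (radial_limit f) \<alpha>1 \<alpha>2"
    show "\<sigma> \<le> \<alpha> - \<alpha>2"
      unfolding assms(15) by (rule plus_bounds(1)) (use A increasing_right_edge[OF c] in auto)
  next
    fix \<alpha>1 \<alpha>2
    assume A: "\<forall>b\<in>{0<..<1}. A_I (\<lambda>s. \<gamma> (pm s)) b \<le> ereal (m * b)"
      and c: "case_D \<alpha> (radial_limit f) \<alpha>1 \<alpha>2 \<or> case_DI \<alpha> (radial_limit f) \<alpha>1 \<alpha>2"
    have "\<sigma> \<le> \<alpha> - (- \<alpha>1)"
      unfolding assms(15) by (rule minus_bounds(1)) (use A decreasing_left_edge[OF c] in auto)
    then show "\<sigma> \<le> \<alpha>1 + \<alpha>" by simp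
  next
    fix \<alpha>1 \<alpha>2
    assume A: "\<forall>b\<in>{0<..<1}. ereal (m * b) \<le> A_S (\<lambda>s. \<gamma> (pm s)) b"
      and c: "case_I \<alpha> (radial_limit f) \<alpha>1 \<alpha>2 \<or> case_ID \<alpha> (radial_limit f) \<alpha>1 \<alpha>2"
    have "pi - \<sigma> \<le> \<alpha> - (- \<alpha>1)"
      unfolding assms(15) by (rule minus_bounds(2)) (use A increasing_left_edge[OF c] in auto)
    then show "pi - \<sigma> \<le> \<alpha>1 + \<alpha>" by simp
  next
    fix \<alpha>1 \<alpha>2
    assume A: "\<forall>b\<in>{0<..<1}. ereal (m * b) \<le> A_S (\<lambda>s. \<gamma> (pp s)) b"
      and c: "case_D \<alpha> (radial_limit f) \<alpha>1 \<alpha>2 \<or> case_ID \<alpha> (radial_limit f) \<alpha>1 \<alpha>2"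
    show "pi - \<sigma> \<le> \<alpha> - \<alpha>2"
      unfolding assms(15) by (rule plus_bounds(2)) (use A decreasing_right_edge[OF c] in auto)
  qed
qed

end
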